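(* Let $0\le\beta\le\alpha\le 1$ with $\beta<1$, and let $(\chi,(\psi_i)_{i\in I_\ast})$ be a wave-packet scattering bank subordinate to the covering $\mathcal Q^{(\alpha,\beta)}$ which satisfies the active core condition (AC) and the uniform active-core regularity condition (R). Then there exist functions $f_j\in L^2(\mathbb R^2)$ with compact Fourier support and $\|f_j\|_{L^2}=1$, compactly supported smooth deformations $\tau_j\in C_c^\infty(\mathbb R^2;\mathbb R^2)$, and a constant $c>0$ independent of $j$, such that, for all sufficiently large $j$, $$\|\tau_j\|_{C^m}\le C_m\,2^{-(1-\beta)j}\qquad\text{for all } m\in\mathbb N_0,$$ with constants $C_m<\infty$ independent of $j$, and $$\|\mathsf S_{\chi,1}(L_{\tau_j}f_j)-\mathsf S_{\chi,1}f_j\|_{\ell^2(L^2)}\ge c .$$ Moreover, for the linear filter map $\mathcal W$ one also has $\|[\mathcal W,L_{\tau_j}]f_j\|_{\ell^2(L^2)}\ge c$ for all sufficiently large $j$. If, in addition, the active-core sequence $(i_j,\xi_j)_{j\ge j_0}$ and the radius $r_0>0$ can be chosen so that (AC) (together with (R)) holds with $c_{\rm act}=1$, then the functions $f_j$ above can be taken so that moreover they have uniformly bounded mixed scattering norm, $$\sup_{j\ge j_0}\sum_{n=0}^\infty\|U_nf_j\|_{\ell^2(L^2)}<\infty .$$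
   Context: Notation: $\mathbb N=\{1,2,\dots\}$, $\mathbb N_0=\{0,1,2,\dots\}$; $\widehat f(\xi)=\int_{\mathbb R^2}e^{-2\pi \mathrm i x\cdot\xi}f(x)\,dx$; $B_r(x_0)$ is the open ball; $X\asymp Y$ means two-sided bounds with constants independent of $j$. For a vector field $\tau:\mathbb R^2\to\mathbb R^2$, $L_\tau f(x)=f(x-\tau(x))$ (applied componentwise to families of functions), and $\|\tau\|_{C^m}=\sum_{|\nu|\le m}\|\partial^\nu\tau\|_{L^\infty}$. For a countable family $q=(q_p)_p$, $\|q\|_{\ell^2(L^2)}=(\sum_p\|q_p\|_{L^2}^2)^{1/2}$. Covering. Fix $0\le\beta\le\alpha\le1$ and $\varepsilon_0\in(0,1/32)$. Let $Q=(-\varepsilon_0,1+\varepsilon_0)\times(-1-\varepsilon_0,1+\varepsilon_0)$ and $P=[0,1]\times[-1,1]$. For $j\in\mathbb N$ let $m_j^{\max}=\lceil 2^{(1-\alpha)j-1}\rceil$, $\ell_j^{\max}=\lceil 10\cdot2^{(1-\beta)j}\rceil$, $A_j=\mathrm{diag}(2^{\alpha j},2^{\beta j})$, $c_{j,m}=(2^{j-1}+m2^{\alpha j},0)^\top$, and let $R_{j,\ell}$ be the rotation matrix by the angle $\theta_{j,\ell}=2\ell\cdot\frac{\pi}{10}2^{(\beta-1)j}$. Put $I_\ast=\{(j,m,\ell)\in\mathbb N\times\mathbb N_0\times\mathbb N_0: m\le m_j^{\max},\ \ell\le\ell_j^{\max}\}$, $I=\{0\}\cup I_\ast$, and for $i=(j,m,\ell)\in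 I_\ast$, $Q_i=R_{j,\ell}(A_jQ+c_{j,m})$, $P_i=R_{j,\ell}(A_jP+c_{j,m})$; also $Q_0=B_4(0)$, $P_0=B_3(0)$. The covering is $\mathcal Q^{(\alpha,\beta)}=(Q_i)_{i\in I}$. Filter bank. A wave-packet scattering bank subordinate to $\mathcal Q^{(\alpha,\beta)}$ consists of $\chi\in L^1\cap L^2(\mathbb R^2)$ and $\psi_i\in L^1\cap L^2(\mathbb R^2)$, $i\in I_\ast$, with $m_i:=\widehat\psi_i$, such that $|\widehat\chi(\xi)|^2+\sum_{i\in I_\ast}|m_i(\xi)|^2=1$ for a.e. $\xi$, $\operatorname{supp}\widehat\chi\subset Q_0$ and $\operatorname{supp}m_i\subset Q_i$ for all $i\in I_\ast$. Scattering. $U[e]f=f$ for the empty path $e$; for $p=(i_1,\dots,i_n)\in I_\ast^n$, $U[p]f=U[i_n]\cdots U[i_1]f$ with $U[i]g=|g*\psi_i|$; $U_nf=(U[p]f)_{p\in I_\ast^n}$ with $I_\ast^0=\{e\}$. First layer: $\mathsf S_{\chi,1}f=(|f*\psi_i|*\chi)_{i\in I_\ast}$. Linear filter map: $\mathcal Wf=(f*\chi,(f*\psi_i)_{i\in I_\ast})$, $[\mathcal W,L_\tau]f=\mathcal W(L_\tau f)-L_\tau(\mathcal Wf)$. Active-core system (exists whenever $\beta<1$; one is fixed): $j_0\in\mathbb N$, $r_0>0$, indices $i_j\in I_\ast$, points $\xi_j\in P_{i_j}$ and matrices $M_j\in\mathbb R^{2\times2}$, $j\ge j_0$, with $|\xi_j|\asymp2^j$,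 $B_{r_0}(\xi_j)\subset P_{i_j}\subset Q_{i_j}$, $\|M_j\|\asymp2^{-(1-\beta)j}$, $\mathrm{Id}-M_j$ invertible, and, for every $0<\rho\le r_0$ and $i\in I$: $Q_i\cap B_\rho(\xi_j)\ne\varnothing$ implies $Q_i\cap(\mathrm{Id}-M_j)B_\rho(\xi_j)=\varnothing$. (AC): there is $c_{\rm act}>0$ with $|m_{i_j}(\xi)|\ge c_{\rm act}$ for all $\xi\in B_{r_0}(\xi_j)$ and all $j\ge j_0$. (R): there is $C_{\rm reg}<\infty$ with $\sup_{j\ge j_0}\|\nabla m_{i_j}\|_{L^\infty(B_{r_0}(\xi_j))}\le C_{\rm reg}$. *)

theory Defs
  imports "HOL-Analysis.Analysis" "HOL-Probability.Essential_Supremum"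
begin

section \<open>Function spaces on the plane\<close>

type_synonym plane = "real ^ 2"

definition esqrt :: "ennreal \<Rightarrow> ennreal" where
  "esqrt x = (if x = \<infinity> then \<infinity> else ennreal (sqrt (enn2real x)))"

definition L1 :: "(plane \<Rightarrow> complex) \<Rightarrow> bool" where
  "L1 f \<longleftrightarrow> integrable lborel f"

definition L2 :: "(plane \<Rightarrow> complex) \<Rightarrow> bool" where
  "L2 f \<longleftrightarrow> f \<in> borel_measurable lborel \<and> integrable lborel (\<lambda>x. (norm (f x))\<^sup>2)"

definition L2_norm :: "(plane \<Rightarrow> complex) \<Rightarrow> ennreal" where
  "L2_norm f = esqrt (\<integral>\<^sup>+ x. ennreal ((norm (f x))\<^sup>2) \<partial>lborel)"

definition l2_L2_norm :: "'p set \<Rightarrow> ('p \<Rightarrow> plane \<Rightarrow> complex) \<Rightarrow> ennreal" where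
  "l2_L2_norm P q = esqrt (\<Sum>\<^sub>\<infinity>p\<in>P. (L2_norm (q p))\<^sup>2)"

definition Linf_norm :: "plane measure \<Rightarrow> (plane \<Rightarrow> 'b::real_normed_vector) \<Rightarrow> ennreal" where
  "Linf_norm N g = esssup N (\<lambda>x. ennreal (norm (g x)))"

definition supp :: "('a::topological_space \<Rightarrow> 'b::zero) \<Rightarrow> 'a set" where
  "supp f = closure {x. f x \<noteq> 0}"

definition partial :: "2 \<Rightarrow> (plane \<Rightarrow> 'b::real_normed_vector) \<Rightarrow> plane \<Rightarrow> 'b" where
  "partial k f x = frechet_derivative f (at x) (axis k 1)"

definition partials :: "nat \<times> nat \<Rightarrow> (plane \<Rightarrow> 'b::real_normed_vector) \<Rightarrow> plane \<Rightarrow> 'b" where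
  "partials \<nu> f = (partial 1 ^^ fst \<nu>) ((partial 2 ^^ snd \<nu>) f)"

primrec Ck :: "nat \<Rightarrow> (plane \<Rightarrow> 'b::real_normed_vector) \<Rightarrow> bool" where
  "Ck 0 f \<longleftrightarrow> continuous_on UNIV f"
| "Ck (Suc k) f \<longleftrightarrow> (\<forall>x. f differentiable (at x)) \<and> (\<forall>i. Ck k (partial i f))"

definition Cc_infinity :: "(plane \<Rightarrow> 'b::real_normed_vector) \<Rightarrow> bool" where
  "Cc_infinity f \<longleftrightarrow> (\<forall>k. Ck k f) \<and> compact (supp f)"

definition Cm_norm :: "nat \<Rightarrow> (plane \<Rightarrow> plane) \<Rightarrow> ennreal" where
  "Cm_norm m \<tau> = (\<Sum>\<nu>\<in>{\<nu>. fst \<nu> + snd \<nu> \<le> m}. Linf_norm lborel (partials \<nu> \<tau>))"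

text \<open>The Fourier transform of an integrable function need not be differentiable, so the
  gradient of a filter is understood in the distributional sense.\<close>

definition weak_gradient :: "plane set \<Rightarrow> (plane \<Rightarrow> complex) \<Rightarrow> (plane \<Rightarrow> complex ^ 2) \<Rightarrow> bool" where
  "weak_gradient \<Omega> u G \<longleftrightarrow>
     (\<forall>K. compact K \<and> K \<subseteq> \<Omega> \<longrightarrow> set_integrable lborel K G) \<and>
     (\<forall>\<phi> :: plane \<Rightarrow> real. Cc_infinity \<phi> \<and> supp \<phi> \<subseteq> \<Omega> \<longrightarrow>
        (\<forall>k. (LINT x|lborel. partial k \<phi> x *\<^sub>R u x) = - (LINT x|lborel. \<phi> x *\<^sub>R G x $ k)))"

definition conv :: "(plane \<Rightarrow> complex) \<Rightarrow> (plane \<Rightarrow> complex) \<Rightarrow> plane \<Rightarrow> complex" where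
  "conv f g x = (LINT y|lborel. f y * g (x - y))"

definition fourier :: "(plane \<Rightarrow> complex) \<Rightarrow> plane \<Rightarrow> complex" where
  "fourier f \<xi> = (LINT x|lborel. cis (- 2 * pi * (x \<bullet> \<xi>)) * f x)"

text \<open>For functions that are only square integrable, the Fourier integral is extended
  by density; \<open>g\<close> is determined by \<open>f\<close> up to a null set.\<close>

definition is_L2_fourier :: "(plane \<Rightarrow> complex) \<Rightarrow> (plane \<Rightarrow> complex) \<Rightarrow> bool" where
  "is_L2_fourier f g \<longleftrightarrow> L2 f \<and> L2 g \<and>
     (\<exists>h. (\<forall>n::nat. L1 (h n) \<and> L2 (h n)) \<and>
        (\<lambda>n. L2_norm (\<lambda>x. h n x - f x)) \<longlonglongrightarrow> 0 \<and>
        (\<lambda>n. L2_norm (\<lambda>\<xi>. fourier (h n) \<xi> - g \<xi>)) \<longlonglongrightarrow> 0)"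

definition compact_fourier_support :: "(plane \<Rightarrow> complex) \<Rightarrow> bool" where
  "compact_fourier_support f \<longleftrightarrow> (\<exists>g. is_L2_fourier f g \<and> compact (supp g))"

definition deform :: "(plane \<Rightarrow> plane) \<Rightarrow> (plane \<Rightarrow> complex) \<Rightarrow> plane \<Rightarrow> complex" where
  "deform \<tau> f x = f (x - \<tau> x)"


section \<open>The covering\<close>

type_synonym idx = "nat \<times> nat \<times> nat"

definition Istar :: "real \<Rightarrow> real \<Rightarrow> idx set" where
  "Istar \<alpha> \<beta> = {(j, m, l). 1 \<le> j \<and> m \<le> nat \<lceil>2 powr ((1 - \<alpha>) * real j - 1)\<rceil>
                      \<and> l \<le> nat \<lceil>10 * 2 powr ((1 - \<beta>) * real j)\<rceil>}"

text \<open>The full index set adjoins the low-frequency index, written \<open>0\<close> in the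
  literature and \<open>None\<close> here.\<close>

definition Ifull :: "real \<Rightarrow> real \<Rightarrow> idx option set" where
  "Ifull \<alpha> \<beta> = insert None (Some ` Istar \<alpha> \<beta>)"

definition rot :: "real \<Rightarrow> real ^ 2 ^ 2" where
  "rot \<theta> = vector [vector [cos \<theta>, - sin \<theta>], vector [sin \<theta>, cos \<theta>]]"

definition tile_map :: "real \<Rightarrow> real \<Rightarrow> idx \<Rightarrow> plane \<Rightarrow> plane" where
  "tile_map \<alpha> \<beta> = (\<lambda>(j, m, l) x.
     rot (2 * real l * (pi / 10) * 2 powr ((\<beta> - 1) * real j)) *v
       (vector [vector [2 powr (\<alpha> * real j), 0], vector [0, 2 powr (\<beta> * real j)]] *v x
        + vector [2 powr (real j - 1) + real m * 2 powr (\<alpha> * real j), 0]))"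

definition Qtile :: "real \<Rightarrow> real \<Rightarrow> real \<Rightarrow> idx option \<Rightarrow> plane set" where
  "Qtile \<alpha> \<beta> \<epsilon> i = (case i of
       None \<Rightarrow> ball 0 4
     | Some i' \<Rightarrow> tile_map \<alpha> \<beta> i' `
         {x. - \<epsilon> < x $ 1 \<and> x $ 1 < 1 + \<epsilon> \<and> - 1 - \<epsilon> < x $ 2 \<and> x $ 2 < 1 + \<epsilon>})"

definition Ptile :: "real \<Rightarrow> real \<Rightarrow> idx option \<Rightarrow> plane set" where
  "Ptile \<alpha> \<beta> i = (case i of
       None \<Rightarrow> ball 0 3
     | Some i' \<Rightarrow> tile_map \<alpha> \<beta> i' ` {x. 0 \<le> x $ 1 \<and> x $ 1 \<le> 1 \<and> - 1 \<le> x $ 2 \<and> x $ 2 \<le> 1})"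


section \<open>Filter banks and scattering\<close>

definition wave_packet_bank ::
  "real \<Rightarrow> real \<Rightarrow> real \<Rightarrow> (plane \<Rightarrow> complex) \<Rightarrow> (idx \<Rightarrow> plane \<Rightarrow> complex) \<Rightarrow> bool" where
  "wave_packet_bank \<alpha> \<beta> \<epsilon> chi \<psi> \<longleftrightarrow>
     L1 chi \<and> L2 chi \<and> (\<forall>i\<in>Istar \<alpha> \<beta>. L1 (\<psi> i) \<and> L2 (\<psi> i)) \<and>
     (AE \<xi> in lborel. ((\<lambda>i. (norm (fourier (\<psi> i) \<xi>))\<^sup>2) has_sum
                          (1 - (norm (fourier chi \<xi>))\<^sup>2)) (Istar \<alpha> \<beta>)) \<and>
     supp (fourier chi) \<subseteq> Qtile \<alpha> \<beta> \<epsilon> None \<and>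
     (\<forall>i\<in>Istar \<alpha> \<beta>. supp (fourier (\<psi> i)) \<subseteq> Qtile \<alpha> \<beta> \<epsilon> (Some i))"

definition paths :: "real \<Rightarrow> real \<Rightarrow> nat \<Rightarrow> idx list set" where
  "paths \<alpha> \<beta> n = {p. length p = n \<and> set p \<subseteq> Istar \<alpha> \<beta>}"

definition U1 :: "(idx \<Rightarrow> plane \<Rightarrow> complex) \<Rightarrow> idx \<Rightarrow> (plane \<Rightarrow> complex) \<Rightarrow> plane \<Rightarrow> complex" where
  "U1 \<psi> i f x = complex_of_real (norm (conv f (\<psi> i) x))"

text \<open>The head of the list is the filter applied first.\<close>

primrec U_path :: "(idx \<Rightarrow> plane \<Rightarrow> complex) \<Rightarrow> idx list \<Rightarrow> (plane \<Rightarrow> complex) \<Rightarrow> plane \<Rightarrow> complex" where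
  "U_path \<psi> [] f = f"
| "U_path \<psi> (i # p) f = U_path \<psi> p (U1 \<psi> i f)"

definition S1 :: "(plane \<Rightarrow> complex) \<Rightarrow> (idx \<Rightarrow> plane \<Rightarrow> complex) \<Rightarrow>
    (plane \<Rightarrow> complex) \<Rightarrow> idx \<Rightarrow> plane \<Rightarrow> complex" where
  "S1 chi \<psi> f i = conv (U1 \<psi> i f) chi"

definition W_map :: "(plane \<Rightarrow> complex) \<Rightarrow> (idx \<Rightarrow> plane \<Rightarrow> complex) \<Rightarrow>
    (plane \<Rightarrow> complex) \<Rightarrow> idx option \<Rightarrow> plane \<Rightarrow> complex" where
  "W_map chi \<psi> f i = (case i of None \<Rightarrow> conv f chi | Some i' \<Rightarrow> conv f (\<psi> i'))"

definition W_commutator :: "(plane \<Rightarrow> complex) \<Rightarrow> (idx \<Rightarrow> plane \<Rightarrow> complex) \<Rightarrow>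
    (plane \<Rightarrow> plane) \<Rightarrow> (plane \<Rightarrow> complex) \<Rightarrow> idx option \<Rightarrow> plane \<Rightarrow> complex" where
  "W_commutator chi \<psi> \<tau> f i x = W_map chi \<psi> (deform \<tau> f) i x - deform \<tau> (W_map chi \<psi> f i) x"


section \<open>Active cores\<close>

definition active_core_system ::
  "real \<Rightarrow> real \<Rightarrow> real \<Rightarrow> nat \<Rightarrow> real \<Rightarrow> (nat \<Rightarrow> idx) \<Rightarrow> (nat \<Rightarrow> plane) \<Rightarrow> (nat \<Rightarrow> real ^ 2 ^ 2) \<Rightarrow> bool"
where
  "active_core_system \<alpha> \<beta> \<epsilon> j0 r0 \<iota> \<xi> M \<longleftrightarrow>
     1 \<le> j0 \<and> 0 < r0 \<and>
     (\<forall>j\<ge>j0. \<iota> j \<in> Istar \<alpha> \<beta> \<and> \<xi> j \<in> Ptile \<alpha> \<beta> (Some (\<iota> j)) \<and>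
        ball (\<xi> j) r0 \<subseteq> Ptile \<alpha> \<beta> (Some (\<iota> j)) \<and>
        Ptile \<alpha> \<beta> (Some (\<iota> j)) \<subseteq> Qtile \<alpha> \<beta> \<epsilon> (Some (\<iota> j)) \<and>
        invertible (mat 1 - M j) \<and>
        (\<forall>\<rho> i. 0 < \<rho> \<and> \<rho> \<le> r0 \<and> i \<in> Ifull \<alpha> \<beta> \<and> Qtile \<alpha> \<beta> \<epsilon> i \<inter> ball (\<xi> j) \<rho> \<noteq> {} \<longrightarrow>
           Qtile \<alpha> \<beta> \<epsilon> i \<inter> (\<lambda>x. (mat 1 - M j) *v x) ` ball (\<xi> j) \<rho> = {})) \<and>
     (\<exists>a>0. \<exists>b. \<forall>j\<ge>j0. a * 2 ^ j \<le> norm (\<xi> j) \<and> norm (\<xi> j) \<le> b * 2 ^ j) \<and>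
     (\<exists>a>0. \<exists>b. \<forall>j\<ge>j0. a * 2 powr (- (1 - \<beta>) * real j) \<le> onorm ((*v) (M j))
                       \<and> onorm ((*v) (M j)) \<le> b * 2 powr (- (1 - \<beta>) * real j))"

definition active_core_bound ::
  "(idx \<Rightarrow> plane \<Rightarrow> complex) \<Rightarrow> nat \<Rightarrow> real \<Rightarrow> (nat \<Rightarrow> idx) \<Rightarrow> (nat \<Rightarrow> plane) \<Rightarrow> real \<Rightarrow> bool"
where
  "active_core_bound \<psi> j0 r0 \<iota> \<xi> c \<longleftrightarrow>
     (\<forall>j\<ge>j0. \<forall>\<eta>\<in>ball (\<xi> j) r0. c \<le> norm (fourier (\<psi> (\<iota> j)) \<eta>))"

definition active_core_regular ::
  "(idx \<Rightarrow> plane \<Rightarrow> complex) \<Rightarrow> nat \<Rightarrow> real \<Rightarrow> (nat \<Rightarrow> idx) \<Rightarrow> (nat \<Rightarrow> plane) \<Rightarrow> bool"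
where
  "active_core_regular \<psi> j0 r0 \<iota> \<xi> \<longleftrightarrow>
     (\<exists>C::real. \<forall>j\<ge>j0. \<exists>G. weak_gradient (ball (\<xi> j) r0) (fourier (\<psi> (\<iota> j))) G \<and>
        Linf_norm (restrict_space lborel (ball (\<xi> j) r0)) G \<le> ennreal C)"

definition unstable_family ::
  "real \<Rightarrow> real \<Rightarrow> (plane \<Rightarrow> complex) \<Rightarrow> (idx \<Rightarrow> plane \<Rightarrow> complex) \<Rightarrow> nat \<Rightarrow>
   (nat \<Rightarrow> plane \<Rightarrow> complex) \<Rightarrow> (nat \<Rightarrow> plane \<Rightarrow> plane) \<Rightarrow> bool"
where
  "unstable_family \<alpha> \<beta> chi \<psi> j0 f \<tau> \<longleftrightarrow>
     (\<forall>j\<ge>j0. L2 (f j) \<and> compact_fourier_support (f j) \<and> L2_norm (f j) = 1 \<and> Cc_infinity (\<tau> j)) \<and>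
     (\<exists>c>0. \<exists>C::nat \<Rightarrow> real. \<forall>\<^sub>F j in sequentially.
        (\<forall>m. Cm_norm m (\<tau> j) \<le> ennreal (C m * 2 powr (- (1 - \<beta>) * real j))) \<and>
        ennreal c \<le> l2_L2_norm (Istar \<alpha> \<beta>)
                      (\<lambda>i x. S1 chi \<psi> (deform (\<tau> j) (f j)) i x - S1 chi \<psi> (f j) i x) \<and>
        ennreal c \<le> l2_L2_norm (Ifull \<alpha> \<beta>) (W_commutator chi \<psi> (\<tau> j) (f j)))"

end

theory Submission
  imports Defs "HOL-Probability.Characteristic_Functions"
begin

text \<open>A linear deformation moves frequencies: if \<open>f\<close> has its Fourier transform in a small disc around
\<open>\<xi>\<^sub>j\<close>, then \<open>x \<mapsto> f ((Id - M\<^sub>j\<^sup>T) x)\<close> has its Fourier transform in the image of the disc under \<open>Id - M\<^sub>j\<close>.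
The active core system says that this image leaves every tile that meets the disc, so in particular
the filter \<open>\<psi>\<close> of index \<open>i\<^sub>j\<close>, which sees \<open>f\<close>, no longer sees the deformed function at all. As the entries of \<open>M\<^sub>j\<close>
are of size \<open>2 powr (- (1 - \<beta>) * j)\<close>, an arbitrarily small deformation destroys the response of that filter,
and it is enough to look at this single index to bound both \<open>\<ell>\<^sup>2(L\<^sup>2)\<close> norms from below. For the commutator one
compares with the deformation of \<open>f * \<psi>\<close>, which keeps its energy up to a factor, as the deformation is close to the identity.

Three points need care.

\<^item> The deformation has to be compactly supported, so \<open>M\<^sub>j\<^sup>T x\<close> is multiplied by a fixed smooth cut-off which
  is 1 on a disc of radius \<open>R\<close>. The difference to the linear deformation only involves the part of \<open>f\<close>
  outside a disc of radius \<open>R / 2\<close> (lemma \<open>energy_deform_difference\<close>), and this part has to be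
  small uniformly in \<open>j\<close>.
\<^item> After the modulus, the low-pass filter \<open>\<chi>\<close> must still see the response \<open>\<bar>f * \<psi>\<bar>\<close> of the undeformed function.
\<^item> If the filter has modulus 1 on its core, then the scattering cascade started at \<open>f\<close> should stop.

All three are settled by one choice. Let \<open>\<Lambda>\<close> be a nonnegative bump around the origin whose Fourier
transform is nonnegative as well, let \<open>m\<close> be the Fourier transform of \<open>\<psi>\<close>, and let \<open>f\<close> have the Fourier
transform \<open>\<Lambda> (\<eta> - \<xi>\<^sub>j) * cnj (m \<eta>)\<close>. The conjugate cancels the phase of the filter: \<open>f * \<psi>\<close> has the Fourier
transform \<open>\<Lambda> (\<eta> - \<xi>\<^sub>j) * \<bar>m \<eta>\<bar>\<^sup>2\<close>. Hence the integral of \<open>\<bar>f * \<psi>\<bar>\<close> against the nonnegative kernel with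
Fourier transform \<open>\<Lambda>\<close> is at least \<open>c\<^sup>2 * \<parallel>\<Lambda>\<parallel>\<^sup>2\<close>, and since \<open>\<Lambda>\<close> lives where the Fourier transform of \<open>\<chi>\<close> has modulus 1, this
forces energy through the low-pass filter (\<open>low_pass_energy\<close>). If \<open>\<bar>m\<bar> = 1\<close> on the core, then
\<open>\<bar>f * \<psi>\<bar>\<close> is exactly that kernel; its frequencies lie below all band-pass tiles, so every path of length
at least two vanishes (\<open>mixed_norm_le\<close>). Uniform decay comes from the regularity condition: a bounded weak
gradient makes \<open>m\<close> Lipschitz (\<open>lipschitz_of_weak_gradient\<close>), so on a bump of small width \<open>m\<close> is nearly the
constant \<open>m \<xi>\<^sub>j\<close> and \<open>f\<close> is close in \<open>L\<^sup>2\<close> to a multiple of a modulation of one fixed kernel (\<open>tail_energy\<close>).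

The Fourier analysis is carried out for functions that are continuous, bounded and integrable. This class
contains the packets, their deformations and all filter outputs, since it is closed under convolution with integrable
functions and under the deformations, and on it Fourier transforms and convolutions are honest integrals.\<close>


section \<open>Integration over the plane\<close>

lemma plane_integrable_affine:
  fixes f :: "plane \<Rightarrow> 'a::{banach,second_countable_topology}"
  assumes c: "c \<noteq> 0" and f: "integrable lborel f"
  shows "integrable lborel (\<lambda>x. f (t + c *\<^sub>R x))"
proof -
  have [measurable]: "f \<in> borel_measurable borel" using f by auto
  have "integrable (density (distr lborel borel (\<lambda>x. t + c *\<^sub>R x)) (\<lambda>_. ennreal (\<bar>c\<bar>^2))) f"
    using f lborel_affine[OF c, of t] by (simp add: ennreal_power)
  then have "integrable lborel (\<lambda>x. \<bar>c\<bar>^2 *\<^sub>R f (t + c *\<^sub>R x))"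
    by (subst (asm) integrable_density) (auto simp: integrable_distr_eq)
  then have "integrable lborel (\<lambda>x. (1 / \<bar>c\<bar>^2) *\<^sub>R (\<bar>c\<bar>^2 *\<^sub>R f (t + c *\<^sub>R x)))"
    by (rule integrable_scaleR_right)
  then show ?thesis using c by simp
qed

lemma plane_integral_affine:
  fixes f :: "plane \<Rightarrow> 'a::{banach,second_countable_topology}"
  assumes c: "c \<noteq> 0" and f: "f \<in> borel_measurable borel"
  shows "(LINT x|lborel. f x) = \<bar>c\<bar>^2 *\<^sub>R (LINT x|lborel. f (t + c *\<^sub>R x))"
proof -
  note f[measurable]
  have "(LINT x|lborel. f x)
      = (LINT x|density (distr lborel borel (\<lambda>x. t + c *\<^sub>R x)) (\<lambda>_. ennreal (\<bar>c\<bar>^2)). f x)"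
    using lborel_affine[OF c, of t] by (simp add: ennreal_power)
  also have "\<dots> = (LINT x|lborel. \<bar>c\<bar>^2 *\<^sub>R f (t + c *\<^sub>R x))"
    by (subst integral_density) (auto simp: integral_distr)
  finally show ?thesis by simp
qed

lemma plane_integrable_shift:
  fixes f :: "plane \<Rightarrow> 'a::{banach,second_countable_topology}"
  assumes "integrable lborel f"
  shows "integrable lborel (\<lambda>y. f (x - y))" "integrable lborel (\<lambda>y. f (y - x))"
    "integrable lborel (\<lambda>y. f (- y))"
  using plane_integrable_affine[OF _ assms, of "-1" x] plane_integrable_affine[OF _ assms, of "1" "-x"]
    plane_integrable_affine[OF _ assms, of "-1" 0]
  by simp_all

lemma plane_integral_shift:
  fixes f :: "plane \<Rightarrow> 'a::{banach,second_countable_topology}"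
  assumes "f \<in> borel_measurable borel"
  shows "(LINT y|lborel. f (x - y)) = (LINT y|lborel. f y)"
    "(LINT y|lborel. f (y - x)) = (LINT y|lborel. f y)"
    "(LINT y|lborel. f (- y)) = (LINT y|lborel. f y)"
  using plane_integral_affine[OF _ assms, of "-1" x] plane_integral_affine[OF _ assms, of "1" "-x"]
    plane_integral_affine[OF _ assms, of "-1" 0]
  by simp_all

lemma Basis_plane: "(Basis :: plane set) = {axis 1 1, axis 2 1}"
  by (auto simp: Basis_vec_def exhaust_2) (metis exhaust_2)

text \<open>Lebesgue measure on the plane is the image of the product measure over the two basis vectors, so
tensor products integrate to products. This reduces the two-dimensional Gaussian to the real line.\<close>

lemma plane_integral_tensor:
  fixes f g :: "real \<Rightarrow> complex"
  assumes f: "integrable lborel f" and g: "integrable lborel g"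
  shows "integrable lborel (\<lambda>x::plane. f (x $ 1) * g (x $ 2))"
    "(LINT x::plane|lborel. f (x $ 1) * g (x $ 2)) = (LINT t|lborel. f t) * (LINT t|lborel. g t)"
proof -
  interpret product_sigma_finite "\<lambda>_::plane. lborel :: real measure" ..
  define F where "F = (\<lambda>b::plane. if b = axis 1 1 then f else g)"
  have ne: "axis 1 1 \<noteq> (axis 2 1 :: plane)" by (simp add: axis_eq_axis)
  have [measurable]: "f \<in> borel_measurable borel" "g \<in> borel_measurable borel" using f g by auto
  have intF: "integrable lborel (F b)" for b using f g by (auto simp: F_def)
  let ?T = "\<lambda>v. \<Sum>b\<in>Basis. v b *\<^sub>R (b::plane)"
  have comp: "?T v $ 1 = v (axis 1 1)" "?T v $ 2 = v (axis 2 1)" for v :: "plane \<Rightarrow> real"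
    using ne by (simp_all add: Basis_plane axis_def)
  have eq: "f (?T v $ 1) * g (?T v $ 2) = (\<Prod>b\<in>Basis. F b (v b))" for v
    unfolding comp using ne by (simp add: Basis_plane F_def)
  have [measurable]: "?T \<in> measurable (\<Pi>\<^sub>M b\<in>Basis. lborel) borel" by measurable
  have m: "(\<lambda>x::plane. f (x $ 1) * g (x $ 2)) \<in> borel_measurable borel"
    by measurable
  have "integrable (\<Pi>\<^sub>M b\<in>(Basis::plane set). lborel) (\<lambda>v. \<Prod>b\<in>Basis. F b (v b))"
    by (rule product_integrable_prod) (auto simp: intF)
  then show "integrable lborel (\<lambda>x::plane. f (x $ 1) * g (x $ 2))"
    by (subst lborel_eq, subst integrable_distr_eq) (use m in \<open>simp_all only: eq, simp_all\<close>)
  have "(LINT x::plane|lborel. f (x $ 1) * g (x $ 2))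
      = integral\<^sup>L (\<Pi>\<^sub>M b\<in>(Basis::plane set). lborel) (\<lambda>v. \<Prod>b\<in>Basis. F b (v b))"
    by (subst lborel_eq, subst integral_distr) (use m in \<open>simp_all only: eq, simp_all\<close>)
  also have "\<dots> = (\<Prod>b\<in>Basis. LINT t|lborel. F b t)"
    by (rule product_integral_prod) (auto simp: intF)
  finally show "(LINT x::plane|lborel. f (x $ 1) * g (x $ 2)) = (LINT t|lborel. f t) * (LINT t|lborel. g t)"
    using ne by (simp add: Basis_plane F_def)
qed

lemma borel_measurable_cis [measurable]: "cis \<in> borel_measurable borel"
  by (rule borel_measurable_continuous_onI) (simp add: continuous_on_cis)

section \<open>The Fourier transform of integrable functions\<close>

text \<open>On this class the Fourier transform and convolutions with integrable functions are absolutely convergent integrals at every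
point, and all functions are square integrable.\<close>

definition tame :: "(plane \<Rightarrow> complex) \<Rightarrow> bool" where
  "tame f \<longleftrightarrow> continuous_on UNIV f \<and> bounded (range f) \<and> integrable lborel f"

definition ifourier :: "(plane \<Rightarrow> complex) \<Rightarrow> plane \<Rightarrow> complex" where
  "ifourier v x = fourier v (- x)"

lemma tameD:
  assumes "tame f"
  shows "continuous_on UNIV f" "integrable lborel f" "f \<in> borel_measurable borel"
    "integrable lborel (\<lambda>x. norm (f x))"
  using assms by (auto simp: tame_def)

lemma tame_bound:
  assumes "tame f" obtains B where "B \<ge> 0" "\<And>x. norm (f x) \<le> B"
proof -
  from assms obtain B where "\<And>x. norm (f x) \<le> B" unfolding tame_def bounded_iff by auto
  then show ?thesis using that[of B] norm_ge_zero order_trans by blast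
qed

lemma tame_square_integrable:
  assumes "tame f"
  shows "integrable lborel (\<lambda>x. (norm (f x))\<^sup>2)"
proof -
  obtain B where B: "B \<ge> 0" "\<And>x. norm (f x) \<le> B" using tame_bound[OF assms] by blast
  have [measurable]: "f \<in> borel_measurable borel" using tameD[OF assms] by auto
  show ?thesis
  proof (rule Bochner_Integration.integrable_bound[where f = "\<lambda>x. B * norm (f x)"])
    show "integrable lborel (\<lambda>x. B * norm (f x))" using tameD[OF assms] by auto
  qed (use B in \<open>auto simp: power2_eq_square intro!: mult_right_mono\<close>)
qed

lemma tame_L1_L2: "tame f \<Longrightarrow> L1 f \<and> L2 f"
  using tame_square_integrable tameD by (auto simp: L1_def L2_def)

lemma tame_reflect: "tame f \<Longrightarrow> tame (\<lambda>x. cnj (f (- x)))"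
  unfolding tame_def bounded_iff
  by (auto intro!: continuous_intros plane_integrable_shift(3) continuous_on_compose2[of UNIV f])

lemma integrable_cis_mult:
  fixes f :: "plane \<Rightarrow> complex"
  assumes "integrable lborel f" "h \<in> borel_measurable borel"
  shows "integrable lborel (\<lambda>x. cis (h x) * f x)"
proof -
  have "(\<lambda>x. cis (h x)) \<in> borel_measurable borel"
    by (rule borel_measurable_continuous_onI[THEN measurable_compose[OF assms(2)]]) (simp add: continuous_on_cis)
  then show ?thesis
    using assms by (intro Bochner_Integration.integrable_bound[OF assms(1)]) (auto simp: norm_mult)
qed

lemma continuous_on_fourier:
  assumes "integrable lborel f" shows "continuous_on UNIV (fourier f)"
  unfolding continuous_on_sequentially
proof (intro ballI allI impI)
  fix X :: "nat \<Rightarrow> plane" and a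
  assume X: "(\<forall>n. X n \<in> UNIV) \<and> X \<longlonglongrightarrow> a"
  have [measurable]: "f \<in> borel_measurable borel" using assms by auto
  show "(fourier f \<circ> X) \<longlonglongrightarrow> fourier f a"
    unfolding fourier_def comp_def
  proof (rule integral_dominated_convergence[where w = "\<lambda>x. norm (f x)"])
    have "integrable lborel (\<lambda>x. cis (- 2 * pi * (x \<bullet> \<xi>)) * f x)" for \<xi>
      by (rule integrable_cis_mult[OF assms]) simp
    then show "(\<lambda>x. cis (- 2 * pi * (x \<bullet> a)) * f x) \<in> borel_measurable lborel"
      "\<And>i. (\<lambda>x. cis (- 2 * pi * (x \<bullet> X i)) * f x) \<in> borel_measurable lborel"
      using borel_measurable_integrable by blast+
    show "AE x in lborel. (\<lambda>i. cis (- 2 * pi * (x \<bullet> X i)) * f x) \<longlonglongrightarrow> cis (- 2 * pi * (x \<bullet> a)) * f x"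
      using X by (auto intro!: tendsto_intros)
  qed (use assms in \<open>auto simp: norm_mult\<close>)
qed

lemma norm_fourier_le: "integrable lborel f \<Longrightarrow> norm (fourier f \<xi>) \<le> (LINT x|lborel. norm (f x))"
  unfolding fourier_def by (rule order_trans[OF integral_norm_bound]) (simp add: norm_mult)

text \<open>Fubini's theorem for the Fourier kernel. It moves pairings with a Fourier integral to the frequency side
before Plancherel's identity is at hand; Gauss summability rests on it.\<close>

lemma fourier_swap:
  assumes u: "integrable lborel u" and v: "integrable lborel v"
  shows "(LINT \<xi>|lborel. fourier u \<xi> * v \<xi>) = (LINT x|lborel. u x * fourier v x)"
proof -
  have [measurable]: "u \<in> borel_measurable borel" "v \<in> borel_measurable borel" using u v by auto
  let ?k = "\<lambda>(\<xi>, x). cis (- 2 * pi * (x \<bullet> \<xi>)) * u x * v \<xi>"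
  have [measurable]: "?k \<in> borel_measurable (lborel \<Otimes>\<^sub>M lborel)" by measurable
  have "integrable (lborel \<Otimes>\<^sub>M lborel) ?k"
  proof (rule lborel_pair.Fubini_integrable)
    have "(LINT x|lborel. norm (?k (\<xi>, x))) = norm (v \<xi>) * (LINT x|lborel. norm (u x))" for \<xi>
      by (simp add: norm_mult mult.commute)
    then show "integrable lborel (\<lambda>\<xi>. LINT x|lborel. norm (?k (\<xi>, x)))" using v by auto
    show "AE \<xi> in lborel. integrable lborel (\<lambda>x. ?k (\<xi>, x))"
      using integrable_cis_mult[OF u] by auto
  qed simp
  from lborel_pair.Fubini_integral[OF this]
  have "(LINT \<xi>|lborel. LINT x|lborel. cis (- 2 * pi * (x \<bullet> \<xi>)) * u x * v \<xi>)
     = (LINT x|lborel. LINT \<xi>|lborel. cis (- 2 * pi * (x \<bullet> \<xi>)) * u x * v \<xi>)" by simp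
  moreover have "(LINT x|lborel. cis (- 2 * pi * (x \<bullet> \<xi>)) * u x * v \<xi>) = fourier u \<xi> * v \<xi>" for \<xi>
    unfolding fourier_def by simp
  moreover have "(LINT \<xi>|lborel. cis (- 2 * pi * (x \<bullet> \<xi>)) * u x * v \<xi>) = u x * fourier v x" for x
  proof -
    have "(LINT \<xi>|lborel. cis (- 2 * pi * (x \<bullet> \<xi>)) * u x * v \<xi>)
        = (LINT \<xi>|lborel. u x * (cis (- 2 * pi * (\<xi> \<bullet> x)) * v \<xi>))"
      by (simp add: inner_commute mult_ac)
    then show ?thesis unfolding fourier_def by simp
  qed
  ultimately show ?thesis by (simp only:)
qed

lemma fourier_modulate:
  "fourier (\<lambda>x. cis (2 * pi * (a \<bullet> x)) * v x) \<xi> = fourier v (\<xi> - a)"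
proof -
  have "- 2 * pi * (x \<bullet> \<xi>) + 2 * pi * (a \<bullet> x) = - 2 * pi * (x \<bullet> (\<xi> - a))" for x
    by (simp add: inner_diff_right inner_commute right_diff_distrib)
  then show ?thesis unfolding fourier_def by (simp only: mult.assoc[symmetric] cis_mult)
qed

lemma fourier_translate:
  assumes "v \<in> borel_measurable borel"
  shows "fourier (\<lambda>x. v (x - a)) \<xi> = cis (- 2 * pi * (a \<bullet> \<xi>)) * fourier v \<xi>"
proof -
  have "fourier (\<lambda>x. v (x - a)) \<xi> = (LINT x|lborel. (\<lambda>y. cis (- 2 * pi * ((y + a) \<bullet> \<xi>)) * v y) (x - a))"
    unfolding fourier_def by simp
  also have "\<dots> = (LINT y|lborel. cis (- 2 * pi * ((y + a) \<bullet> \<xi>)) * v y)"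
    using assms by (intro plane_integral_shift(2)) measurable
  also have "\<dots> = (LINT y|lborel. cis (- 2 * pi * (a \<bullet> \<xi>)) * (cis (- 2 * pi * (y \<bullet> \<xi>)) * v y))"
  proof -
    have "- 2 * pi * ((y + a) \<bullet> \<xi>) = - 2 * pi * (a \<bullet> \<xi>) + - 2 * pi * (y \<bullet> \<xi>)" for y
      by (simp add: inner_add_left distrib_left)
    then show ?thesis by (simp only: mult.assoc[symmetric] cis_mult)
  qed
  finally show ?thesis unfolding fourier_def by simp
qed

lemma fourier_uminus_arg:
  assumes "v \<in> borel_measurable borel"
  shows "fourier (\<lambda>x. v (- x)) \<xi> = fourier v (- \<xi>)"
proof -
  have "fourier (\<lambda>x. v (- x)) \<xi> = (LINT x|lborel. (\<lambda>y. cis (- 2 * pi * (y \<bullet> (- \<xi>))) * v y) (- x))"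
    unfolding fourier_def by simp
  also have "\<dots> = fourier v (- \<xi>)"
    unfolding fourier_def using assms by (intro plane_integral_shift(3)) measurable
  finally show ?thesis .
qed

lemma fourier_cnj: "fourier (\<lambda>x. cnj (v x)) \<xi> = cnj (fourier v (- \<xi>))"
proof -
  have "cnj (fourier v (- \<xi>)) = (LINT x|lborel. cnj (cis (- 2 * pi * (x \<bullet> - \<xi>)) * v x))"
    unfolding fourier_def by (rule Bochner_Integration.integral_cnj[symmetric])
  then show ?thesis unfolding fourier_def by (simp add: cis_cnj)
qed

lemma fourier_reflect:
  assumes "v \<in> borel_measurable borel"
  shows "fourier (\<lambda>x. cnj (v (- x))) \<xi> = cnj (fourier v \<xi>)"
proof -
  have [measurable]: "cnj \<in> borel_measurable borel"
    by (rule borel_measurable_continuous_onI) (auto intro: continuous_intros)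
  have "(\<lambda>x. cnj (v x)) \<in> borel_measurable borel" using assms by measurable
  from fourier_uminus_arg[OF this, of \<xi>] show ?thesis by (simp add: fourier_cnj)
qed

section \<open>Convolution\<close>

lemma conv_commute:
  assumes "f \<in> borel_measurable borel" "k \<in> borel_measurable borel"
  shows "conv f k x = (LINT y|lborel. f (x - y) * k y)"
proof -
  note assms[measurable]
  have "conv f k x = (LINT y|lborel. (\<lambda>y. f (x - y) * k y) (x - y))" unfolding conv_def by simp
  also have "\<dots> = (LINT y|lborel. f (x - y) * k y)" by (rule plane_integral_shift(1)) measurable
  finally show ?thesis .
qed

lemma conv_pair_integrable:
  fixes f k :: "plane \<Rightarrow> complex"
  assumes f: "integrable lborel f" and k: "integrable lborel k"
  shows "integrable (lborel \<Otimes>\<^sub>M lborel) (\<lambda>(y, x). f (x - y) * k y)"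
proof (rule lborel_pair.Fubini_integrable)
  have [measurable]: "f \<in> borel_measurable borel" "k \<in> borel_measurable borel" using f k by auto
  show "(\<lambda>(y, x). f (x - y) * k y) \<in> borel_measurable (lborel \<Otimes>\<^sub>M lborel)" by measurable
  have "(LINT x|lborel. norm (f (x - y) * k y)) = (LINT x|lborel. norm (f x)) * norm (k y)" for y
    using plane_integral_shift(2)[of "\<lambda>x. norm (f x)" y] by (simp add: norm_mult)
  then show "integrable lborel (\<lambda>y. LINT x|lborel. norm (case (y, x) of (y, x) \<Rightarrow> f (x - y) * k y))"
    using k by auto
  show "AE y in lborel. integrable lborel (\<lambda>x. case (y, x) of (y, x) \<Rightarrow> f (x - y) * k y)"
    using plane_integrable_shift(2)[OF f] by auto
qed

text \<open>The bound and the continuity come from the bounded continuous factor (dominated convergence),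
integrability from both factors (Fubini).\<close>

lemma conv_tame:
  assumes f: "tame f" and k: "integrable lborel k"
  shows "tame (conv f k)"
  unfolding tame_def
proof (intro conjI)
  obtain B where B: "B \<ge> 0" "\<And>x. norm (f x) \<le> B" using tame_bound[OF f] by blast
  have [measurable]: "f \<in> borel_measurable borel" "k \<in> borel_measurable borel" using tameD[OF f] k by auto
  have c: "conv f k = (\<lambda>x. LINT y|lborel. f (x - y) * k y)" by (rule ext, rule conv_commute) auto
  have bd: "norm (f (x - y) * k y) \<le> B * norm (k y)" for x y
    using B by (auto simp: norm_mult intro!: mult_right_mono)
  show "continuous_on UNIV (conv f k)"
    unfolding continuous_on_sequentially c
  proof (intro ballI allI impI)
    fix X :: "nat \<Rightarrow> plane" and a
    assume X: "(\<forall>n. X n \<in> UNIV) \<and> X \<longlonglongrightarrow> a"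
    show "((\<lambda>x. LINT y|lborel. f (x - y) * k y) \<circ> X) \<longlonglongrightarrow> (LINT y|lborel. f (a - y) * k y)"
      unfolding comp_def
    proof (rule integral_dominated_convergence[where w = "\<lambda>y. B * norm (k y)"])
      have "(\<lambda>i. f (X i - y)) \<longlonglongrightarrow> f (a - y)" for y
        using X by (intro continuous_on_tendsto_compose[OF tameD(1)[OF f]]) (auto intro!: tendsto_intros)
      then show "AE y in lborel. (\<lambda>i. f (X i - y) * k y) \<longlonglongrightarrow> f (a - y) * k y"
        by (auto intro!: tendsto_intros)
    qed (use k bd in auto)
  qed
  have "norm (conv f k x) \<le> (LINT y|lborel. B * norm (k y))" for x
    unfolding c by (rule order_trans[OF integral_norm_bound], rule integral_mono')
      (use k bd B in auto)
  then show "bounded (range (conv f k))" unfolding bounded_iff by auto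
  show "integrable lborel (conv f k)"
    using lborel_pair.integrable_snd[OF conv_pair_integrable[OF tameD(2)[OF f] k]] unfolding c by simp
qed

lemma fourier_conv:
  assumes f: "integrable lborel f" and k: "integrable lborel k"
  shows "fourier (conv f k) \<xi> = fourier f \<xi> * fourier k \<xi>"
proof -
  have [measurable]: "f \<in> borel_measurable borel" "k \<in> borel_measurable borel" using f k by auto
  let ?h = "\<lambda>(y, x). cis (- 2 * pi * (x \<bullet> \<xi>)) * (f (x - y) * k y)"
  have "integrable (lborel \<Otimes>\<^sub>M lborel) ?h"
    by (rule Bochner_Integration.integrable_bound[OF conv_pair_integrable[OF f k]]) (auto simp: norm_mult)
  from lborel_pair.Fubini_integral[OF this]
  have "(LINT x|lborel. LINT y|lborel. cis (- 2 * pi * (x \<bullet> \<xi>)) * (f (x - y) * k y))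
     = (LINT y|lborel. LINT x|lborel. cis (- 2 * pi * (x \<bullet> \<xi>)) * (f (x - y) * k y))" by simp
  also have "\<dots> = (LINT y|lborel. fourier (\<lambda>x. f (x - y)) \<xi> * k y)"
    unfolding fourier_def by (simp add: mult.assoc[symmetric])
  also have "\<dots> = (LINT y|lborel. fourier f \<xi> * (cis (- 2 * pi * (y \<bullet> \<xi>)) * k y))"
    by (simp add: fourier_translate mult_ac)
  also have "\<dots> = fourier f \<xi> * fourier k \<xi>" unfolding fourier_def by simp
  finally show ?thesis by (subst fourier_def) (simp add: conv_commute)
qed

text \<open>Synthesis form of the convolution theorem: a function given as a Fourier integral of an integrable \<open>v\<close> is
filtered by multiplying \<open>v\<close>.\<close>

lemma conv_ifourier:
  assumes v: "integrable lborel v" and k: "integrable lborel k"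
  shows "conv (ifourier v) k x = ifourier (\<lambda>\<eta>. v \<eta> * fourier k \<eta>) x"
proof -
  have [measurable]: "v \<in> borel_measurable borel" "k \<in> borel_measurable borel" using v k by auto
  have ki: "integrable lborel (\<lambda>y. k (x + y))"
    using plane_integrable_shift(2)[OF k, of "- x"] by (simp add: add.commute)
  have [measurable]: "fourier v \<in> borel_measurable borel"
    using continuous_on_fourier[OF v] by (rule borel_measurable_continuous_onI)
  have "conv (ifourier v) k x = (LINT y|lborel. (\<lambda>y. fourier v y * k (x + y)) (- y))"
    unfolding conv_def ifourier_def by simp
  also have "\<dots> = (LINT y|lborel. fourier v y * k (x + y))"
    by (rule plane_integral_shift(3)) measurable
  also have "\<dots> = (LINT \<eta>|lborel. v \<eta> * fourier (\<lambda>y. k (x + y)) \<eta>)" by (rule fourier_swap[OF v ki])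
  also have "\<dots> = (LINT \<eta>|lborel. v \<eta> * (cis (2 * pi * (x \<bullet> \<eta>)) * fourier k \<eta>))"
    using fourier_translate[of k "- x"] by (simp add: add.commute)
  also have "\<dots> = ifourier (\<lambda>\<eta>. v \<eta> * fourier k \<eta>) x"
    unfolding ifourier_def fourier_def[of "\<lambda>\<eta>. v \<eta> * fourier k \<eta>"]
    by (simp add: inner_commute mult_ac)
  finally show ?thesis .
qed

section \<open>Gauss summability, Plancherel's identity and Fourier inversion\<close>

definition gauss :: "plane \<Rightarrow> real" where
  "gauss z = exp (- (norm z)\<^sup>2 / 2)"

lemma fourier_gauss_line:
  "integrable lborel (\<lambda>t. complex_of_real (exp (- t\<^sup>2 / 2)) * cis (t * s))"
  "(LINT t|lborel. complex_of_real (exp (- t\<^sup>2 / 2)) * cis (t * s)) = sqrt (2 * pi) * exp (- s\<^sup>2 / 2)"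
proof -
  have r: "complex_of_real (exp (- t\<^sup>2 / 2)) * cis (t * s)
      = sqrt (2 * pi) *\<^sub>R (std_normal_density t *\<^sub>R cis (t * s))" for t
    by (simp add: std_normal_density_def scaleR_conv_of_real)
  have i: "integrable lborel (\<lambda>t. std_normal_density t *\<^sub>R cis (t * s))"
    by (rule Bochner_Integration.integrable_bound[of _ std_normal_density]) auto
  then show "integrable lborel (\<lambda>t. complex_of_real (exp (- t\<^sup>2 / 2)) * cis (t * s))"
    unfolding r by (rule integrable_scaleR_right)
  have "char std_normal_distribution s = (LINT t|lborel. std_normal_density t *\<^sub>R cis (t * s))"
    unfolding char_def by (subst integral_density) (auto simp: cis_conv_exp mult.commute)
  then have "(LINT t|lborel. std_normal_density t *\<^sub>R cis (t * s)) = exp (- s\<^sup>2 / 2)"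
    by (simp add: char_std_normal_distribution)
  then show "(LINT t|lborel. complex_of_real (exp (- t\<^sup>2 / 2)) * cis (t * s)) = sqrt (2 * pi) * exp (- s\<^sup>2 / 2)"
    unfolding r by (simp only: integral_scaleR_right) (simp add: scaleR_conv_of_real)
qed

lemma fourier_gauss_plane:
  "integrable lborel (\<lambda>z. complex_of_real (gauss z) * cis (z \<bullet> w))"
  "(LINT z|lborel. complex_of_real (gauss z) * cis (z \<bullet> w)) = 2 * pi * gauss w"
proof -
  have n: "(norm z)\<^sup>2 = (z$1)\<^sup>2 + (z$2)\<^sup>2" for z :: plane
    unfolding power2_norm_eq_inner by (simp add: inner_vec_def sum_2 power2_eq_square)
  have r: "complex_of_real (gauss z) * cis (z \<bullet> w) = complex_of_real (exp (- (z$1)\<^sup>2 / 2)) * cis (z$1 * w$1)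
     * (complex_of_real (exp (- (z$2)\<^sup>2 / 2)) * cis (z$2 * w$2))" for z
  proof -
    have "gauss z = exp (- (z$1)\<^sup>2 / 2) * exp (- (z$2)\<^sup>2 / 2)"
      unfolding gauss_def n by (simp add: exp_add[symmetric] field_simps)
    moreover have "cis (z \<bullet> w) = cis (z$1 * w$1) * cis (z$2 * w$2)"
      by (simp add: inner_vec_def sum_2 cis_mult)
    ultimately show ?thesis by simp
  qed
  note T = plane_integral_tensor[OF fourier_gauss_line(1)[of "w$1"] fourier_gauss_line(1)[of "w$2"]]
  show "integrable lborel (\<lambda>z. complex_of_real (gauss z) * cis (z \<bullet> w))"
    unfolding r by (rule T(1))
  have "sqrt (2 * pi) * exp (- (w$1)\<^sup>2 / 2) * (sqrt (2 * pi) * exp (- (w$2)\<^sup>2 / 2))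
      = (sqrt (2 * pi) * sqrt (2 * pi)) * exp (- (norm w)\<^sup>2 / 2)"
    unfolding n by (simp add: exp_add[symmetric] field_simps)
  then have e: "sqrt (2 * pi) * exp (- (w$1)\<^sup>2 / 2) * (sqrt (2 * pi) * exp (- (w$2)\<^sup>2 / 2)) = 2 * pi * gauss w"
    unfolding gauss_def by simp
  show "(LINT z|lborel. complex_of_real (gauss z) * cis (z \<bullet> w)) = 2 * pi * gauss w"
    unfolding r T(2) fourier_gauss_line(2) of_real_mult[symmetric] e ..
qed

lemma gauss_integral: "integrable lborel gauss" "(LINT z|lborel. gauss z) = 2 * pi"
proof -
  have "integrable lborel (\<lambda>z. complex_of_real (gauss z))"
    using fourier_gauss_plane(1)[of 0] by (simp add: gauss_def)
  then show "integrable lborel gauss" using complex_of_real_integrable_eq by blast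
  have "complex_of_real (LINT z|lborel. gauss z) = complex_of_real (2 * pi)"
    using fourier_gauss_plane(2)[of 0] by (simp add: gauss_def flip: integral_complex_of_real)
  then show "(LINT z|lborel. gauss z) = 2 * pi" using of_real_eq_iff by blast
qed

lemma gauss_measurable [measurable]: "gauss \<in> borel_measurable borel"
  using gauss_integral(1) by auto

lemma fourier_gauss_scaled:
  assumes c: "c > 0"
  shows "fourier (\<lambda>\<xi>. complex_of_real (gauss (c *\<^sub>R \<xi>))) x = 2 * pi / c\<^sup>2 * gauss ((2 * pi / c) *\<^sub>R x)"
proof -
  have "fourier (\<lambda>\<xi>. complex_of_real (gauss (c *\<^sub>R \<xi>))) x
      = \<bar>1 / c\<bar>\<^sup>2 *\<^sub>R (LINT \<xi>|lborel. cis (- 2 * pi * ((0 + (1/c) *\<^sub>R \<xi>) \<bullet> x)) * complex_of_real (gauss (c *\<^sub>R (0 + (1/c) *\<^sub>R \<xi>))))"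
    unfolding fourier_def by (rule plane_integral_affine) (use c in \<open>simp, measurable\<close>)
  also have "(LINT \<xi>|lborel. cis (- 2 * pi * ((0 + (1/c) *\<^sub>R \<xi>) \<bullet> x)) * complex_of_real (gauss (c *\<^sub>R (0 + (1/c) *\<^sub>R \<xi>))))
     = (LINT \<xi>|lborel. complex_of_real (gauss \<xi>) * cis (\<xi> \<bullet> (- (2 * pi / c) *\<^sub>R x)))"
    using c by (simp add: mult.commute)
  also have "\<dots> = 2 * pi * gauss (- (2 * pi / c) *\<^sub>R x)" by (rule fourier_gauss_plane(2))
  finally show ?thesis using c by (simp add: gauss_def power_divide scaleR_conv_of_real)
qed

text \<open>By \<open>fourier_swap\<close> the damped Fourier integral is the average of \<open>v\<close> against a Gaussian of width proportional to
\<open>c n\<close> centred at \<open>x\<close>, and such averages converge to \<open>v x\<close> because \<open>v\<close> is bounded and continuous. Plancherel's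
identity and the inversion theorem both follow by removing the damping.\<close>

lemma gauss_summability:
  assumes v: "tame v"
  defines "c \<equiv> \<lambda>n. 1 / real (Suc n)"
  shows "(\<lambda>n. LINT \<xi>|lborel. fourier v \<xi> * (cis (2 * pi * (x \<bullet> \<xi>)) * complex_of_real (gauss (c n *\<^sub>R \<xi>))))
           \<longlonglongrightarrow> v x"
proof -
  have c: "c n > 0" for n by (simp add: c_def)
  have [measurable]: "cis \<in> borel_measurable borel" "v \<in> borel_measurable borel"
    using tameD[OF v] by (auto intro: borel_measurable_continuous_onI simp: continuous_on_cis)
  have gi: "integrable lborel (\<lambda>z. complex_of_real (gauss z))" using gauss_integral(1) by simp
  have "(LINT \<xi>|lborel. fourier v \<xi> * (cis (2 * pi * (x \<bullet> \<xi>)) * complex_of_real (gauss (c n *\<^sub>R \<xi>))))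
      = (LINT z|lborel. v (x + (c n / (2 * pi)) *\<^sub>R z) * gauss z) / (2 * pi)" (is "?L = _") for n
  proof -
    let ?w = "\<lambda>\<xi>. cis (2 * pi * (x \<bullet> \<xi>)) * complex_of_real (gauss (c n *\<^sub>R \<xi>))"
    have "integrable lborel (\<lambda>\<xi>. complex_of_real (gauss (c n *\<^sub>R \<xi>)))"
      using plane_integrable_affine[OF _ gi, of "c n" 0] c[of n] by simp
    then have wi: "integrable lborel ?w" by (intro integrable_cis_mult) auto
    have "?L = (LINT y|lborel. v y * fourier ?w y)" by (rule fourier_swap[OF tameD(2)[OF v] wi])
    also have "\<dots> = (LINT y|lborel. v y * complex_of_real (2 * pi / (c n)\<^sup>2 * gauss ((2 * pi / c n) *\<^sub>R (y - x))))"
      unfolding fourier_modulate fourier_gauss_scaled[OF c] ..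
    also have "\<dots> = \<bar>c n / (2 * pi)\<bar>\<^sup>2 *\<^sub>R (LINT z|lborel. v (x + (c n / (2 * pi)) *\<^sub>R z) *
        complex_of_real (2 * pi / (c n)\<^sup>2 * gauss ((2 * pi / c n) *\<^sub>R (x + (c n / (2 * pi)) *\<^sub>R z - x))))"
      by (rule plane_integral_affine) (use c[of n] in \<open>simp, measurable\<close>)
    also have "(\<lambda>z. v (x + (c n / (2 * pi)) *\<^sub>R z) *
        complex_of_real (2 * pi / (c n)\<^sup>2 * gauss ((2 * pi / c n) *\<^sub>R (x + (c n / (2 * pi)) *\<^sub>R z - x))))
      = (\<lambda>z. complex_of_real (2 * pi / (c n)\<^sup>2) * (v (x + (c n / (2 * pi)) *\<^sub>R z) * gauss z))"
      using c[of n] by (simp add: fun_eq_iff)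
    also have "\<bar>c n / (2 * pi)\<bar>\<^sup>2 *\<^sub>R (LINT z|lborel. complex_of_real (2 * pi / (c n)\<^sup>2) * (v (x + (c n / (2 * pi)) *\<^sub>R z) * gauss z))
       = (complex_of_real (\<bar>c n / (2 * pi)\<bar>\<^sup>2 * (2 * pi / (c n)\<^sup>2))) * (LINT z|lborel. v (x + (c n / (2 * pi)) *\<^sub>R z) * gauss z)"
      by (simp add: scaleR_conv_of_real)
    also have "\<bar>c n / (2 * pi)\<bar>\<^sup>2 * (2 * pi / (c n)\<^sup>2) = 1 / (2 * pi)"
      using c[of n] by (simp add: field_simps power2_eq_square)
    finally show ?thesis by simp
  qed
  moreover have "(\<lambda>n. LINT z|lborel. v (x + (c n / (2 * pi)) *\<^sub>R z) * gauss z) \<longlonglongrightarrow> (LINT z|lborel. v x * gauss z)"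
  proof -
    obtain B where B: "B \<ge> 0" "\<And>x. norm (v x) \<le> B" using tame_bound[OF v] by blast
    show ?thesis
    proof (rule integral_dominated_convergence[where w = "\<lambda>z. B * gauss z"])
      have "c \<longlonglongrightarrow> 0" unfolding c_def by (rule LIMSEQ_Suc) (rule lim_1_over_n)
      then have "(\<lambda>n. x + (c n / (2 * pi)) *\<^sub>R z) \<longlonglongrightarrow> x + (0 / (2 * pi)) *\<^sub>R z" for z
        by (intro tendsto_intros) auto
      then have "(\<lambda>n. v (x + (c n / (2 * pi)) *\<^sub>R z)) \<longlonglongrightarrow> v x" for z
        by (intro continuous_on_tendsto_compose[OF tameD(1)[OF v]]) auto
      then show "AE z in lborel. (\<lambda>n. v (x + (c n / (2 * pi)) *\<^sub>R z) * gauss z) \<longlonglongrightarrow> v x * gauss z"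
        by (auto intro!: tendsto_intros)
      show "AE z in lborel. norm (v (x + (c n / (2 * pi)) *\<^sub>R z) * gauss z) \<le> B * gauss z" for n
        using B by (auto simp: norm_mult gauss_def)
    qed (use gauss_integral(1) in auto)
  qed
  moreover have "(LINT z|lborel. v x * gauss z) = v x * (2 * pi)"
    using gauss_integral(2) by simp
  ultimately have "(\<lambda>n. LINT \<xi>|lborel. fourier v \<xi> * (cis (2 * pi * (x \<bullet> \<xi>)) * complex_of_real (gauss (c n *\<^sub>R \<xi>))))
           \<longlonglongrightarrow> v x * (2 * pi) / (2 * pi)"
    by (simp only:) (intro tendsto_divide tendsto_const, auto)
  then show ?thesis by simp
qed

text \<open>The autocorrelation \<open>A\<close> of \<open>F\<close> is again continuous, bounded and integrable, its value at the origin is the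
squared \<open>L\<^sup>2\<close> norm of \<open>F\<close>, and its Fourier transform is \<open>\<bar>fourier F\<bar>\<^sup>2\<close>. Gauss summability for \<open>A\<close> at the origin
and monotone convergence (the transform of \<open>A\<close> is nonnegative) give the identity, and with it the
integrability of \<open>\<bar>fourier F\<bar>\<^sup>2\<close>.\<close>

theorem plancherel:
  assumes F: "tame F"
  shows "integrable lborel (\<lambda>\<xi>. (norm (fourier F \<xi>))\<^sup>2)"
    and "(LINT \<xi>|lborel. (norm (fourier F \<xi>))\<^sup>2) = (LINT x|lborel. (norm (F x))\<^sup>2)"
proof -
  define c where "c = (\<lambda>n. 1 / real (Suc n))"
  define A where "A = conv F (\<lambda>x. cnj (F (- x)))"
  have R: "tame (\<lambda>x. cnj (F (- x)))" by (rule tame_reflect[OF F])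
  have A: "tame A" unfolding A_def by (rule conv_tame[OF F tameD(2)[OF R]])
  have A0: "A 0 = (LINT x|lborel. (norm (F x))\<^sup>2)"
    unfolding A_def conv_def by (simp add: complex_norm_square[symmetric] del: of_real_power)
  have FA: "fourier A \<xi> = (norm (fourier F \<xi>))\<^sup>2" for \<xi>
    unfolding A_def fourier_conv[OF tameD(2)[OF F] tameD(2)[OF R]] fourier_reflect[OF tameD(3)[OF F]]
    by (rule complex_norm_square[symmetric])
  let ?h = "\<lambda>n \<xi>. (norm (fourier F \<xi>))\<^sup>2 * gauss (c n *\<^sub>R \<xi>)"
  have Fm [measurable]: "fourier F \<in> borel_measurable borel"
    by (intro borel_measurable_continuous_onI continuous_on_fourier tameD(2)[OF F])
  have lim: "(\<lambda>n. LINT \<xi>|lborel. ?h n \<xi>) \<longlonglongrightarrow> (LINT x|lborel. (norm (F x))\<^sup>2)"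
  proof -
    have "(\<lambda>n. complex_of_real (LINT \<xi>|lborel. ?h n \<xi>)) \<longlonglongrightarrow> complex_of_real (LINT x|lborel. (norm (F x))\<^sup>2)"
      using gauss_summability[OF A, of 0] unfolding A0 FA c_def
      by (simp flip: of_real_mult of_real_power add: integral_complex_of_real)
    then show ?thesis by (simp only: tendsto_of_real_iff)
  qed
  have hi: "integrable lborel (?h n)" for n
  proof -
    have c: "c n \<noteq> 0" by (simp add: c_def)
    obtain K where K: "\<And>\<xi>. norm (fourier F \<xi>) \<le> K" using norm_fourier_le[OF tameD(2)[OF F]] by blast
    have "integrable lborel (\<lambda>\<xi>. gauss (0 + c n *\<^sub>R \<xi>))" by (rule plane_integrable_affine[OF c gauss_integral(1)])
    then have "integrable lborel (\<lambda>\<xi>. K\<^sup>2 * gauss (c n *\<^sub>R \<xi>))" by simp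
    then show ?thesis
      by (rule Bochner_Integration.integrable_bound)
         (use K in \<open>auto simp: gauss_def abs_mult power_mono intro!: mult_right_mono\<close>)
  qed
  have mono: "mono (\<lambda>n. ?h n \<xi>)" for \<xi>
  proof (rule monoI)
    fix m n :: nat assume "m \<le> n"
    then have "(c n * norm \<xi>)\<^sup>2 \<le> (c m * norm \<xi>)\<^sup>2"
      by (intro power_mono mult_right_mono) (auto simp: c_def frac_le)
    then show "?h m \<xi> \<le> ?h n \<xi>" by (auto simp: gauss_def c_def intro!: mult_left_mono)
  qed
  have pt: "(\<lambda>n. ?h n \<xi>) \<longlonglongrightarrow> (norm (fourier F \<xi>))\<^sup>2" for \<xi>
  proof -
    have "c \<longlonglongrightarrow> 0" unfolding c_def by (rule LIMSEQ_Suc) (rule lim_1_over_n)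
    then have "(\<lambda>n. ?h n \<xi>) \<longlonglongrightarrow> (norm (fourier F \<xi>))\<^sup>2 * exp (- (norm (0 *\<^sub>R \<xi>))\<^sup>2 / 2)"
      unfolding gauss_def by (intro tendsto_intros) auto
    then show ?thesis by simp
  qed
  show "integrable lborel (\<lambda>\<xi>. (norm (fourier F \<xi>))\<^sup>2)"
    by (rule integrable_monotone_convergence[where f = ?h, OF hi _ _ lim]) (use mono pt in auto)
  show "(LINT \<xi>|lborel. (norm (fourier F \<xi>))\<^sup>2) = (LINT x|lborel. (norm (F x))\<^sup>2)"
    by (rule integral_monotone_convergence[where f = ?h, OF hi _ _ lim]) (use mono pt in auto)
qed

text \<open>With an integrable transform, dominated convergence removes the damping in \<open>gauss_summability\<close>.\<close>

theorem fourier_inversion: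
  assumes v: "tame v" and vi: "integrable lborel (fourier v)"
  shows "ifourier (fourier v) x = v x" "fourier (ifourier v) x = v x"
proof -
  define c where "c = (\<lambda>n. 1 / real (Suc n))"
  have Fm [measurable]: "fourier v \<in> borel_measurable borel" using vi by auto
  have "(\<lambda>n. LINT \<xi>|lborel. fourier v \<xi> * (cis (2 * pi * (x \<bullet> \<xi>)) * complex_of_real (gauss (c n *\<^sub>R \<xi>))))
     \<longlonglongrightarrow> (LINT \<xi>|lborel. fourier v \<xi> * cis (2 * pi * (x \<bullet> \<xi>)))"
  proof (rule integral_dominated_convergence[where w = "\<lambda>\<xi>. norm (fourier v \<xi>)"])
    have c0: "c \<longlonglongrightarrow> 0" unfolding c_def by (rule LIMSEQ_Suc) (rule lim_1_over_n)
    have "(\<lambda>n. gauss (c n *\<^sub>R \<xi>)) \<longlonglongrightarrow> exp (- (norm (0 *\<^sub>R \<xi>))\<^sup>2 / 2)" for \<xi>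
      unfolding gauss_def by (intro tendsto_intros c0) auto
    then have "(\<lambda>n. fourier v \<xi> * (cis (2 * pi * (x \<bullet> \<xi>)) * complex_of_real (gauss (c n *\<^sub>R \<xi>))))
      \<longlonglongrightarrow> fourier v \<xi> * (cis (2 * pi * (x \<bullet> \<xi>)) * complex_of_real 1)" for \<xi>
      by (intro tendsto_intros) simp
    then show "AE \<xi> in lborel. (\<lambda>n. fourier v \<xi> * (cis (2 * pi * (x \<bullet> \<xi>)) * complex_of_real (gauss (c n *\<^sub>R \<xi>))))
      \<longlonglongrightarrow> fourier v \<xi> * cis (2 * pi * (x \<bullet> \<xi>))" by simp
  qed (use vi in \<open>auto simp: norm_mult gauss_def mult_left_le\<close>)
  moreover have "(\<lambda>n. LINT \<xi>|lborel. fourier v \<xi> * (cis (2 * pi * (x \<bullet> \<xi>)) * complex_of_real (gauss (c n *\<^sub>R \<xi>))))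
     \<longlonglongrightarrow> v x"
    unfolding c_def by (rule gauss_summability[OF v])
  ultimately have "(LINT \<xi>|lborel. fourier v \<xi> * cis (2 * pi * (x \<bullet> \<xi>))) = v x"
    by (rule LIMSEQ_unique)
  then show 1: "ifourier (fourier v) x = v x"
    unfolding ifourier_def fourier_def[of "fourier v"] by (simp add: inner_commute mult.commute)
  show "fourier (ifourier v) x = v x"
    using fourier_uminus_arg[OF Fm, of x] 1 unfolding ifourier_def by simp
qed

section \<open>Smooth functions with compact support\<close>

text \<open>Smoothness of \<open>P 0\<close>, witnessed by all its derivatives at once. With the witness at hand, the mixed partial
derivatives of tensor products on the plane can be written down.\<close>

definition deriv_seq :: "(nat \<Rightarrow> real \<Rightarrow> real) \<Rightarrow> bool" where
  "deriv_seq P \<longleftrightarrow> (\<forall>n t. (P n has_real_derivative P (Suc n) t) (at t))"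

lemma deriv_seq_continuous: "deriv_seq P \<Longrightarrow> continuous_on A (P n)"
  unfolding deriv_seq_def by (meson DERIV_isCont continuous_at_imp_continuous_on)

lemma deriv_seq_scale: "deriv_seq P \<Longrightarrow> deriv_seq (\<lambda>n t. c * P n t)"
  unfolding deriv_seq_def by (auto intro!: derivative_eq_intros)

lemma deriv_seq_affine: "deriv_seq P \<Longrightarrow> deriv_seq (\<lambda>n t. c ^ n * P n (c * t + d))"
  unfolding deriv_seq_def
proof (intro allI)
  fix n t assume P: "\<forall>n t. (P n has_real_derivative P (Suc n) t) (at t)"
  have "((\<lambda>t. P n (c * t + d)) has_real_derivative P (Suc n) (c * t + d) * c) (at t)"
    by (rule DERIV_chain2[where f = "P n" and g = "\<lambda>t. c * t + d"])
       (use P in \<open>auto intro!: derivative_eq_intros\<close>)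
  from DERIV_cmult[OF this, of "c ^ n"]
  show "((\<lambda>t. c ^ n * P n (c * t + d)) has_real_derivative c ^ Suc n * P (Suc n) (c * t + d)) (at t)"
    by (simp add: mult_ac)
qed

text \<open>The derivatives of a product are sums of products \<open>P i * Q j\<close>. They are encoded by the
list of the occurring index pairs, on which differentiation acts by \<open>step\<close>.\<close>

lemma deriv_seq_mult:
  assumes P: "deriv_seq P" and Q: "deriv_seq Q"
  obtains S where "deriv_seq S" "\<And>t. S 0 t = P 0 t * Q 0 t"
proof -
  define h where "h = (\<lambda>xs t. \<Sum>(i, j)\<leftarrow>xs. P i t * Q j t)"
  define step :: "(nat \<times> nat) list \<Rightarrow> (nat \<times> nat) list"
    where "step = (\<lambda>xs. concat (map (\<lambda>(i, j). [(Suc i, j), (i, Suc j)]) xs))"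
  have d: "(h xs has_real_derivative h (step xs) t) (at t)" for xs t
  proof (induction xs)
    case Nil show ?case by (simp add: h_def step_def)
  next
    case (Cons p xs)
    obtain i j where p: "p = (i, j)" by (cases p)
    have "((\<lambda>t. P i t * Q j t) has_real_derivative P (Suc i) t * Q j t + P i t * Q (Suc j) t) (at t)"
      using P Q unfolding deriv_seq_def by (auto intro!: derivative_eq_intros)
    from DERIV_add[OF this Cons.IH] show ?case
      by (simp add: h_def step_def p add.assoc)
  qed
  show ?thesis
  proof (rule that[of "\<lambda>n. h ((step ^^ n) [(0, 0)])"])
    show "deriv_seq (\<lambda>n. h ((step ^^ n) [(0, 0)]))" unfolding deriv_seq_def using d by simp
    show "h ((step ^^ 0) [(0, 0)]) t = P 0 t * Q 0 t" for t by (simp add: h_def)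
  qed
qed

lemma deriv_seq_identity:
  "deriv_seq (\<lambda>n t. if n = 0 then t else if n = 1 then 1 else 0)"
  unfolding deriv_seq_def by (auto intro!: derivative_eq_intros)

lemma deriv_seq_support:
  assumes P: "deriv_seq P" and z: "\<And>t. r < \<bar>t\<bar> \<Longrightarrow> P 0 t = 0"
  shows "r < \<bar>t\<bar> \<Longrightarrow> P n t = 0"
proof (induction n arbitrary: t)
  case (Suc n)
  have "open {t::real. r < \<bar>t\<bar>}" by (intro open_Collect_less continuous_intros)
  then have "((\<lambda>_. 0) has_real_derivative P (Suc n) t) (at t)"
    using P Suc.IH Suc.prems unfolding deriv_seq_def
    by (intro has_field_derivative_transform_within_open[of "P n" "P (Suc n) t" t "{t. r < \<bar>t\<bar>}" "\<lambda>_. 0"]) auto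
  then show ?case using DERIV_const[of 0] DERIV_unique by blast
qed (use z in auto)

lemma deriv_seq_bounded:
  assumes P: "deriv_seq P" and z: "\<And>t. r < \<bar>t\<bar> \<Longrightarrow> P 0 t = 0"
  obtains K where "K \<ge> 0" "\<And>t. \<bar>P n t\<bar> \<le> K"
proof -
  have "compact (P n ` {-r..r})"
    by (intro compact_continuous_image deriv_seq_continuous[OF P]) simp
  then obtain K where K: "\<And>t. t \<in> {-r..r} \<Longrightarrow> \<bar>P n t\<bar> \<le> K"
    using compact_imp_bounded bounded_iff by (metis imageI real_norm_def)
  have "\<bar>P n t\<bar> \<le> max 0 K" for t
  proof (cases "r < \<bar>t\<bar>")
    case True then show ?thesis using deriv_seq_support[OF P z] by simp
  next
    case False
    then have "t \<in> {-r..r}" by auto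
    then show ?thesis using K by (simp add: le_max_iff_disj)
  qed
  then show ?thesis using that[of "max 0 K"] by auto
qed

lemma poly_times_exp_tendsto_0: "((\<lambda>x. poly p x * exp (- x)) \<longlongrightarrow> (0::real)) at_top"
proof -
  have "((\<lambda>x. \<Sum>i\<le>degree p. coeff p i * (x ^ i / exp x)) \<longlongrightarrow> (\<Sum>i\<le>degree p. coeff p i * 0)) at_top"
    by (intro tendsto_intros tendsto_power_div_exp_0)
  moreover have "(\<Sum>i\<le>degree p. coeff p i * (x ^ i / exp x)) = poly p x * exp (- x)" for x :: real
    by (simp add: poly_altdef sum_distrib_right exp_minus divide_inverse mult.assoc)
  ultimately show ?thesis by simp
qed

text \<open>The function \<open>exp (- 1 / t)\<close>, extended by zero. Its \<open>n\<close>-th derivative is a polynomial \<open>q n\<close> in \<open>1 / t\<close> times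
\<open>exp (- 1 / t)\<close>; the exponential beats every polynomial, which gives the derivative at the origin.\<close>

lemma flat_function:
  obtains E where "deriv_seq E" "\<And>t. E 0 t = (if t \<le> 0 then 0 else exp (- (1 / t)))"
proof -
  define q where "q = rec_nat (1 :: real poly) (\<lambda>_ p. [:0, 0, 1:] * (p - pderiv p))"
  have q: "q 0 = 1" "q (Suc n) = [:0, 0, 1:] * (q n - pderiv (q n))" for n by (simp_all add: q_def)
  define E where "E = (\<lambda>n t. if t \<le> 0 then 0 else poly (q n) (1 / t) * exp (- (1 / t)))"
  have "(E n has_real_derivative E (Suc n) t) (at t)" for n t
  proof -
    consider "t < 0" | "t = 0" | "t > 0" by linarith
    then show ?thesis
    proof cases
      case 1
      have "((\<lambda>_. 0) has_real_derivative 0) (at t)" by simp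
      then have "(E n has_real_derivative 0) (at t)"
        by (rule has_field_derivative_transform_within_open[where S = "{..<0}"]) (use 1 in \<open>auto simp: E_def\<close>)
      then show ?thesis using 1 by (simp add: E_def)
    next
      case 3
      have "((\<lambda>t. poly (q n) (1 / t) * exp (- (1 / t))) has_real_derivative
          poly (pderiv (q n)) (1 / t) * (- (1 / t\<^sup>2)) * exp (- (1 / t)) + poly (q n) (1 / t) * (exp (- (1 / t)) * (1 / t\<^sup>2))) (at t)"
        using 3 by (auto intro!: derivative_eq_intros DERIV_chain2[OF poly_DERIV] simp: power2_eq_square field_simps)
      also have "poly (pderiv (q n)) (1 / t) * (- (1 / t\<^sup>2)) * exp (- (1 / t)) + poly (q n) (1 / t) * (exp (- (1 / t)) * (1 / t\<^sup>2))
          = E (Suc n) t"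
        using 3 by (simp add: E_def q field_simps power2_eq_square)
      finally have *: "((\<lambda>t. poly (q n) (1 / t) * exp (- (1 / t))) has_real_derivative E (Suc n) t) (at t)" .
      show ?thesis
        by (rule has_field_derivative_transform_within_open[OF *, where S = "{0<..}"]) (use 3 in \<open>auto simp: E_def\<close>)
    next
      case 2
      have "((\<lambda>h. E n h / h) \<longlongrightarrow> 0) (at_left 0)"
        by (rule Lim_transform_eventually[OF tendsto_const]) (auto simp: E_def eventually_at_filter)
      moreover have "((\<lambda>h. E n h / h) \<longlongrightarrow> 0) (at_right 0)"
      proof (rule Lim_transform_eventually)
        show "((\<lambda>h. poly (pCons 0 (q n)) (inverse h) * exp (- inverse h)) \<longlongrightarrow> 0) (at_right 0)"
          by (rule filterlim_compose[OF poly_times_exp_tendsto_0 filterlim_inverse_at_top_right])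
      qed (auto simp: E_def eventually_at_filter field_simps)
      ultimately have "((\<lambda>h. E n h / h) \<longlongrightarrow> 0) (at 0)" using filterlim_split_at by blast
      then show ?thesis using 2 by (simp add: DERIV_def) (simp add: E_def)
    qed
  qed
  then have "deriv_seq E" unfolding deriv_seq_def by blast
  then show ?thesis using that[of E] by (simp add: E_def q)
qed

lemma line_bump:
  obtains B where "deriv_seq B" "\<And>t. 0 \<le> B 0 t" "\<And>t. 1 < \<bar>t\<bar> \<Longrightarrow> B 0 t = 0"
    "0 < B 0 0" "0 < integral {-1..1} (B 0)"
proof -
  obtain E where E: "deriv_seq E" "\<And>t. E 0 t = (if t \<le> 0 then 0 else exp (- (1 / t)))"
    using flat_function by blast
  obtain B where B: "deriv_seq B" "\<And>t. B 0 t = E 0 (t + 1) * E 0 (1 - t)"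
    using deriv_seq_mult[OF deriv_seq_affine[OF E(1), of 1 1] deriv_seq_affine[OF E(1), of "-1" 1]]
    by (auto simp: add.commute)
  have nn: "0 \<le> B 0 t" for t by (simp add: B E)
  have "integral {-1..1} (B 0) \<noteq> 0"
  proof
    assume "integral {-1..1} (B 0) = 0"
    then have "B 0 0 = 0"
      using integral_eq_0_iff[of "-1" 1 "B 0"] nn deriv_seq_continuous[OF B(1)] by auto
    then show False by (simp add: B E)
  qed
  moreover have "0 \<le> integral {-1..1} (B 0)"
    by (intro integral_nonneg integrable_continuous_real deriv_seq_continuous[OF B(1)]) (use nn in auto)
  ultimately have "0 < integral {-1..1} (B 0)" by linarith
  moreover have "B 0 t = 0" if "1 < \<bar>t\<bar>" for t using that by (auto simp: B E)
  moreover have "0 < B 0 0" by (simp add: B E)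
  ultimately show ?thesis using that[of B] B(1) nn by blast
qed

text \<open>The primitive \<open>H\<close> of a bump is a smooth step from \<open>0\<close> to the constant \<open>c\<close>; the product of a rising and a
falling step, divided by \<open>c\<^sup>2\<close>, is the cut-off.\<close>

lemma line_cutoff:
  assumes "0 < R"
  obtains P where "deriv_seq P" "\<And>t. \<bar>t\<bar> \<le> R \<Longrightarrow> P 0 t = 1" "\<And>t. R + 2 < \<bar>t\<bar> \<Longrightarrow> P 0 t = 0"
proof -
  obtain B where B: "deriv_seq B" "\<And>t. 0 \<le> B 0 t" "\<And>t. 1 < \<bar>t\<bar> \<Longrightarrow> B 0 t = 0"
    "0 < B 0 0" "0 < integral {-1..1} (B 0)" using line_bump by blast
  define c where "c = integral {-1..1} (B 0)"
  define H where "H = (\<lambda>n t. case n of 0 \<Rightarrow> integral {-2..t} (B 0) | Suc n \<Rightarrow> B n t)"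
  have int: "B 0 integrable_on {a..b}" for a b
    by (intro integrable_continuous_real deriv_seq_continuous[OF B(1)])
  have low: "integral {-2..t} (B 0) = 0" if "t \<le> -1" for t
  proof -
    have "B 0 (-1) = 0"
    proof -
      have "((B 0) \<longlongrightarrow> B 0 (-1)) (at_left (-1))"
        using deriv_seq_continuous[OF B(1), of UNIV 0] unfolding continuous_on_def
        by (meson UNIV_I subset_UNIV tendsto_within_subset)
      moreover have "((B 0) \<longlongrightarrow> 0) (at_left (-1))"
        by (rule Lim_transform_eventually[OF tendsto_const]) (use B(3) in \<open>auto simp: eventually_at_filter\<close>)
      ultimately show ?thesis using tendsto_unique trivial_limit_at_left_real by blast
    qed
    then have "B 0 s = 0" if "s \<le> -1" for s using B(3)[of s] that by (cases "s = -1") auto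
    then have "integral {-2..t} (B 0) = integral {-2..t} (\<lambda>_. 0)"
      by (intro Henstock_Kurzweil_Integration.integral_cong) (use that in auto)
    then show ?thesis by simp
  qed
  have high: "integral {-2..t} (B 0) = c" if "t \<ge> 1" for t
  proof -
    have z: "integral {1..t} (B 0) = integral {1..t} (\<lambda>_. 0)"
      by (rule integral_spike[of "{1}"]) (use B(3) in auto)
    have "integral {-2..t} (B 0) = integral {-2..-1} (B 0) + integral {-1..t} (B 0)"
      by (rule Henstock_Kurzweil_Integration.integral_combine[symmetric]) (use that int in auto)
    also have "integral {-1..t} (B 0) = integral {-1..1} (B 0) + integral {1..t} (B 0)"
      by (rule Henstock_Kurzweil_Integration.integral_combine[symmetric]) (use that int in auto)
    finally show ?thesis using z low[of "-1"] by (simp add: c_def)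
  qed
  have "(H n has_real_derivative H (Suc n) t) (at t)" for n t
  proof (cases n)
    case (Suc m) then show ?thesis using B(1) by (simp add: H_def deriv_seq_def)
  next
    case 0
    show ?thesis
    proof (cases "t < -1")
      case True
      have "((\<lambda>_. 0) has_real_derivative 0) (at t)" by simp
      then have "((\<lambda>t. integral {-2..t} (B 0)) has_real_derivative 0) (at t)"
        by (rule has_field_derivative_transform_within_open[where S = "{..<-1}"]) (use True low in auto)
      then show ?thesis using 0 True B(3) by (simp add: H_def)
    next
      case False
      have "((\<lambda>t. integral {-2..t} (B 0)) has_real_derivative B 0 t) (at t within {-2..t+1})"
        by (rule integral_has_real_derivative) (use False deriv_seq_continuous[OF B(1)] in auto)
      moreover have "at t within {-2..t+1} = at t" using False by (intro at_within_interior) auto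
      ultimately show ?thesis using 0 by (simp add: H_def)
    qed
  qed
  then have H: "deriv_seq H" unfolding deriv_seq_def by blast
  obtain S where S: "deriv_seq S" "\<And>t. S 0 t = H 0 (t + (R + 1)) * H 0 (R + 1 - t)"
    using deriv_seq_mult[OF deriv_seq_affine[OF H, of 1 "R + 1"] deriv_seq_affine[OF H, of "-1" "R + 1"]]
    by (auto simp: add.commute)
  have c: "c > 0" using B(5) by (simp add: c_def)
  show ?thesis
  proof (rule that[OF deriv_seq_scale[OF S(1), of "1 / c\<^sup>2"]])
    show "1 / c\<^sup>2 * S 0 t = 1" if "\<bar>t\<bar> \<le> R" for t
      using that c by (auto simp: S H_def high power2_eq_square)
    show "1 / c\<^sup>2 * S 0 t = 0" if "R + 2 < \<bar>t\<bar>" for t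
      using that assms low by (cases "t \<ge> 0") (auto simp: S H_def)
  qed
qed

text \<open>The analogue of \<^const>\<open>deriv_seq\<close> on the plane: \<open>F a b\<close> is the derivative of \<open>F 0 0\<close> of order \<open>a\<close> in the first
and \<open>b\<close> in the second coordinate. Membership yields at once \<^const>\<open>Ck\<close> for all orders and the
values of \<^const>\<open>partials\<close>.\<close>

definition deriv_family :: "(nat \<Rightarrow> nat \<Rightarrow> plane \<Rightarrow> 'b::real_normed_vector) \<Rightarrow> bool" where
  "deriv_family F \<longleftrightarrow> (\<forall>a b x. (F a b has_derivative
     (\<lambda>h. (h $ 1) *\<^sub>R F (Suc a) b x + (h $ 2) *\<^sub>R F a (Suc b) x)) (at x))"

lemma deriv_family_add:
  "deriv_family F \<Longrightarrow> deriv_family G \<Longrightarrow> deriv_family (\<lambda>a b x. F a b x + G a b x)"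
  unfolding deriv_family_def
proof (intro allI)
  fix a b x
  assume "\<forall>a b x. (F a b has_derivative (\<lambda>h. (h $ 1) *\<^sub>R F (Suc a) b x + (h $ 2) *\<^sub>R F a (Suc b) x)) (at x)"
    and "\<forall>a b x. (G a b has_derivative (\<lambda>h. (h $ 1) *\<^sub>R G (Suc a) b x + (h $ 2) *\<^sub>R G a (Suc b) x)) (at x)"
  then have "((\<lambda>x. F a b x + G a b x) has_derivative
     (\<lambda>h. ((h $ 1) *\<^sub>R F (Suc a) b x + (h $ 2) *\<^sub>R F a (Suc b) x)
        + ((h $ 1) *\<^sub>R G (Suc a) b x + (h $ 2) *\<^sub>R G a (Suc b) x))) (at x)"
    by (intro has_derivative_add) auto
  then show "((\<lambda>x. F a b x + G a b x) has_derivative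
     (\<lambda>h. (h $ 1) *\<^sub>R (F (Suc a) b x + G (Suc a) b x) + (h $ 2) *\<^sub>R (F a (Suc b) x + G a (Suc b) x))) (at x)"
    by (simp add: algebra_simps)
qed

lemma deriv_family_shift:
  assumes "deriv_family F" shows "deriv_family (\<lambda>a b x. F a b (x - p))"
  unfolding deriv_family_def
proof (intro allI)
  fix a b and x :: plane
  have "((\<lambda>x. x - p) has_derivative (\<lambda>h. h)) (at x)" by (auto intro!: derivative_eq_intros)
  from has_derivative_compose[OF this, of "F a b"] assms
  show "((\<lambda>x. F a b (x - p)) has_derivative (\<lambda>h. (h $ 1) *\<^sub>R F (Suc a) b (x - p) + (h $ 2) *\<^sub>R F a (Suc b) (x - p))) (at x)"
    unfolding deriv_family_def by blast
qed

lemma deriv_family_tensor: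
  assumes "deriv_seq P" "deriv_seq Q"
  shows "deriv_family (\<lambda>a b x. (P a (x $ 1) * Q b (x $ 2)) *\<^sub>R v)"
  unfolding deriv_family_def
proof (intro allI)
  fix a b :: nat and x :: plane
  have P: "((\<lambda>x::plane. P a (x $ 1)) has_derivative (\<lambda>h. P (Suc a) (x $ 1) * (h $ 1))) (at x)"
    by (rule has_derivative_compose[where f = "\<lambda>x. x $ 1" and g = "P a" and f' = "\<lambda>h. h $ 1"])
       (use assms(1) in \<open>auto simp: deriv_seq_def has_field_derivative_def bounded_linear_imp_has_derivative[OF bounded_linear_vec_nth]\<close>)
  have Q: "((\<lambda>x::plane. Q b (x $ 2)) has_derivative (\<lambda>h. Q (Suc b) (x $ 2) * (h $ 2))) (at x)"
    by (rule has_derivative_compose[where f = "\<lambda>x. x $ 2" and g = "Q b" and f' = "\<lambda>h. h $ 2"])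
       (use assms(2) in \<open>auto simp: deriv_seq_def has_field_derivative_def bounded_linear_imp_has_derivative[OF bounded_linear_vec_nth]\<close>)
  have "((\<lambda>x. (P a (x $ 1) * Q b (x $ 2)) *\<^sub>R v) has_derivative
      (\<lambda>h. (P a (x $ 1) * (Q (Suc b) (x $ 2) * (h $ 2)) + P (Suc a) (x $ 1) * (h $ 1) * Q b (x $ 2)) *\<^sub>R v)) (at x)"
    by (intro has_derivative_scaleR_left has_derivative_mult P Q)
  then show "((\<lambda>x. (P a (x $ 1) * Q b (x $ 2)) *\<^sub>R v) has_derivative
      (\<lambda>h. (h $ 1) *\<^sub>R (P (Suc a) (x $ 1) * Q b (x $ 2)) *\<^sub>R v + (h $ 2) *\<^sub>R (P a (x $ 1) * Q (Suc b) (x $ 2)) *\<^sub>R v)) (at x)"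
    by (simp add: algebra_simps)
qed

lemma deriv_family_partial:
  assumes "deriv_family F"
  shows "partial 1 (F a b) = F (Suc a) b" "partial 2 (F a b) = F a (Suc b)"
proof -
  have "frechet_derivative (F a b) (at x) = (\<lambda>h. (h $ 1) *\<^sub>R F (Suc a) b x + (h $ 2) *\<^sub>R F a (Suc b) x)" for x
    using assms unfolding deriv_family_def by (intro frechet_derivative_at[symmetric]) blast
  then show "partial 1 (F a b) = F (Suc a) b" "partial 2 (F a b) = F a (Suc b)"
    by (auto simp: partial_def fun_eq_iff axis_def)
qed

lemma deriv_family_Ck: "deriv_family F \<Longrightarrow> Ck k (F a b)"
proof (induction k arbitrary: a b)
  case 0
  then have "F a b differentiable (at x)" for x unfolding deriv_family_def differentiable_def by blast
  then show ?case by (simp add: continuous_at_imp_continuous_on differentiable_imp_continuous_within)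
next
  case (Suc k)
  have "F a b differentiable (at x)" for x using Suc.prems unfolding deriv_family_def differentiable_def by blast
  moreover have "Ck k (partial i (F a b))" for i
    using Suc exhaust_2[of i] by (auto simp: deriv_family_partial)
  ultimately show ?case by simp
qed

lemma deriv_family_partials:
  assumes "deriv_family F" shows "partials (a', b') (F a b) = F (a + a') (b + b')"
proof -
  have "(partial 2 ^^ b') (F a b) = F a (b + b')" for a
    by (induction b') (auto simp: deriv_family_partial[OF assms])
  moreover have "(partial 1 ^^ a') (F a b) = F (a + a') b" for b
    by (induction a') (auto simp: deriv_family_partial[OF assms])
  ultimately show ?thesis by (simp add: partials_def)
qed

lemma compact_supp_box:
  fixes f :: "plane \<Rightarrow> 'b::zero" and a :: plane
  assumes "\<And>x. r < \<bar>x $ 1 - a $ 1\<bar> \<or> r < \<bar>x $ 2 - a $ 2\<bar> \<Longrightarrow> f x = 0"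
  shows "compact (supp f)"
proof -
  have "{x. f x \<noteq> 0} \<subseteq> cball a (2 * r)"
  proof
    fix x assume "x \<in> {x. f x \<noteq> 0}"
    then have "\<bar>x $ 1 - a $ 1\<bar> \<le> r" "\<bar>x $ 2 - a $ 2\<bar> \<le> r" using assms[of x] by fastforce+
    moreover have "norm (x - a) \<le> \<bar>(x - a) $ 1\<bar> + \<bar>(x - a) $ 2\<bar>"
      using norm_le_l1_cart[of "x - a"] by (simp add: sum_2)
    ultimately show "x \<in> cball a (2 * r)" by (simp add: dist_norm norm_minus_commute)
  qed
  then have "supp f \<subseteq> cball a (2 * r)" unfolding supp_def by (rule closure_minimal) simp
  then show ?thesis unfolding supp_def
    by (meson bounded_cball bounded_subset closed_closure compact_eq_bounded_closed)
qed

text \<open>The cut-off vector field depends linearly on the matrix and is built from two fixed tensor products of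
compactly supported smooth functions on the line, one for each column of \<open>N\<close>. So each derivative is bounded by a constant,
which depends on the order and on \<open>R\<close>, times the largest entry of \<open>N\<close>.\<close>

lemma cut_off_linear_field:
  assumes R: "0 < R"
  obtains T :: "real ^ 2 ^ 2 \<Rightarrow> plane \<Rightarrow> plane" where
    "\<And>N. Cc_infinity (T N)"
    "\<And>N x. norm x \<le> R \<Longrightarrow> T N x = N *v x"
    "\<And>m. \<exists>C\<ge>0. \<forall>N s. (\<forall>k l. \<bar>N $ k $ l\<bar> \<le> s) \<longrightarrow> Cm_norm m (T N) \<le> ennreal (C * s)"
    "\<exists>K\<ge>0. \<forall>N s x. (\<forall>k l. \<bar>N $ k $ l\<bar> \<le> s) \<longrightarrow>
       (\<exists>D. (T N has_derivative D) (at x) \<and> (\<forall>k l. \<bar>D (axis l 1) $ k\<bar> \<le> K * s))"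
proof -
  obtain P where P: "deriv_seq P" "\<And>t. \<bar>t\<bar> \<le> R \<Longrightarrow> P 0 t = 1" "\<And>t. R + 2 < \<bar>t\<bar> \<Longrightarrow> P 0 t = 0"
    using line_cutoff[OF R] by blast
  obtain Q where Q: "deriv_seq Q" "\<And>t. Q 0 t = t * P 0 t"
    using deriv_seq_mult[OF deriv_seq_identity P(1)] by auto
  have Qz: "R + 2 < \<bar>t\<bar> \<Longrightarrow> Q 0 t = 0" for t using P(3) Q(2) by simp
  define F :: "real ^ 2 ^ 2 \<Rightarrow> nat \<Rightarrow> nat \<Rightarrow> plane \<Rightarrow> plane" where
    "F = (\<lambda>N a b x. (Q a (x $ 1) * P b (x $ 2)) *\<^sub>R column 1 N + (P a (x $ 1) * Q b (x $ 2)) *\<^sub>R column 2 N)"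
  have fam: "deriv_family (F N)" for N
    unfolding F_def by (intro deriv_family_add deriv_family_tensor P(1) Q(1))
  have bound: "\<exists>K\<ge>0. \<forall>N s x. (\<forall>k l. \<bar>N $ k $ l\<bar> \<le> s) \<longrightarrow> norm (F N a b x) \<le> K * s" for a b
  proof -
    obtain p where p: "p \<ge> 0" "\<And>t. \<bar>P a t\<bar> \<le> p" using deriv_seq_bounded[OF P(1,3)] by blast
    obtain p' where p': "p' \<ge> 0" "\<And>t. \<bar>P b t\<bar> \<le> p'" using deriv_seq_bounded[OF P(1,3)] by blast
    obtain q where q: "q \<ge> 0" "\<And>t. \<bar>Q a t\<bar> \<le> q" using deriv_seq_bounded[OF Q(1) Qz] by blast
    obtain q' where q': "q' \<ge> 0" "\<And>t. \<bar>Q b t\<bar> \<le> q'" using deriv_seq_bounded[OF Q(1) Qz] by blast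
    have "norm (F N a b x) \<le> (q * p' * 2 + p * q' * 2) * s" if N: "\<forall>k l. \<bar>N $ k $ l\<bar> \<le> s" for N s x
    proof -
      have col: "norm (column l N) \<le> 2 * s" for l
      proof -
        have "\<bar>column l N $ 1\<bar> \<le> s" "\<bar>column l N $ 2\<bar> \<le> s" using N by (simp_all add: column_def)
        then show ?thesis using norm_le_l1_cart[of "column l N"] by (simp add: sum_2)
      qed
      have "norm (F N a b x) \<le> norm ((Q a (x $ 1) * P b (x $ 2)) *\<^sub>R column 1 N) + norm ((P a (x $ 1) * Q b (x $ 2)) *\<^sub>R column 2 N)"
        unfolding F_def by (rule norm_triangle_ineq)
      also have "\<dots> \<le> (q * p') * (2 * s) + (p * q') * (2 * s)"
        using p p' q q' col by (auto simp: abs_mult intro!: add_mono mult_mono)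
      finally show ?thesis by (simp add: algebra_simps)
    qed
    then show ?thesis using p p' q q' by (intro exI[of _ "q * p' * 2 + p * q' * 2"]) auto
  qed
  then obtain K where K: "\<And>a b. K a b \<ge> 0"
    "\<And>a b N s x. (\<forall>k l. \<bar>N $ k $ l\<bar> \<le> s) \<Longrightarrow> norm (F N a b x) \<le> K a b * s" by metis
  show ?thesis
  proof (rule that[of "\<lambda>N. F N 0 0"])
    fix N
    have "F N 0 0 x = 0" if "R + 2 < \<bar>x $ 1 - 0 $ 1\<bar> \<or> R + 2 < \<bar>x $ 2 - 0 $ 2\<bar>" for x
      using that P(3) Qz by (auto simp: F_def)
    then have "compact (supp (F N 0 0))" by (rule compact_supp_box)
    then show "Cc_infinity (F N 0 0)" unfolding Cc_infinity_def using deriv_family_Ck[OF fam] by blast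
  next
    fix N and x :: plane assume "norm x \<le> R"
    then have "\<bar>x $ 1\<bar> \<le> R" "\<bar>x $ 2\<bar> \<le> R" using component_le_norm_cart order_trans by blast+
    then have "F N 0 0 x = (x $ 1) *\<^sub>R column 1 N + (x $ 2) *\<^sub>R column 2 N"
      by (simp add: F_def P Q)
    also have "\<dots> = N *v x" by (simp add: vec_eq_iff matrix_vector_mult_def column_def sum_2)
    finally show "F N 0 0 x = N *v x" .
  next
    fix m
    let ?I = "{\<nu>::nat \<times> nat. fst \<nu> + snd \<nu> \<le> m}"
    have "?I \<subseteq> {..m} \<times> {..m}" by auto
    then have fin: "finite ?I" by (rule finite_subset) auto
    have "Cm_norm m (F N 0 0) \<le> ennreal ((\<Sum>\<nu>\<in>?I. K (fst \<nu>) (snd \<nu>)) * s)"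
      if N: "\<forall>k l. \<bar>N $ k $ l\<bar> \<le> s" for N s
    proof -
      have s: "s \<ge> 0" using N by (meson abs_ge_zero order_trans)
      have "Linf_norm lborel (partials \<nu> (F N 0 0)) \<le> ennreal (K (fst \<nu>) (snd \<nu>) * s)" for \<nu>
      proof -
        have e: "partials \<nu> (F N 0 0) = F N (fst \<nu>) (snd \<nu>)"
          using deriv_family_partials[OF fam, of "fst \<nu>" "snd \<nu>"] by simp
        have "continuous_on UNIV (F N (fst \<nu>) (snd \<nu>))" using deriv_family_Ck[OF fam, of 0] by simp
        then have [measurable]: "F N (fst \<nu>) (snd \<nu>) \<in> borel_measurable borel" by (rule borel_measurable_continuous_onI)
        show ?thesis unfolding Linf_norm_def e
          by (rule esssup_I) (use K(2)[OF N] in \<open>auto intro!: ennreal_leI\<close>)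
      qed
      then have "Cm_norm m (F N 0 0) \<le> (\<Sum>\<nu>\<in>?I. ennreal (K (fst \<nu>) (snd \<nu>) * s))"
        unfolding Cm_norm_def by (intro sum_mono) blast
      also have "\<dots> = ennreal ((\<Sum>\<nu>\<in>?I. K (fst \<nu>) (snd \<nu>)) * s)"
        using K(1) s by (subst sum_ennreal) (auto simp: sum_distrib_right)
      finally show ?thesis .
    qed
    then show "\<exists>C\<ge>0. \<forall>N s. (\<forall>k l. \<bar>N $ k $ l\<bar> \<le> s) \<longrightarrow> Cm_norm m (F N 0 0) \<le> ennreal (C * s)"
      using K(1) by (intro exI[of _ "\<Sum>\<nu>\<in>?I. K (fst \<nu>) (snd \<nu>)"]) (auto intro!: sum_nonneg)
  next
    have "\<exists>D. (F N 0 0 has_derivative D) (at x) \<and> (\<forall>k l. \<bar>D (axis l 1) $ k\<bar> \<le> (K 1 0 + K 0 1) * s)"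
      if N: "\<forall>k l. \<bar>N $ k $ l\<bar> \<le> s" for N s x
    proof (intro exI conjI allI)
      show "(F N 0 0 has_derivative (\<lambda>h. (h $ 1) *\<^sub>R F N 1 0 x + (h $ 2) *\<^sub>R F N 0 1 x)) (at x)"
        using fam[of N] unfolding deriv_family_def One_nat_def by blast
      fix k l :: 2
      have s: "s \<ge> 0" using N by (meson abs_ge_zero order_trans)
      have "\<bar>F N 1 0 x $ k\<bar> \<le> K 1 0 * s" "\<bar>F N 0 1 x $ k\<bar> \<le> K 0 1 * s"
        using K(2)[OF N] component_le_norm_cart order_trans by blast+
      moreover have "0 \<le> K 1 0 * s" "0 \<le> K 0 1 * s" using K(1) s by auto
      ultimately show "\<bar>((axis l 1 $ 1) *\<^sub>R F N 1 0 x + (axis l 1 $ 2) *\<^sub>R F N 0 1 x) $ k\<bar> \<le> (K 1 0 + K 0 1) * s"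
        using exhaust_2[of l] by (auto simp: axis_def distrib_right)
    qed
    then show "\<exists>K\<ge>0. \<forall>N s x. (\<forall>k l. \<bar>N $ k $ l\<bar> \<le> s) \<longrightarrow>
       (\<exists>D. (F N 0 0 has_derivative D) (at x) \<and> (\<forall>k l. \<bar>D (axis l 1) $ k\<bar> \<le> K * s))"
      using K(1)[of 1 0] K(1)[of 0 1] by (intro exI[of _ "K 1 0 + K 0 1"]) auto
  qed
qed

section \<open>Lipschitz bounds from bounded weak gradients\<close>

lemma integral_continuous_supported:
  fixes f :: "plane \<Rightarrow> 'b::euclidean_space"
  assumes f: "continuous_on UNIV f" and z: "\<And>x. x \<notin> cbox L U \<Longrightarrow> f x = 0"
  shows "integrable lborel f" "(LINT x|lborel. f x) = integral (cbox L U) f"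
proof -
  have "f = (\<lambda>x. indicator (cbox L U) x *\<^sub>R f x)" using z by (auto simp: fun_eq_iff indicator_def)
  then show i: "integrable lborel f"
    using borel_integrable_compact[of "cbox L U" f] continuous_on_subset[OF f] by (metis compact_cbox subset_UNIV)
  have "integral UNIV f = integral (cbox L U) f"
  proof -
    have "(\<lambda>x. if x \<in> cbox L U then f x else 0) = f" using z by auto
    then show ?thesis using integral_restrict_UNIV[of "cbox L U" f] by simp
  qed
  then show "(LINT x|lborel. f x) = integral (cbox L U) f" using integral_lborel[OF i] by simp
qed

lemma open_AE_empty:
  fixes U :: "plane set"
  assumes U: "open U" and ae: "AE x in lborel. x \<notin> U"
  shows "U = {}"
proof (rule ccontr)
  have "U \<in> null_sets lborel" using AE_iff_null_sets[of U lborel] borel_open[OF U] ae by simp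
  then have "negligible U" by (simp add: negligible_iff_null_sets null_sets_completionI)
  then show "U \<noteq> {} \<Longrightarrow> False" using open_not_negligible[OF U] by blast
qed

lemma integral_continuous_pos:
  fixes f :: "plane \<Rightarrow> real"
  assumes f: "continuous_on UNIV f" "integrable lborel f" "\<And>x. 0 \<le> f x" "0 < f a"
  shows "0 < (LINT x|lborel. f x)"
proof -
  have "(LINT x|lborel. f x) \<noteq> 0"
  proof
    assume "(LINT x|lborel. f x) = 0"
    then have "AE x in lborel. x \<notin> {x. f x \<noteq> 0}"
      using integral_nonneg_eq_0_iff_AE[OF f(2)] f(3) by auto
    moreover have "open {x. f x \<noteq> 0}" by (rule open_Collect_neq[OF f(1)]) auto
    ultimately show False using open_AE_empty[of "{x. f x \<noteq> 0}"] f(4) by force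
  qed
  moreover have "0 \<le> (LINT x|lborel. f x)" using f(3) by (simp add: Bochner_Integration.integral_nonneg)
  ultimately show ?thesis by linarith
qed

text \<open>Testing the weak gradient against a bump \<open>w\<close> that slides from \<open>a\<close> to \<open>y\<close> computes the derivative of the
local averages \<open>K t\<close> of \<open>u\<close>; it is at most \<open>2 * C * \<bar>y - a\<bar>\<close> times the mass of \<open>w\<close>. As the bump shrinks, the
averages at the two end points converge to \<open>u a\<close> and \<open>u y\<close>. The factor 2 comes from estimating the two
coordinates separately.\<close>

lemma lipschitz_of_weak_gradient:
  fixes u :: "plane \<Rightarrow> complex"
  assumes u: "continuous_on UNIV u" and W: "weak_gradient (ball a r) u G"
    and G: "Linf_norm (restrict_space lborel (ball a r)) G \<le> ennreal C" and C: "0 \<le> C"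
    and y: "y \<in> ball a r"
  shows "norm (u y - u a) \<le> 2 * C * norm (y - a)"
proof (rule field_le_epsilon)
  fix e :: real assume e: "0 < e"
  define v where "v = y - a"
  have vr: "norm v < r" using y by (simp add: v_def dist_norm norm_minus_commute)
  have "\<exists>d>0. \<forall>z. norm (z - b) < d \<longrightarrow> norm (u z - u b) \<le> e / 2" for b
  proof -
    have "isCont u b" using u by (simp add: continuous_on_eq_continuous_at)
    then show ?thesis unfolding continuous_at_eps_delta using e
      by (metis dist_norm half_gt_zero less_imp_le)
  qed
  then obtain d where d: "\<And>b. d b > 0" "\<And>b z. norm (z - b) < d b \<Longrightarrow> norm (u z - u b) \<le> e / 2" by metis
  \<comment> \<open>The bump is supported in a square of half-width \<open>\<delta>\<close>, hence in a disc of radius \<open>2 * \<delta>\<close>, and this disc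
    has to stay inside the ball on the whole way and inside the regions of small oscillation at both ends.\<close>
  define \<delta> where "\<delta> = min (min (d a) (d y)) (r - norm v) / 3"
  have \<delta>: "0 < \<delta>" "2 * \<delta> < d a" "2 * \<delta> < d y" "2 * \<delta> < r - norm v"
    using d(1)[of a] d(1)[of y] vr by (auto simp: \<delta>_def min_def)
  obtain B where B: "deriv_seq B" "\<And>t. 0 \<le> B 0 t" "\<And>t. 1 < \<bar>t\<bar> \<Longrightarrow> B 0 t = 0" "0 < B 0 0"
    "0 < integral {-1..1} (B 0)" using line_bump by blast
  define P where "P = (\<lambda>n t. (1 / \<delta>) ^ n * B n ((1 / \<delta>) * t + 0))"
  have P: "deriv_seq P" unfolding P_def by (rule deriv_seq_affine[OF B(1)])
  have P0: "P 0 t = 0" if "\<delta> < \<bar>t\<bar>" for t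
  proof -
    have "1 < \<bar>t\<bar> / \<delta>" using that \<delta>(1) by simp
    then have "1 < \<bar>t / \<delta>\<bar>" using \<delta>(1) by simp
    then show ?thesis using B(3)[of "t / \<delta>"] by (simp add: P_def)
  qed
  define F where "F = (\<lambda>i j (x::plane). (P i (x $ 1) * P j (x $ 2)) *\<^sub>R (1::real))"
  have fam: "deriv_family F" unfolding F_def by (intro deriv_family_tensor P)
  have F0: "F i j x = 0" if "\<delta> < \<bar>x $ 1\<bar> \<or> \<delta> < \<bar>x $ 2\<bar>" for i j x
    using that deriv_seq_support[OF P P0] by (auto simp: F_def)
  have Fc: "continuous_on UNIV (F i j)" for i j using deriv_family_Ck[OF fam, of 0] by simp
  have Fn: "norm x \<le> 2 * \<delta>" if "F i j x \<noteq> 0" for i j x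
  proof -
    have "\<bar>x $ 1\<bar> \<le> \<delta>" "\<bar>x $ 2\<bar> \<le> \<delta>" using that F0[of x i j] by fastforce+
    then show ?thesis using norm_le_l1_cart[of x] by (simp add: sum_2)
  qed
  define w where "w = F 0 0"
  have w: "continuous_on UNIV w" "\<And>x. 0 \<le> w x" "0 < w 0"
    using Fc[of 0 0] B(2,4) by (simp_all add: w_def F_def P_def)
  define p where "p = (\<lambda>t. a + t *\<^sub>R v)"
  have inball: "cball (p t) (2 * \<delta>) \<subseteq> ball a r" if "t \<in> {0..1}" for t
  proof
    fix x assume x: "x \<in> cball (p t) (2 * \<delta>)"
    have "norm (x - a) \<le> norm (x - p t) + norm (t *\<^sub>R v)"
      using norm_triangle_ineq[of "x - p t" "t *\<^sub>R v"] by (simp add: p_def)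
    also have "norm (t *\<^sub>R v) \<le> norm v" using that by (simp add: mult_left_le_one_le)
    finally show "x \<in> ball a r" using x \<delta>(4) by (simp add: dist_norm norm_minus_commute)
  qed
  obtain L where L: "ball a r \<subseteq> cbox (- L) L" using bounded_subset_cbox_symmetric[OF bounded_ball] by blast
  have Fz: "F i j (x - p t) = 0" if "t \<in> {0..1}" "x \<notin> cbox (- L) L" for i j t x
    using Fn[of i j "x - p t"] inball[OF that(1)] L that(2)
    by (auto simp: dist_norm norm_minus_commute subset_iff)
  have Fi: "integrable lborel (\<lambda>x. F i j (x - p t) *\<^sub>R u x)"
      "(LINT x|lborel. F i j (x - p t) *\<^sub>R u x) = integral (cbox (- L) L) (\<lambda>x. F i j (x - p t) *\<^sub>R u x)"
      "(\<lambda>x. F i j (x - p t) *\<^sub>R u x) integrable_on cbox (- L) L" if t: "t \<in> {0..1}" for i j t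
  proof -
    have c: "continuous_on UNIV (\<lambda>x. F i j (x - p t) *\<^sub>R u x)"
      by (intro continuous_intros u continuous_on_compose2[OF Fc]) auto
    show "integrable lborel (\<lambda>x. F i j (x - p t) *\<^sub>R u x)"
      "(LINT x|lborel. F i j (x - p t) *\<^sub>R u x) = integral (cbox (- L) L) (\<lambda>x. F i j (x - p t) *\<^sub>R u x)"
      using integral_continuous_supported[OF c, of "- L" L] Fz[OF t] by auto
    show "(\<lambda>x. F i j (x - p t) *\<^sub>R u x) integrable_on cbox (- L) L"
      by (rule integrable_continuous) (rule continuous_on_subset[OF c subset_UNIV])
  qed
  define I where "I = (LINT x|lborel. w x)"
  have wi: "integrable lborel w"
  proof -
    obtain L' where "cball (0::plane) (2 * \<delta>) \<subseteq> cbox (- L') L'"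
      using bounded_subset_cbox_symmetric[OF bounded_cball] by blast
    then show ?thesis using integral_continuous_supported(1)[OF w(1), of "- L'" L'] Fn[of 0 0]
      unfolding w_def by (metis mem_cball_0 subset_iff)
  qed
  have I: "0 < I" unfolding I_def by (rule integral_continuous_pos[OF w(1) wi w(2,3)])
  have Ip: "(LINT x|lborel. w (x - q)) = I" for q
    unfolding I_def by (rule plane_integral_shift(2)) (use wi in auto)
  define K where "K = (\<lambda>t. LINT x|lborel. w (x - p t) *\<^sub>R u x)"
  define K' where "K' = (\<lambda>t. integral (cbox (- L) L) (\<lambda>x. (- (v $ 1 * F 1 0 (x - p t) + v $ 2 * F 0 1 (x - p t))) *\<^sub>R u x))"
  have Kd: "(K has_vector_derivative K' t) (at t within {0..1})" if t: "t \<in> {0..1}" for t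
  proof -
    have "((\<lambda>t. integral (cbox (- L) L) (\<lambda>x. w (x - p t) *\<^sub>R u x)) has_vector_derivative K' t) (at t within {0..1})"
      unfolding K'_def
    proof (rule leibniz_rule_vector_derivative[OF _ _ _ t])
      fix s x assume s: "s \<in> {0..1::real}"
      have "((\<lambda>s. x - p s) has_derivative (\<lambda>h. - (h *\<^sub>R v))) (at s within {0..1})"
        unfolding p_def by (auto intro!: derivative_eq_intros)
      moreover have "(w has_derivative (\<lambda>h. (h $ 1) *\<^sub>R F 1 0 (x - p s) + (h $ 2) *\<^sub>R F 0 1 (x - p s))) (at (x - p s))"
        using fam unfolding deriv_family_def w_def One_nat_def by blast
      ultimately have "((\<lambda>s. w (x - p s)) has_derivative
         (\<lambda>h. ((- (h *\<^sub>R v)) $ 1) *\<^sub>R F 1 0 (x - p s) + ((- (h *\<^sub>R v)) $ 2) *\<^sub>R F 0 1 (x - p s))) (at s within {0..1})"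
        by (rule has_derivative_compose)
      from has_derivative_scaleR_left[OF this, of "u x"]
      show "((\<lambda>s. w (x - p s) *\<^sub>R u x) has_vector_derivative
          (- (v $ 1 * F 1 0 (x - p s) + v $ 2 * F 0 1 (x - p s))) *\<^sub>R u x) (at s within {0..1})"
        unfolding has_vector_derivative_def by (simp add: algebra_simps)
    next
      show "(\<lambda>x. w (x - p s) *\<^sub>R u x) integrable_on cbox (- L) L" if "s \<in> {0..1}" for s
        unfolding w_def by (rule Fi(3)[OF that])
      have "continuous_on ({0..1} \<times> cbox (- L) L) (\<lambda>z. F i j (snd z - p (fst z)))" for i j
        unfolding p_def by (rule continuous_on_compose2[OF Fc]) (auto intro!: continuous_intros)
      moreover have "continuous_on ({0..1::real} \<times> cbox (- L) L) (\<lambda>z. u (snd z))"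
        by (rule continuous_on_compose2[OF u]) (auto intro!: continuous_intros)
      ultimately show "continuous_on ({0..1} \<times> cbox (- L) L)
          (\<lambda>(s, x). (- (v $ 1 * F 1 0 (x - p s) + v $ 2 * F 0 1 (x - p s))) *\<^sub>R u x)"
        unfolding split_beta by (intro continuous_intros)
    qed simp
    then show ?thesis
      by (rule has_vector_derivative_transform[OF t, rotated])
         (simp add: K_def w_def Fi(2))
  qed
  have K'b: "norm (K' t) \<le> 2 * C * norm v * I" if t: "t \<in> {0..1}" for t
  proof -
    let ?\<phi> = "\<lambda>i j x. F i j (x - p t)"
    have famt: "deriv_family ?\<phi>" by (rule deriv_family_shift[OF fam])
    have sub: "supp (?\<phi> 0 0) \<subseteq> ball a r"
    proof -
      have "{x. ?\<phi> 0 0 x \<noteq> 0} \<subseteq> cball (p t) (2 * \<delta>)"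
        using Fn[of 0 0] by (auto simp: dist_norm norm_minus_commute)
      then have "supp (?\<phi> 0 0) \<subseteq> cball (p t) (2 * \<delta>)" unfolding supp_def by (rule closure_minimal) simp
      then show ?thesis using inball[OF t] by blast
    qed
    moreover have "compact (supp (?\<phi> 0 0))"
      using sub bounded_subset[OF bounded_ball] unfolding supp_def by (simp add: compact_eq_bounded_closed)
    ultimately have wk: "(LINT x|lborel. partial k (?\<phi> 0 0) x *\<^sub>R u x) = - (LINT x|lborel. ?\<phi> 0 0 x *\<^sub>R G x $ k)" for k
      using W deriv_family_Ck[OF famt] unfolding weak_gradient_def Cc_infinity_def by blast
    have GA: "AE x in lborel. x \<in> ball a r \<longrightarrow> norm (G x) \<le> C"
    proof -
      have "AE x in restrict_space lborel (ball a r). ennreal (norm (G x)) \<le> ennreal C"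
        using esssup_AE[of "\<lambda>x. ennreal (norm (G x))" "restrict_space lborel (ball a r)"] G
        unfolding Linf_norm_def by (auto elim!: eventually_mono)
      then show ?thesis using C by (subst (asm) AE_restrict_space_iff) auto
    qed
    have b: "norm (LINT x|lborel. ?\<phi> 0 0 x *\<^sub>R G x $ k) \<le> C * I" for k
    proof (cases "integrable lborel (\<lambda>x. ?\<phi> 0 0 x *\<^sub>R G x $ k)")
      case True
      have "norm (LINT x|lborel. ?\<phi> 0 0 x *\<^sub>R G x $ k) \<le> (LINT x|lborel. norm (?\<phi> 0 0 x *\<^sub>R G x $ k))"
        by (rule integral_norm_bound)
      also have "\<dots> \<le> (LINT x|lborel. C * w (x - p t))"
      proof (rule integral_mono_AE)
        show "integrable lborel (\<lambda>x. norm (?\<phi> 0 0 x *\<^sub>R G x $ k))" by (rule integrable_norm[OF True])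
        show "integrable lborel (\<lambda>x. C * w (x - p t))" using plane_integrable_shift(2)[OF wi] by simp
        show "AE x in lborel. norm (?\<phi> 0 0 x *\<^sub>R G x $ k) \<le> C * w (x - p t)"
          using GA
        proof eventually_elim
          case (elim x)
          show ?case
          proof (cases "?\<phi> 0 0 x = 0")
            case False
            then have "x \<in> ball a r" using sub closure_subset[of "{x. ?\<phi> 0 0 x \<noteq> 0}"] unfolding supp_def by blast
            then have "norm (G x $ k) \<le> C" using elim Finite_Cartesian_Product.norm_nth_le order_trans by blast
            then show ?thesis using w(2)[of "x - p t"]
              by (simp add: w_def mult.commute mult_right_mono)
          qed (simp add: w_def)
        qed
      qed
      also have "\<dots> = C * I" using Ip by simp
      finally show ?thesis .
    next
      case False
      then have "(LINT x|lborel. ?\<phi> 0 0 x *\<^sub>R G x $ k) = 0" by (rule not_integrable_integral_eq)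
      then show ?thesis using C I by simp
    qed
    have "K' t = - (v $ 1 *\<^sub>R integral (cbox (- L) L) (\<lambda>x. F 1 0 (x - p t) *\<^sub>R u x)
               + v $ 2 *\<^sub>R integral (cbox (- L) L) (\<lambda>x. F 0 1 (x - p t) *\<^sub>R u x))"
    proof -
      define f1 where "f1 = (\<lambda>x. F 1 0 (x - p t) *\<^sub>R u x)"
      define f2 where "f2 = (\<lambda>x. F 0 1 (x - p t) *\<^sub>R u x)"
      have fi: "f1 integrable_on cbox (- L) L" "f2 integrable_on cbox (- L) L"
        unfolding f1_def f2_def by (rule Fi(3)[OF t])+
      have "K' t = integral (cbox (- L) L) (\<lambda>x. - (v $ 1 *\<^sub>R f1 x + v $ 2 *\<^sub>R f2 x))"
        unfolding K'_def f1_def f2_def by (simp add: algebra_simps)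
      also have "\<dots> = - (integral (cbox (- L) L) (\<lambda>x. v $ 1 *\<^sub>R f1 x)
          + integral (cbox (- L) L) (\<lambda>x. v $ 2 *\<^sub>R f2 x))"
        unfolding Henstock_Kurzweil_Integration.integral_neg
        using fi by (subst Henstock_Kurzweil_Integration.integral_add) (auto intro!: integrable_cmul)
      also have "\<dots> = - (v $ 1 *\<^sub>R integral (cbox (- L) L) f1 + v $ 2 *\<^sub>R integral (cbox (- L) L) f2)"
        by (simp only: integral_cmul)
      finally show ?thesis unfolding f1_def f2_def .
    qed
    also have "\<dots> = v $ 1 *\<^sub>R (LINT x|lborel. ?\<phi> 0 0 x *\<^sub>R G x $ 1) + v $ 2 *\<^sub>R (LINT x|lborel. ?\<phi> 0 0 x *\<^sub>R G x $ 2)"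
      using wk[of 1] wk[of 2] Fi(2)[OF t]
      by (simp add: deriv_family_partial[OF famt])
    also have "norm \<dots> \<le> \<bar>v $ 1\<bar> * (C * I) + \<bar>v $ 2\<bar> * (C * I)"
      by (rule order_trans[OF norm_triangle_ineq]) (auto intro!: add_mono mult_left_mono b)
    also have "\<dots> \<le> norm v * (C * I) + norm v * (C * I)"
      using C I by (intro add_mono mult_right_mono component_le_norm_cart) auto
    finally show ?thesis by (simp add: algebra_simps)
  qed
  have "norm (K 1 - K 0) \<le> 2 * C * norm v * I * norm (1 - 0 :: real)"
  proof (rule differentiable_bound[of "{0..1::real}"])
    show "(K has_derivative (\<lambda>h. h *\<^sub>R K' t)) (at t within {0..1})" if "t \<in> {0..1}" for t
      using Kd[OF that] by (simp add: has_vector_derivative_def)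
    show "onorm (\<lambda>h. h *\<^sub>R K' t) \<le> 2 * C * norm v * I" if "t \<in> {0..1}" for t
      proof (rule onorm_le)
      fix h :: real
      have "norm (h *\<^sub>R K' t) = norm (K' t) * \<bar>h\<bar>" by simp
      also have "\<dots> \<le> (2 * C * norm v * I) * \<bar>h\<bar>" using K'b[OF that] by (rule mult_right_mono) simp
      finally show "norm (h *\<^sub>R K' t) \<le> 2 * C * norm v * I * norm h" by simp
    qed
  qed auto
  then have Kdiff: "norm (K 1 - K 0) \<le> 2 * C * norm v * I" by simp
  have near: "norm (K t - I *\<^sub>R u (p t)) \<le> e / 2 * I" if t: "t \<in> {0..1}" and dd: "2 * \<delta> < d (p t)" for t
  proof -
    have i1: "integrable lborel (\<lambda>x. w (x - p t))" by (rule plane_integrable_shift(2)[OF wi])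
    have i2: "integrable lborel (\<lambda>x. w (x - p t) *\<^sub>R u x)" using Fi(1)[OF t, of 0 0] by (simp add: w_def)
    have i3: "integrable lborel (\<lambda>x. w (x - p t) *\<^sub>R u (p t))" using i1 by simp
    have "K t - I *\<^sub>R u (p t) = (LINT x|lborel. w (x - p t) *\<^sub>R u x) - (LINT x|lborel. w (x - p t) *\<^sub>R u (p t))"
      unfolding K_def using Ip[of "p t"] i1 by simp
    also have "\<dots> = (LINT x|lborel. w (x - p t) *\<^sub>R u x - w (x - p t) *\<^sub>R u (p t))"
      by (rule Bochner_Integration.integral_diff[symmetric, OF i2 i3])
    also have "norm \<dots> \<le> (LINT x|lborel. norm (w (x - p t) *\<^sub>R u x - w (x - p t) *\<^sub>R u (p t)))"
      by (rule integral_norm_bound)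
    also have "\<dots> \<le> (LINT x|lborel. e / 2 * w (x - p t))"
    proof (rule integral_mono)
      show "integrable lborel (\<lambda>x. norm (w (x - p t) *\<^sub>R u x - w (x - p t) *\<^sub>R u (p t)))"
        using i2 i3 by auto
      show "norm (w (x - p t) *\<^sub>R u x - w (x - p t) *\<^sub>R u (p t)) \<le> e / 2 * w (x - p t)" for x
      proof (cases "w (x - p t) = 0")
        case False
        then have "norm (x - p t) < d (p t)" using Fn[of 0 0 "x - p t"] dd by (simp add: w_def)
        then have "norm (u x - u (p t)) \<le> e / 2" by (rule d(2))
        have "norm (w (x - p t) *\<^sub>R u x - w (x - p t) *\<^sub>R u (p t)) = norm (u x - u (p t)) * w (x - p t)"
          using w(2)[of "x - p t"] by (simp add: scaleR_diff_right[symmetric] del: scaleR_diff_right)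
        also have "\<dots> \<le> e / 2 * w (x - p t)"
          using \<open>norm (u x - u (p t)) \<le> e / 2\<close> w(2) by (rule mult_right_mono)
        finally show ?thesis .
      qed simp
    qed (use i1 in simp)
    also have "\<dots> = e / 2 * I" using Ip by simp
    finally show ?thesis .
  qed
  have "I *\<^sub>R (u y - u a) = (K 1 - K 0) - (K 1 - I *\<^sub>R u (p 1)) + (K 0 - I *\<^sub>R u (p 0))"
    by (simp add: p_def v_def algebra_simps)
  also have "norm \<dots> \<le> norm (K 1 - K 0) + norm (K 1 - I *\<^sub>R u (p 1)) + norm (K 0 - I *\<^sub>R u (p 0))"
    by (meson add_mono norm_triangle_ineq norm_triangle_ineq4 order_refl order_trans)
  also have "\<dots> \<le> 2 * C * norm v * I + e / 2 * I + e / 2 * I"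
    using near[of 1] near[of 0] \<delta> Kdiff by (intro add_mono) (auto simp: p_def v_def)
  finally have "norm (I *\<^sub>R (u y - u a)) \<le> I * (2 * C * norm v + e)" by (simp only: distrib_left mult_ac field_sum_of_halves)
  then have "I * norm (u y - u a) \<le> I * (2 * C * norm v + e)" unfolding norm_scaleR using I by simp
  then show "norm (u y - u a) \<le> 2 * C * norm (y - a) + e" using I by (simp add: v_def)
qed

section \<open>Deformations close to the identity\<close>

text \<open>The entries of the Jacobian matrix of \<open>\<sigma>\<close> are at most \<open>1 / 8\<close> in absolute value. Then \<open>\<sigma>\<close> is a contraction with constant \<open>1 / 2\<close>,
which makes \<open>x - \<sigma> x\<close> a bijection of the plane, and the determinant of \<open>Id - D\<close> lies between \<open>1 / 2\<close> and \<open>2\<close>.\<close>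

locale near_identity =
  fixes \<sigma> :: "plane \<Rightarrow> plane" and D :: "plane \<Rightarrow> plane \<Rightarrow> plane"
  assumes der: "\<And>x. (\<sigma> has_derivative D x) (at x)"
    and small: "\<And>x k l. \<bar>D x (axis l 1) $ k\<bar> \<le> 1 / 8"
    and fixes_0: "\<sigma> 0 = 0"
begin

definition warp :: "plane \<Rightarrow> plane" where "warp x = x - \<sigma> x"

lemma lipschitz: "norm (\<sigma> x - \<sigma> y) \<le> 1 / 2 * norm (x - y)"
proof (rule differentiable_bound[of UNIV])
  fix x :: plane
  show "(\<sigma> has_derivative D x) (at x within UNIV)" using der by simp
  show "onorm (D x) \<le> 1 / 2"
  proof (rule onorm_le)
    fix h :: plane
    have lin: "linear (D x)" using der has_derivative_linear by blast
    have "h = (h $ 1) *\<^sub>R axis 1 1 + (h $ 2) *\<^sub>R axis 2 1"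
      by (simp add: vec_eq_iff forall_2 axis_def)
    then have "D x h = (h $ 1) *\<^sub>R D x (axis 1 1) + (h $ 2) *\<^sub>R D x (axis 2 1)"
      by (metis linear_add[OF lin] linear_scale[OF lin])
    moreover have n: "norm (D x (axis l 1)) \<le> 1 / 4" for l
      using norm_le_l1_cart[of "D x (axis l 1)"] small[of x l 1] small[of x l 2] by (simp add: sum_2)
    ultimately have "norm (D x h) \<le> \<bar>h $ 1\<bar> * norm (D x (axis 1 1)) + \<bar>h $ 2\<bar> * norm (D x (axis 2 1))"
      using norm_triangle_ineq[of "(h $ 1) *\<^sub>R D x (axis 1 1)" "(h $ 2) *\<^sub>R D x (axis 2 1)"] by simp
    also have "\<dots> \<le> \<bar>h $ 1\<bar> * (1 / 4) + \<bar>h $ 2\<bar> * (1 / 4)"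
      by (intro add_mono mult_left_mono n) auto
    also have "\<dots> \<le> norm h * (1 / 4) + norm h * (1 / 4)"
      by (intro add_mono mult_right_mono component_le_norm_cart) auto
    finally show "norm (D x h) \<le> 1 / 2 * norm h" by simp
  qed
qed auto

lemma norm_warp: "norm x / 2 \<le> norm (warp x)"
  using lipschitz[of x 0] norm_triangle_ineq2[of x "\<sigma> x"] by (simp add: warp_def fixes_0)

lemma inj_warp: "inj warp"
proof (rule injI)
  fix x y assume "warp x = warp y"
  then have "x - y = \<sigma> x - \<sigma> y" by (simp add: warp_def algebra_simps)
  then have "norm (x - y) \<le> 1 / 2 * norm (x - y)" using lipschitz[of x y] by simp
  then show "x = y" by simp
qed

lemma surj_warp: "surj warp"
proof -
  have "\<exists>x. warp x = y" for y
  proof -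
    have "\<exists>!x. y + \<sigma> x = x"
      by (rule banach_fix_type[where c = "1 / 2"]) (use lipschitz in \<open>auto simp: dist_norm\<close>)
    then obtain x where "y + \<sigma> x = x" by blast
    then have "warp x = y" by (simp add: warp_def algebra_simps)
    then show ?thesis by blast
  qed
  then show ?thesis by (metis surjI)
qed

lemma continuous_warp: "continuous_on UNIV warp"
proof -
  have "continuous_on UNIV \<sigma>" 
    by (intro continuous_at_imp_continuous_on ballI has_derivative_continuous[OF der])
  then show ?thesis unfolding warp_def by (intro continuous_intros)
qed

lemma det_warp: "1 / 2 \<le> det (matrix (\<lambda>h. h - D x h))" "det (matrix (\<lambda>h. h - D x h)) \<le> 2"
proof -
  define p q r s where "p = D x (axis 1 1) $ 1" "q = D x (axis 2 1) $ 1"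
    "r = D x (axis 1 1) $ 2" "s = D x (axis 2 1) $ 2"
  have b: "\<bar>p\<bar> \<le> 1/8" "\<bar>q\<bar> \<le> 1/8" "\<bar>r\<bar> \<le> 1/8" "\<bar>s\<bar> \<le> 1/8"
    unfolding p_q_r_s_def using small by blast+
  have d: "det (matrix (\<lambda>h. h - D x h)) = (1 - p) * (1 - s) - q * r"
    by (simp add: det_2 matrix_def axis_def p_q_r_s_def[unfolded axis_def])
  have "\<bar>q * r\<bar> \<le> 1/8 * (1/8)" unfolding abs_mult using b by (intro mult_mono) auto
  moreover have "(7/8) * (7/8) \<le> (1 - p) * (1 - s)" using b by (intro mult_mono) auto
  moreover have "(1 - p) * (1 - s) \<le> (9/8) * (9/8)" using b by (intro mult_mono) auto
  ultimately show "1 / 2 \<le> det (matrix (\<lambda>h. h - D x h))" "det (matrix (\<lambda>h. h - D x h)) \<le> 2"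
    unfolding d by linarith+
qed

text \<open>The bounds on the determinant turn the change of variables formula into a comparison of the two integrals.\<close>

lemma integrable_warp:
  fixes h :: "plane \<Rightarrow> real"
  assumes h: "integrable lborel h" and nn: "\<And>x. 0 \<le> h x"
  shows "integrable lborel (\<lambda>x. h (warp x))"
    "(LINT x|lborel. h (warp x)) \<le> 2 * (LINT x|lborel. h x)"
    "(LINT x|lborel. h x) \<le> 2 * (LINT x|lborel. h (warp x))"
proof -
  define J where "J = (\<lambda>x. det (matrix (\<lambda>h. h - D x h)))"
  have J: "1 / 2 \<le> J x" "J x \<le> 2" for x using det_warp unfolding J_def by auto
  have warp [measurable]: "warp \<in> borel_measurable borel" using continuous_warp by (rule borel_measurable_continuous_onI)
  have hm [measurable]: "h \<in> borel_measurable borel" using h by auto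
  have hl: "integrable lebesgue h" using h hm by (simp add: integrable_completion)
  \<comment> \<open>The real function \<open>h\<close> becomes the first coordinate of a vector field, to which the change of variables
    for vector-valued functions applies.\<close>
  define v :: plane where "v = axis 1 1"
  have v: "v \<bullet> v = 1" by (simp add: v_def inner_axis_axis)
  have warp_der: "(warp has_derivative (\<lambda>h. h - D x h)) (at x within UNIV)" for x
    unfolding warp_def using der by (auto intro!: derivative_eq_intros)
  have fi: "(\<lambda>x. h x *\<^sub>R v) absolutely_integrable_on UNIV"
    using hl by (simp add: set_integrable_def)
  have cov: "(\<lambda>x. \<bar>J x\<bar> *\<^sub>R (h (warp x) *\<^sub>R v)) absolutely_integrable_on UNIV \<and>
        integral UNIV (\<lambda>x. \<bar>J x\<bar> *\<^sub>R (h (warp x) *\<^sub>R v)) = integral UNIV (\<lambda>x. h x *\<^sub>R v)"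
    unfolding J_def
    using has_absolute_integral_change_of_variables[where f = "\<lambda>x. h x *\<^sub>R v" and g = warp
        and b = "integral UNIV (\<lambda>x. h x *\<^sub>R v)", OF _ warp_der inj_warp] fi
    unfolding surj_warp by simp
  have Jv: "integrable lebesgue (\<lambda>x. J x *\<^sub>R (h (warp x) *\<^sub>R v))"
    using cov J by (simp add: set_integrable_def abs_of_nonneg order_trans[of 0 "1/2"])
  have hv: "integrable lebesgue (\<lambda>x. h x *\<^sub>R v)" using hl by simp
  have "integrable lebesgue (\<lambda>x. (J x *\<^sub>R (h (warp x) *\<^sub>R v)) \<bullet> v)" using Jv by (rule integrable_inner_left)
  then have Ji: "integrable lebesgue (\<lambda>x. J x * h (warp x))" using v by simp
  have "(LINT x|lebesgue. J x *\<^sub>R (h (warp x) *\<^sub>R v)) = (LINT x|lebesgue. h x *\<^sub>R v)"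
    using cov J integral_lebesgue[OF Jv] integral_lebesgue[OF hv]
    by (simp add: abs_of_nonneg order_trans[of 0 "1/2"])
  then have "(LINT x|lebesgue. J x *\<^sub>R (h (warp x) *\<^sub>R v)) \<bullet> v = (LINT x|lebesgue. h x *\<^sub>R v) \<bullet> v" by simp
  then have "(LINT x|lebesgue. (J x *\<^sub>R (h (warp x) *\<^sub>R v)) \<bullet> v) = (LINT x|lebesgue. (h x *\<^sub>R v) \<bullet> v)"
    using Jv hv by (simp only: integral_inner_left)
  then have "(LINT x|lebesgue. J x * h (warp x)) = (LINT x|lebesgue. h x)" using v by simp
  then have Jeq: "(LINT x|lebesgue. J x * h (warp x)) = (LINT x|lborel. h x)" by (simp add: integral_completion)
  have hg [measurable]: "(\<lambda>x. h (warp x)) \<in> borel_measurable borel" by measurable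
  then have hgl: "(\<lambda>x. h (warp x)) \<in> borel_measurable lebesgue" by (simp add: measurable_completion)
  have low: "h (warp x) \<le> 2 * (J x * h (warp x))" for x
    using mult_right_mono[OF J(1)[of x] nn[of "warp x"]] by simp
  have high: "J x * h (warp x) \<le> 2 * h (warp x)" for x
    by (rule mult_right_mono[OF J(2) nn])
  have hgi: "integrable lebesgue (\<lambda>x. h (warp x))"
    by (rule Bochner_Integration.integrable_bound[OF integrable_mult_right[OF Ji, of 2] hgl])
       (use low nn in \<open>auto intro: order_trans[OF low abs_ge_self]\<close>)
  then show "integrable lborel (\<lambda>x. h (warp x))" using hg by (simp add: integrable_completion)
  have e: "(LINT x|lborel. h (warp x)) = (LINT x|lebesgue. h (warp x))" by (simp add: integral_completion)
  have "(LINT x|lebesgue. h (warp x)) \<le> (LINT x|lebesgue. 2 * (J x * h (warp x)))"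
    by (rule integral_mono) (use hgi Ji low in auto)
  then show "(LINT x|lborel. h (warp x)) \<le> 2 * (LINT x|lborel. h x)" unfolding e Jeq[symmetric] by simp
  have "(LINT x|lebesgue. J x * h (warp x)) \<le> (LINT x|lebesgue. 2 * h (warp x))"
    by (rule integral_mono) (use hgi Ji high in auto)
  then show "(LINT x|lborel. h x) \<le> 2 * (LINT x|lborel. h (warp x))" unfolding e Jeq[symmetric] by simp
qed

end

section \<open>Energy\<close>

definition energy :: "(plane \<Rightarrow> complex) \<Rightarrow> real" where
  "energy F = (LINT x|lborel. (norm (F x))\<^sup>2)"

lemma energy_nonneg: "0 \<le> energy F"
  unfolding energy_def by (rule Bochner_Integration.integral_nonneg) simp

lemma tame_scale: "tame F \<Longrightarrow> tame (\<lambda>x. a * F x)"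
proof -
  assume F: "tame F"
  obtain B where B: "B \<ge> 0" "\<And>x. norm (F x) \<le> B" using tame_bound[OF F] by blast
  have "norm (a * F x) \<le> norm a * B" for x using B by (auto simp: norm_mult intro: mult_left_mono)
  then have "bounded (range (\<lambda>x. a * F x))" unfolding bounded_iff by blast
  then show ?thesis using tameD[OF F] unfolding tame_def by (auto intro!: continuous_intros)
qed

lemma tame_diff: "tame F \<Longrightarrow> tame G \<Longrightarrow> tame (\<lambda>x. F x - G x)"
  unfolding tame_def by (auto intro!: continuous_intros bounded_minus_comp)

lemma tame_norm: "tame F \<Longrightarrow> tame (\<lambda>x. complex_of_real (norm (F x)))"
  unfolding tame_def by (auto intro!: continuous_intros simp: bounded_iff)

lemma tame_shift: "tame F \<Longrightarrow> tame (\<lambda>x. F (x - a))"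
  unfolding tame_def bounded_iff
  by (auto intro!: continuous_intros plane_integrable_shift(2) continuous_on_compose2[of UNIV F])

lemma energy_norm: "energy (\<lambda>x. complex_of_real (norm (F x))) = energy F"
  unfolding energy_def by simp

lemma energy_scale: "energy (\<lambda>x. a * F x) = (norm a)\<^sup>2 * energy F"
  unfolding energy_def by (simp add: norm_mult power_mult_distrib)

text \<open>A weak triangle inequality for squared norms, from \<open>\<bar>F\<bar>\<^sup>2 \<le> 2 * \<bar>G - F\<bar>\<^sup>2 + 2 * \<bar>G\<bar>\<^sup>2\<close>. The factor
\<open>1 / 2\<close> is lost for the sake of working with energies only, without square roots.\<close>

lemma energy_diff_lower:
  assumes "tame F" "tame G"
  shows "energy F / 2 - energy G \<le> energy (\<lambda>x. G x - F x)"
proof -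
  have i: "integrable lborel (\<lambda>x. (norm (F x))\<^sup>2)" "integrable lborel (\<lambda>x. (norm (G x))\<^sup>2)"
    "integrable lborel (\<lambda>x. (norm (G x - F x))\<^sup>2)"
    using assms by (auto intro!: tame_square_integrable tame_diff)
  have p: "(norm (F x))\<^sup>2 / 2 - (norm (G x))\<^sup>2 \<le> (norm (G x - F x))\<^sup>2" for x
  proof -
    have "norm (F x) \<le> norm (G x) + norm (G x - F x)"
      using norm_triangle_ineq4[of "G x" "G x - F x"] by simp
    then have "(norm (F x))\<^sup>2 \<le> (norm (G x) + norm (G x - F x))\<^sup>2" by (rule power_mono) simp
    then show ?thesis using sum_squares_bound[of "norm (G x)" "norm (G x - F x)"]
      by (simp add: power2_sum)
  qed
  have "energy F / 2 - energy G = (LINT x|lborel. (norm (F x))\<^sup>2 / 2 - (norm (G x))\<^sup>2)"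
    unfolding energy_def using i by simp
  also have "\<dots> \<le> energy (\<lambda>x. G x - F x)"
    unfolding energy_def by (rule integral_mono) (use i p in auto)
  finally show ?thesis .
qed

lemma plancherel_energy: "tame F \<Longrightarrow> energy (fourier F) = energy F"
  unfolding energy_def by (rule plancherel(2))

text \<open>Plancherel's identity for \<open>F\<close> and for the convolution. In contrast to Young's inequality the bound is uniform over a
filter bank, whose \<open>L\<^sup>1\<close> norms may grow with the index.\<close>

lemma energy_conv_le:
  assumes F: "tame F" and k: "integrable lborel k" and b: "AE \<xi> in lborel. norm (fourier k \<xi>) \<le> 1"
  shows "energy (conv F k) \<le> energy F"
proof -
  have T: "tame (conv F k)" by (rule conv_tame[OF F k])
  have "energy (conv F k) = (LINT \<xi>|lborel. (norm (fourier (conv F k) \<xi>))\<^sup>2)"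
    using plancherel(2)[OF T] by (simp add: energy_def)
  also have "\<dots> \<le> (LINT \<xi>|lborel. (norm (fourier F \<xi>))\<^sup>2)"
  proof (rule integral_mono_AE[OF plancherel(1)[OF T] plancherel(1)[OF F]])
    show "AE \<xi> in lborel. (norm (fourier (conv F k) \<xi>))\<^sup>2 \<le> (norm (fourier F \<xi>))\<^sup>2"
      using b
    proof eventually_elim
      case (elim \<xi>)
      then show ?case unfolding fourier_conv[OF tameD(2)[OF F] k] norm_mult
        by (intro power_mono mult_left_le) auto
    qed
  qed
  also have "\<dots> = energy F" using plancherel(2)[OF F] by (simp add: energy_def)
  finally show ?thesis .
qed

lemma conv_diff_left:
  assumes F: "tame F" and G: "tame G" and k: "integrable lborel k"
  shows "conv (\<lambda>x. F x - G x) k x = conv F k x - conv G k x"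
proof -
  have "integrable lborel (\<lambda>y. H y * k (x - y))" if H: "tame H" for H
  proof -
    obtain B where B: "B \<ge> 0" "\<And>x. norm (H x) \<le> B" using tame_bound[OF H] by blast
    have [measurable]: "H \<in> borel_measurable borel" "k \<in> borel_measurable borel" using tameD[OF H] k by auto
    have "integrable lborel (\<lambda>y. B * norm (k (x - y)))" using plane_integrable_shift(1)[OF k] by simp
    then show ?thesis
      by (rule Bochner_Integration.integrable_bound) (use B in \<open>auto simp: norm_mult intro!: mult_right_mono\<close>)
  qed
  then show ?thesis unfolding conv_def using F G by (simp add: left_diff_distrib)
qed

section \<open>Band-limited bumps\<close>

text \<open>Positivity is needed on both sides: of \<open>\<Lambda>\<close>, to keep its moments against \<open>\<bar>m\<bar>\<^sup>2\<close> from cancelling, and of its Fourier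
transform, to test the modulus of a filter output. Both are written as \<open>z = of_real (norm z)\<close>.\<close>

definition bump :: "real \<Rightarrow> (plane \<Rightarrow> complex) \<Rightarrow> bool" where
  "bump s \<Lambda> \<longleftrightarrow> tame \<Lambda> \<and> integrable lborel (fourier \<Lambda>) \<and>
     (\<forall>\<eta>. \<Lambda> \<eta> = complex_of_real (norm (\<Lambda> \<eta>))) \<and>
     (\<forall>x. fourier \<Lambda> x = complex_of_real (norm (fourier \<Lambda> x))) \<and>
     (\<forall>\<eta>. \<Lambda> \<eta> \<noteq> 0 \<longrightarrow> norm \<eta> < s)"

lemma fourier_scale: "fourier (\<lambda>x. a * F x) \<xi> = a * fourier F \<xi>"
  unfolding fourier_def by (simp add: mult.left_commute)

lemma bump_scale:
  assumes "bump s \<Lambda>" "0 \<le> a" shows "bump s (\<lambda>\<eta>. complex_of_real a * \<Lambda> \<eta>)"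
proof -
  have f: "fourier (\<lambda>\<eta>. complex_of_real a * \<Lambda> \<eta>) = (\<lambda>x. complex_of_real a * fourier \<Lambda> x)"
    by (rule ext) (rule fourier_scale)
  have r: "complex_of_real a * z = complex_of_real (norm (complex_of_real a * z))"
    if "z = complex_of_real (norm z)" for z
  proof -
    have "complex_of_real (norm (complex_of_real a * z)) = complex_of_real a * complex_of_real (norm z)"
      using assms(2) by (simp add: norm_mult)
    then show ?thesis using that by simp
  qed
  show ?thesis unfolding bump_def f
    using assms(1) unfolding bump_def by (intro conjI allI r tame_scale) auto
qed

text \<open>Take the autocorrelation of a cone \<open>w\<close> of radius \<open>s / 2\<close>. Its Fourier transform is the squared modulus of
the transform of \<open>w\<close>, hence nonnegative, and integrable by Plancherel's identity.\<close>

lemma bump_exists: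
  assumes s: "0 < s"
  obtains \<Lambda> where "bump s \<Lambda>" "0 < energy \<Lambda>"
proof -
  define w where "w = (\<lambda>x::plane. max 0 (s / 2 - norm x))"
  have wc: "continuous_on UNIV w" unfolding w_def by (intro continuous_intros)
  have w0: "w x \<ge> 0" "w x \<le> s / 2" for x using s norm_ge_zero[of x] unfolding w_def by linarith+
  have wz: "w x = 0" if "s / 2 \<le> norm x" for x using that by (simp add: w_def)
  obtain L where L: "cball (0::plane) (s / 2) \<subseteq> cbox (- L) L"
    using bounded_subset_cbox_symmetric[OF bounded_cball] by blast
  have wi: "integrable lborel w"
    by (rule integral_continuous_supported(1)[OF wc, of "- L" L])
       (use L in \<open>auto simp: subset_iff intro!: wz\<close>, metis nle_le)
  have pos: "0 < (LINT x|lborel. w x)"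
    by (rule integral_continuous_pos[OF wc wi w0(1), of 0]) (use s in \<open>simp add: w_def\<close>)
  define W where "W = (\<lambda>x. complex_of_real (w x))"
  have W: "tame W" unfolding tame_def
    using wi wc w0 by (auto simp: W_def bounded_iff intro!: continuous_intros exI[of _ "s / 2"])
  define \<Lambda> where "\<Lambda> = conv W (\<lambda>x. cnj (W (- x)))"
  have RW: "tame (\<lambda>x. cnj (W (- x)))" by (rule tame_reflect[OF W])
  have T: "tame \<Lambda>" unfolding \<Lambda>_def by (rule conv_tame[OF W tameD(2)[OF RW]])
  have F: "fourier \<Lambda> \<xi> = complex_of_real ((norm (fourier W \<xi>))\<^sup>2)" for \<xi>
    unfolding \<Lambda>_def fourier_conv[OF tameD(2)[OF W] tameD(2)[OF RW]] fourier_reflect[OF tameD(3)[OF W]]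
    by (rule complex_norm_square[symmetric])
  have Fi: "integrable lborel (fourier \<Lambda>)"
    using plancherel(1)[OF W] by (simp add: F[abs_def] del: of_real_power)
  have Lr: "\<Lambda> \<eta> = complex_of_real (LINT y|lborel. w y * w (y - \<eta>))" for \<eta>
    unfolding \<Lambda>_def conv_def W_def by (simp flip: of_real_mult add: integral_complex_of_real)
  have Ln: "\<Lambda> \<eta> = complex_of_real (norm (\<Lambda> \<eta>))" for \<eta>
  proof -
    have "0 \<le> (LINT y|lborel. w y * w (y - \<eta>))"
      by (rule Bochner_Integration.integral_nonneg) (use w0 in simp)
    then show ?thesis unfolding Lr by simp
  qed
  have Ls: "norm \<eta> < s" if "\<Lambda> \<eta> \<noteq> 0" for \<eta>
  proof (rule ccontr)
    assume n: "\<not> norm \<eta> < s"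
    have "w y * w (y - \<eta>) = 0" for y
    proof (cases "s / 2 \<le> norm y")
      case False
      then have "s / 2 \<le> norm (y - \<eta>)" using n norm_triangle_ineq4[of y "y - \<eta>"] by simp
      then show ?thesis using wz by simp
    qed (use wz in simp)
    then show False using that unfolding Lr by (simp only:) simp
  qed
  have b: "bump s \<Lambda>" unfolding bump_def using T Fi Ln Ls F
    by (metis norm_of_real of_real_eq_iff abs_of_nonneg zero_le_power2)
  have "energy \<Lambda> \<noteq> 0"
  proof
    assume "energy \<Lambda> = 0"
    then have "AE \<eta> in lborel. \<Lambda> \<eta> = 0"
      unfolding energy_def using integral_nonneg_eq_0_iff_AE[OF tame_square_integrable[OF T]] by auto
    then have "fourier \<Lambda> 0 = 0" unfolding fourier_def by (intro integral_eq_zero_AE) auto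
    moreover have "fourier W 0 = complex_of_real (LINT x|lborel. w x)"
      unfolding fourier_def W_def by simp
    ultimately show False using pos by (simp add: F)
  qed
  then show ?thesis using that b energy_nonneg[of \<Lambda>] by (simp add: less_le)
qed

section \<open>Wave packets adapted to one filter\<close>

text \<open>The conjugate reflection of \<open>\<psi>0\<close> has the conjugate Fourier transform, so that filtering the packet with
\<open>\<psi>0\<close> itself leaves no phase, only the squared modulus of the multiplier.\<close>

definition packet :: "(plane \<Rightarrow> complex) \<Rightarrow> plane \<Rightarrow> (plane \<Rightarrow> complex) \<Rightarrow> plane \<Rightarrow> complex" where
  "packet \<Lambda> \<xi>0 \<psi>0 = conv (ifourier (\<lambda>\<eta>. \<Lambda> (\<eta> - \<xi>0))) (\<lambda>x. cnj (\<psi>0 (- x)))"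

text \<open>One filter \<open>\<psi>0\<close> and one frequency \<open>\<xi>0\<close>. Inside, \<open>m\<close> is the multiplier of the filter, \<open>\<Lambda>0\<close> the bump moved to \<open>\<xi>0\<close>,
and \<open>F\<close> the packet.\<close>

locale active_filter =
  fixes \<Lambda> :: "plane \<Rightarrow> complex" and s :: real and \<xi>0 :: plane and \<psi>0 :: "plane \<Rightarrow> complex"
  assumes bump: "bump s \<Lambda>" and \<psi>0: "integrable lborel \<psi>0"
begin

definition m where "m = fourier \<psi>0"
definition \<Lambda>0 where "\<Lambda>0 = (\<lambda>\<eta>. \<Lambda> (\<eta> - \<xi>0))"
definition F where "F = packet \<Lambda> \<xi>0 \<psi>0"

lemma bump_props: "tame \<Lambda>" "integrable lborel (fourier \<Lambda>)" "\<Lambda> \<eta> = complex_of_real (norm (\<Lambda> \<eta>))"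
  "fourier \<Lambda> x = complex_of_real (norm (fourier \<Lambda> x))" "\<Lambda> \<eta> \<noteq> 0 \<Longrightarrow> norm \<eta> < s"
  using bump unfolding bump_def by blast+

lemma shifted_bump: "tame \<Lambda>0" "\<Lambda>0 \<eta> = complex_of_real (norm (\<Lambda>0 \<eta>))" "\<Lambda>0 \<eta> \<noteq> 0 \<Longrightarrow> \<eta> \<in> ball \<xi>0 s"
  "energy \<Lambda>0 = energy \<Lambda>"
proof -
  show "tame \<Lambda>0" unfolding \<Lambda>0_def by (rule tame_shift[OF bump_props(1)])
  show "\<Lambda>0 \<eta> = complex_of_real (norm (\<Lambda>0 \<eta>))" unfolding \<Lambda>0_def by (rule bump_props(3))
  show "\<Lambda>0 \<eta> \<noteq> 0 \<Longrightarrow> \<eta> \<in> ball \<xi>0 s"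
    using bump_props(5)[of "\<eta> - \<xi>0"] by (simp add: \<Lambda>0_def dist_norm norm_minus_commute)
  show "energy \<Lambda>0 = energy \<Lambda>" unfolding energy_def \<Lambda>0_def
    using plane_integral_shift(2)[of "\<lambda>\<eta>. (norm (\<Lambda> \<eta>))\<^sup>2" \<xi>0] tame_square_integrable[OF bump_props(1)] by auto
qed

lemma fourier_\<Lambda>0: "fourier \<Lambda>0 x = cis (- 2 * pi * (\<xi>0 \<bullet> x)) * fourier \<Lambda> x"
  unfolding \<Lambda>0_def by (rule fourier_translate) (rule tameD(3)[OF bump_props(1)])

lemma fourier_\<Lambda>0_integrable: "integrable lborel (fourier \<Lambda>0)"
  unfolding fourier_\<Lambda>0[abs_def] using bump_props(2) by (rule integrable_cis_mult) simp

text \<open>The modulated kernel, with Fourier transform \<open>\<Lambda>0\<close>. Its modulus is the kernel of \<open>\<Lambda>\<close> itself, the same for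
every \<open>\<xi>0\<close>.\<close>

lemma modulated_kernel: "tame (ifourier \<Lambda>0)" "fourier (ifourier \<Lambda>0) \<eta> = \<Lambda>0 \<eta>"
  "norm (ifourier \<Lambda>0 x) = norm (fourier \<Lambda> (- x))"
proof -
  show "fourier (ifourier \<Lambda>0) \<eta> = \<Lambda>0 \<eta>"
    by (rule fourier_inversion(2)[OF shifted_bump(1) fourier_\<Lambda>0_integrable])
  show "norm (ifourier \<Lambda>0 x) = norm (fourier \<Lambda> (- x))"
    unfolding ifourier_def fourier_\<Lambda>0 by (simp add: norm_mult)
  show "tame (ifourier \<Lambda>0)"
    unfolding tame_def ifourier_def[abs_def]
  proof (intro conjI)
    show "continuous_on UNIV (\<lambda>x. fourier \<Lambda>0 (- x))"
      by (rule continuous_on_compose2[OF continuous_on_fourier[OF tameD(2)[OF shifted_bump(1)]]]) (auto intro!: continuous_intros)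
    show "bounded (range (\<lambda>x. fourier \<Lambda>0 (- x)))"
      unfolding bounded_iff using norm_fourier_le[OF tameD(2)[OF shifted_bump(1)]] by blast
    show "integrable lborel (\<lambda>x. fourier \<Lambda>0 (- x))" by (rule plane_integrable_shift(3)[OF fourier_\<Lambda>0_integrable])
  qed
qed

lemma m_continuous: "continuous_on UNIV m"
  unfolding m_def by (rule continuous_on_fourier[OF \<psi>0])

lemma \<psi>0_reflect: "integrable lborel (\<lambda>x. cnj (\<psi>0 (- x)))" "fourier (\<lambda>x. cnj (\<psi>0 (- x))) \<eta> = cnj (m \<eta>)"
proof -
  show "integrable lborel (\<lambda>x. cnj (\<psi>0 (- x)))"
    using plane_integrable_shift(3)[OF \<psi>0] by (rule integrable_cnj)
  show "fourier (\<lambda>x. cnj (\<psi>0 (- x))) \<eta> = cnj (m \<eta>)"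
    unfolding m_def by (rule fourier_reflect) (use \<psi>0 in auto)
qed

lemma F_tame: "tame F"
  unfolding F_def packet_def \<Lambda>0_def[symmetric] by (rule conv_tame[OF modulated_kernel(1) \<psi>0_reflect(1)])

lemma fourier_F: "fourier F \<eta> = \<Lambda>0 \<eta> * cnj (m \<eta>)"
  unfolding F_def packet_def \<Lambda>0_def[symmetric] fourier_conv[OF tameD(2)[OF modulated_kernel(1)] \<psi>0_reflect(1)]
  by (simp add: modulated_kernel(2) \<psi>0_reflect(2))

lemma \<Lambda>0_m_integrable: "integrable lborel (\<lambda>\<eta>. \<Lambda>0 \<eta> * cnj (m \<eta>))"
proof -
  have [measurable]: "m \<in> borel_measurable borel" "\<Lambda>0 \<in> borel_measurable borel"
    using m_continuous tameD(3)[OF shifted_bump(1)] by (auto intro: borel_measurable_continuous_onI)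
  have "(\<lambda>\<eta>. cnj (m \<eta>)) \<in> borel_measurable borel"
    by (intro borel_measurable_continuous_onI continuous_intros m_continuous)
  then have meas: "(\<lambda>\<eta>. \<Lambda>0 \<eta> * cnj (m \<eta>)) \<in> borel_measurable lborel" by simp
  have "integrable lborel (\<lambda>\<eta>. norm (\<Lambda>0 \<eta>) * (LINT x|lborel. norm (\<psi>0 x)))"
    using tameD(4)[OF shifted_bump(1)] by simp
  then show ?thesis
    by (rule Bochner_Integration.integrable_bound[OF _ meas])
       (use norm_fourier_le[OF \<psi>0] in \<open>auto simp: norm_mult m_def abs_mult intro!: mult_left_mono intro: order_trans[OF _ abs_ge_self]\<close>)
qed

lemma F_eq: "F = ifourier (\<lambda>\<eta>. \<Lambda>0 \<eta> * cnj (m \<eta>))"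
  unfolding F_def packet_def \<Lambda>0_def[symmetric]
  using conv_ifourier[OF tameD(2)[OF shifted_bump(1)] \<psi>0_reflect(1)] \<psi>0_reflect(2) by (simp add: fun_eq_iff)

lemma conv_F: "integrable lborel k \<Longrightarrow> conv F k x = ifourier (\<lambda>\<eta>. \<Lambda>0 \<eta> * cnj (m \<eta>) * fourier k \<eta>) x"
  unfolding F_eq by (rule conv_ifourier[OF \<Lambda>0_m_integrable])

lemma energy_F: "energy F = (LINT \<eta>|lborel. (norm (m \<eta>))\<^sup>2 * (norm (\<Lambda>0 \<eta>))\<^sup>2)"
  using plancherel_energy[OF F_tame] unfolding energy_def fourier_F
  by (simp add: norm_mult power_mult_distrib mult.commute)

lemma energy_F_ge:
  assumes c: "0 \<le> c" "\<And>\<eta>. \<eta> \<in> ball \<xi>0 s \<Longrightarrow> c \<le> norm (m \<eta>)"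
  shows "c\<^sup>2 * energy \<Lambda> \<le> energy F"
proof -
  have "c\<^sup>2 * energy \<Lambda> = (LINT \<eta>|lborel. c\<^sup>2 * (norm (\<Lambda>0 \<eta>))\<^sup>2)"
    unfolding shifted_bump(4)[symmetric] unfolding energy_def by simp
  also have "\<dots> \<le> (LINT \<eta>|lborel. (norm (fourier F \<eta>))\<^sup>2)"
  proof (rule integral_mono[OF _ plancherel(1)[OF F_tame]])
    show "integrable lborel (\<lambda>\<eta>. c\<^sup>2 * (norm (\<Lambda>0 \<eta>))\<^sup>2)" using tame_square_integrable[OF shifted_bump(1)] by simp
    show "c\<^sup>2 * (norm (\<Lambda>0 \<eta>))\<^sup>2 \<le> (norm (fourier F \<eta>))\<^sup>2" for \<eta>
      using c shifted_bump(3)[of \<eta>] by (cases "\<Lambda>0 \<eta> = 0")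
        (auto simp: fourier_F norm_mult power_mult_distrib mult.commute intro!: mult_left_mono power_mono)
  qed
  also have "\<dots> = energy F" using plancherel(2)[OF F_tame] by (simp add: energy_def)
  finally show ?thesis .
qed

lemma conv_F_\<psi>0: "tame (conv F \<psi>0)" "fourier (conv F \<psi>0) \<eta> = complex_of_real ((norm (m \<eta>))\<^sup>2) * \<Lambda>0 \<eta>"
proof -
  show "tame (conv F \<psi>0)" by (rule conv_tame[OF F_tame \<psi>0])
  have "m \<eta> * cnj (m \<eta>) = complex_of_real ((norm (m \<eta>))\<^sup>2)" by (rule complex_norm_square[symmetric])
  then show "fourier (conv F \<psi>0) \<eta> = complex_of_real ((norm (m \<eta>))\<^sup>2) * \<Lambda>0 \<eta>"
    unfolding fourier_conv[OF tameD(2)[OF F_tame] \<psi>0] fourier_F m_def by (simp add: mult_ac)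
qed

text \<open>Write \<open>u\<close> for the filtered packet and \<open>h\<close> for its modulus. The integral of \<open>h\<close> against the nonnegative
function \<open>fourier \<Lambda>\<close> is at least the modulus of the integral of \<open>u\<close> against \<open>fourier \<Lambda>0\<close>, because
\<open>fourier \<Lambda>\<close> is the modulus of \<open>fourier \<Lambda>0\<close>. The second integral is, on the frequency side, the integral of \<open>\<bar>m\<bar>\<^sup>2 * \<Lambda>0\<^sup>2\<close>,
which is at least \<open>c\<^sup>2 * energy \<Lambda>\<close>; the first one only involves frequencies of \<open>h\<close> that pass the low-pass filter
unchanged in modulus.\<close>

lemma low_pass_energy:
  assumes c: "0 < c" "\<And>\<eta>. \<eta> \<in> ball \<xi>0 s \<Longrightarrow> c \<le> norm (m \<eta>)"
    and chi: "integrable lborel chi" "AE \<eta> in lborel. \<eta> \<in> ball 0 s \<longrightarrow> norm (fourier chi \<eta>) = 1"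
  shows "c ^ 4 * energy \<Lambda> \<le> energy (conv (\<lambda>x. complex_of_real (norm (conv F \<psi>0 x))) chi)"
proof -
  define u where "u = conv F \<psi>0"
  define h where "h = (\<lambda>x. complex_of_real (norm (u x)))"
  define S where "S = conv h chi"
  have u: "tame u" unfolding u_def by (rule conv_F_\<psi>0(1))
  have h: "tame h" unfolding h_def by (rule tame_norm[OF u])
  have S: "tame S" unfolding S_def by (rule conv_tame[OF h chi(1)])
  have L2: "integrable lborel (\<lambda>\<eta>. (norm (\<Lambda>0 \<eta>))\<^sup>2)" "integrable lborel (\<lambda>\<eta>. (norm (\<Lambda> \<eta>))\<^sup>2)"
    using tame_square_integrable shifted_bump(1) bump_props(1) by auto
  have [measurable]: "m \<in> borel_measurable borel" "\<Lambda>0 \<in> borel_measurable borel" "\<Lambda> \<in> borel_measurable borel"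
      "fourier h \<in> borel_measurable borel" "u \<in> borel_measurable borel"
    using m_continuous tameD(3)[OF shifted_bump(1)] tameD(3)[OF bump_props(1)] tameD(3)[OF u] continuous_on_fourier[OF tameD(2)[OF h]]
    by (auto intro: borel_measurable_continuous_onI)
  have ub: "norm (fourier u \<eta>) \<le> (LINT x|lborel. norm (u x))" for \<eta> by (rule norm_fourier_le[OF tameD(2)[OF u]])
  have hb: "norm (fourier h \<eta>) \<le> (LINT x|lborel. norm (h x))" for \<eta> by (rule norm_fourier_le[OF tameD(2)[OF h]])
  have "c\<^sup>2 * energy \<Lambda> \<le> energy F" by (rule energy_F_ge) (use c in auto)
  also have "\<dots> = (LINT \<eta>|lborel. (norm (m \<eta>))\<^sup>2 * (norm (\<Lambda>0 \<eta>))\<^sup>2)" by (rule energy_F)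
  also have "\<dots> \<le> (LINT \<eta>|lborel. norm (fourier h \<eta>) * norm (\<Lambda> \<eta>))"
  proof -
    have "(norm (m \<eta>))\<^sup>2 * (norm (\<Lambda>0 \<eta>))\<^sup>2 = Re (fourier u \<eta> * \<Lambda>0 \<eta>)" for \<eta>
    proof -
      have "fourier u \<eta> * \<Lambda>0 \<eta> = complex_of_real ((norm (m \<eta>))\<^sup>2) * complex_of_real (norm (\<Lambda>0 \<eta>)) * complex_of_real (norm (\<Lambda>0 \<eta>))"
        unfolding u_def conv_F_\<psi>0(2) by (subst (1 2) shifted_bump(2)) simp
      then show ?thesis by (simp add: power2_eq_square flip: of_real_mult)
    qed
    moreover have fi: "integrable lborel (\<lambda>\<eta>. fourier u \<eta> * \<Lambda>0 \<eta>)"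
    proof (rule Bochner_Integration.integrable_bound[of _ "\<lambda>\<eta>. (LINT x|lborel. norm (u x)) * norm (\<Lambda>0 \<eta>)"])
      show "(\<lambda>\<eta>. fourier u \<eta> * \<Lambda>0 \<eta>) \<in> borel_measurable lborel"
        unfolding u_def conv_F_\<psi>0(2) by measurable
    qed (use tameD(4)[OF shifted_bump(1)] ub in \<open>auto simp: norm_mult abs_mult intro!: mult_right_mono intro: order_trans[OF _ abs_ge_self]\<close>)
    ultimately have "(LINT \<eta>|lborel. (norm (m \<eta>))\<^sup>2 * (norm (\<Lambda>0 \<eta>))\<^sup>2) = Re (LINT \<eta>|lborel. fourier u \<eta> * \<Lambda>0 \<eta>)"
      using integral_Re[OF fi] by simp
    also have "\<dots> = Re (LINT x|lborel. u x * fourier \<Lambda>0 x)"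
      using fourier_swap[OF tameD(2)[OF u] tameD(2)[OF shifted_bump(1)]] by simp
    also have "\<dots> \<le> norm (LINT x|lborel. u x * fourier \<Lambda>0 x)" by (rule complex_Re_le_cmod)
    also have "\<dots> \<le> (LINT x|lborel. norm (u x * fourier \<Lambda>0 x))" by (rule integral_norm_bound)
    also have "\<dots> = (LINT x|lborel. norm (u x) * norm (fourier \<Lambda> x))"
      unfolding fourier_\<Lambda>0 by (simp add: norm_mult)
    also have "\<dots> = norm (complex_of_real (LINT x|lborel. norm (u x) * norm (fourier \<Lambda> x)))"
      by (simp add: Bochner_Integration.integral_nonneg)
    also have "complex_of_real (LINT x|lborel. norm (u x) * norm (fourier \<Lambda> x)) = (LINT x|lborel. h x * fourier \<Lambda> x)"
      unfolding h_def by (subst bump_props(4)) (simp flip: of_real_mult add: integral_complex_of_real)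
    also have "\<dots> = (LINT \<eta>|lborel. fourier h \<eta> * \<Lambda> \<eta>)"
      by (rule fourier_swap[OF tameD(2)[OF h] tameD(2)[OF bump_props(1)], symmetric])
    also have "norm \<dots> \<le> (LINT \<eta>|lborel. norm (fourier h \<eta> * \<Lambda> \<eta>))" by (rule integral_norm_bound)
    finally show ?thesis by (simp add: norm_mult)
  qed
  \<comment> \<open>The inequality \<open>x * y \<le> x\<^sup>2 / (2 * c\<^sup>2) + c\<^sup>2 * y\<^sup>2 / 2\<close>, its weights chosen such that
    the second term absorbs half of the left-hand side \<open>c\<^sup>2 * energy \<Lambda>\<close>.\<close>
  also have "\<dots> \<le> (LINT \<eta>|lborel. 1 / (2 * c\<^sup>2) * (norm (fourier S \<eta>))\<^sup>2 + c\<^sup>2 / 2 * (norm (\<Lambda> \<eta>))\<^sup>2)"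
  proof (rule integral_mono_AE)
    show "integrable lborel (\<lambda>\<eta>. norm (fourier h \<eta>) * norm (\<Lambda> \<eta>))"
      by (rule Bochner_Integration.integrable_bound[of _ "\<lambda>\<eta>. (LINT x|lborel. norm (h x)) * norm (\<Lambda> \<eta>)"])
         (use tameD(4)[OF bump_props(1)] hb in \<open>auto simp: abs_mult intro!: mult_right_mono intro: order_trans[OF _ abs_ge_self]\<close>)
    show "integrable lborel (\<lambda>\<eta>. 1 / (2 * c\<^sup>2) * (norm (fourier S \<eta>))\<^sup>2 + c\<^sup>2 / 2 * (norm (\<Lambda> \<eta>))\<^sup>2)"
      by (intro Bochner_Integration.integrable_add integrable_mult_right plancherel(1)[OF S] L2(2))
    show "AE \<eta> in lborel. norm (fourier h \<eta>) * norm (\<Lambda> \<eta>)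
        \<le> 1 / (2 * c\<^sup>2) * (norm (fourier S \<eta>))\<^sup>2 + c\<^sup>2 / 2 * (norm (\<Lambda> \<eta>))\<^sup>2"
      using chi(2)
    proof eventually_elim
      case (elim \<eta>)
      show ?case
      proof (cases "\<Lambda> \<eta> = 0")
        case False
        then have "norm (fourier chi \<eta>) = 1" using elim bump_props(5) by (simp add: dist_norm)
        then have e: "norm (fourier S \<eta>) = norm (fourier h \<eta>)"
          unfolding S_def fourier_conv[OF tameD(2)[OF h] chi(1)] by (simp add: norm_mult)
        have "2 * (norm (fourier h \<eta>) / c) * (c * norm (\<Lambda> \<eta>)) \<le> (norm (fourier h \<eta>) / c)\<^sup>2 + (c * norm (\<Lambda> \<eta>))\<^sup>2"
          by (rule sum_squares_bound)
        then show ?thesis unfolding e using c(1) by (simp add: power_divide power_mult_distrib field_simps)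
      qed simp
    qed
  qed
  also have "\<dots> = 1 / (2 * c\<^sup>2) * energy S + c\<^sup>2 / 2 * energy \<Lambda>"
    using plancherel(1)[OF S] L2(2) plancherel(2)[OF S] by (simp add: energy_def)
  finally have "c\<^sup>2 * energy \<Lambda> / 2 \<le> energy S / (2 * c\<^sup>2)" by simp
  then have "c\<^sup>2 * (c\<^sup>2 * energy \<Lambda>) \<le> energy S" using c(1) by (simp add: field_simps)
  then show ?thesis unfolding S_def h_def u_def by (simp add: power2_eq_square power4_eq_xxxx mult_ac)
qed

text \<open>Replacing \<open>m\<close> by the constant \<open>m \<xi>0\<close> turns the packet into a multiple \<open>G\<close> of the modulated kernel, and by
Plancherel's identity the squared error is at most \<open>\<kappa>\<^sup>2 * energy \<Lambda>\<close>. So the mass of the packet on a set \<open>A\<close> is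
controlled by that of a kernel which does not depend on \<open>\<xi>0\<close> or the filter.\<close>

lemma tail_energy:
  assumes k: "0 \<le> \<kappa>" "\<And>\<eta>. \<eta> \<in> ball \<xi>0 s \<Longrightarrow> norm (m \<eta> - m \<xi>0) \<le> \<kappa>" and m1: "norm (m \<xi>0) \<le> 1"
    and A: "A \<in> sets borel"
  shows "(LINT x|lborel. indicator A x * (norm (F x))\<^sup>2)
    \<le> 2 * (LINT x|lborel. indicator A x * (norm (fourier \<Lambda> (- x)))\<^sup>2) + 2 * (\<kappa>\<^sup>2 * energy \<Lambda>)"
proof -
  define G where "G = (\<lambda>x. cnj (m \<xi>0) * ifourier \<Lambda>0 x)"
  define E where "E = (\<lambda>x. F x - G x)"
  have G: "tame G" unfolding G_def by (rule tame_scale[OF modulated_kernel(1)])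
  have E: "tame E" unfolding E_def by (rule tame_diff[OF F_tame G])
  have fE: "fourier E \<eta> = \<Lambda>0 \<eta> * cnj (m \<eta> - m \<xi>0)" for \<eta>
  proof -
    have "fourier E \<eta> = fourier F \<eta> - fourier G \<eta>"
      unfolding E_def fourier_def using tameD(2)[OF F_tame] tameD(2)[OF G]
      by (simp add: right_diff_distrib integrable_cis_mult)
    also have "fourier G \<eta> = cnj (m \<xi>0) * \<Lambda>0 \<eta>" unfolding G_def fourier_scale modulated_kernel(2) ..
    finally show ?thesis by (simp add: fourier_F algebra_simps)
  qed
  have "energy E = (LINT \<eta>|lborel. (norm (fourier E \<eta>))\<^sup>2)" using plancherel(2)[OF E] by (simp add: energy_def)
  also have "\<dots> \<le> (LINT \<eta>|lborel. \<kappa>\<^sup>2 * (norm (\<Lambda>0 \<eta>))\<^sup>2)"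
  proof (rule integral_mono[OF plancherel(1)[OF E]])
    show "integrable lborel (\<lambda>\<eta>. \<kappa>\<^sup>2 * (norm (\<Lambda>0 \<eta>))\<^sup>2)" using tame_square_integrable[OF shifted_bump(1)] by simp
    fix \<eta>
    show "(norm (fourier E \<eta>))\<^sup>2 \<le> \<kappa>\<^sup>2 * (norm (\<Lambda>0 \<eta>))\<^sup>2"
    proof (cases "\<Lambda>0 \<eta> = 0")
      case False
      then have "(norm (m \<eta> - m \<xi>0))\<^sup>2 \<le> \<kappa>\<^sup>2" using k shifted_bump(3) by (intro power_mono) auto
      then show ?thesis unfolding fE norm_mult power_mult_distrib complex_mod_cnj
        by (subst mult.commute) (rule mult_right_mono, auto)
    qed (simp add: fE)
  qed
  also have "\<dots> = \<kappa>\<^sup>2 * energy \<Lambda>" unfolding shifted_bump(4)[symmetric] unfolding energy_def by simp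
  finally have Ee: "energy E \<le> \<kappa>\<^sup>2 * energy \<Lambda>" .
  have ind: "integrable lborel (\<lambda>x. indicator A x * (norm (H x))\<^sup>2)" if "tame H" for H
    using integrable_real_mult_indicator[OF _ tame_square_integrable[OF that], of A] A by (simp add: mult.commute)
  have Gn: "(norm (G x))\<^sup>2 \<le> (norm (ifourier \<Lambda>0 x))\<^sup>2" for x
    unfolding G_def norm_mult complex_mod_cnj using m1 by (intro power_mono mult_left_le_one_le) auto
  have "(LINT x|lborel. indicator A x * (norm (F x))\<^sup>2)
      \<le> (LINT x|lborel. 2 * (indicator A x * (norm (ifourier \<Lambda>0 x))\<^sup>2) + 2 * (norm (E x))\<^sup>2)"
  proof (rule integral_mono[OF ind[OF F_tame]])
    show "integrable lborel (\<lambda>x. 2 * (indicator A x * (norm (ifourier \<Lambda>0 x))\<^sup>2) + 2 * (norm (E x))\<^sup>2)"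
      using ind[OF modulated_kernel(1)] tame_square_integrable[OF E] by simp
    fix x
    have "(norm (F x))\<^sup>2 \<le> (norm (G x) + norm (E x))\<^sup>2"
      using norm_triangle_ineq[of "G x" "E x"] by (intro power_mono) (auto simp: E_def)
    also have "\<dots> \<le> 2 * (norm (G x))\<^sup>2 + 2 * (norm (E x))\<^sup>2"
      using sum_squares_bound[of "norm (G x)" "norm (E x)"] by (simp add: power2_sum)
    also have "\<dots> \<le> 2 * (norm (ifourier \<Lambda>0 x))\<^sup>2 + 2 * (norm (E x))\<^sup>2" using Gn[of x] by simp
    finally show "indicator A x * (norm (F x))\<^sup>2
        \<le> 2 * (indicator A x * (norm (ifourier \<Lambda>0 x))\<^sup>2) + 2 * (norm (E x))\<^sup>2"
      by (auto simp: indicator_def)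
  qed
  also have "\<dots> = 2 * (LINT x|lborel. indicator A x * (norm (ifourier \<Lambda>0 x))\<^sup>2) + 2 * energy E"
    using ind[OF modulated_kernel(1)] tame_square_integrable[OF E] by (simp add: energy_def)
  finally show ?thesis using Ee by (simp add: modulated_kernel(3))
qed

text \<open>Composition with \<open>A\<close> moves the frequency \<open>\<eta>\<close> to \<open>A\<^sup>T \<eta>\<close>; a filter that vanishes on the moved disc annihilates the
deformed packet. This is read off from the Fourier integral that represents \<open>F\<close>.\<close>

lemma conv_linear_deform_zero:
  assumes k: "integrable lborel k" and z: "\<And>\<eta>. \<eta> \<in> ball \<xi>0 s \<Longrightarrow> fourier k (transpose A *v \<eta>) = 0"
  shows "conv (\<lambda>x. F (A *v x)) k x = 0"
proof -
  let ?v = "\<lambda>\<eta>. \<Lambda>0 \<eta> * cnj (m \<eta>)"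
  have [measurable]: "k \<in> borel_measurable borel" "?v \<in> borel_measurable borel" using k \<Lambda>0_m_integrable by auto
  have vm: "?v \<in> borel_measurable borel" by measurable
  let ?h = "\<lambda>(\<eta>, y). cis (2 * pi * (y \<bullet> (transpose A *v \<eta>))) * (?v \<eta> * k (x - y))"
  have Am [measurable]: "(\<lambda>\<eta>. transpose A *v \<eta>) \<in> borel_measurable borel"
    by (intro borel_measurable_continuous_onI matrix_vector_mult_linear_continuous_on)
  have hi: "integrable (lborel \<Otimes>\<^sub>M lborel) ?h"
  proof (rule lborel_pair.Fubini_integrable)
    show "?h \<in> borel_measurable (lborel \<Otimes>\<^sub>M lborel)"
      using vm by measurable
    have "(LINT y|lborel. norm (?h (\<eta>, y))) = norm (?v \<eta>) * (LINT y|lborel. norm (k (x - y)))" for \<eta>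
      by (simp add: norm_mult mult_ac)
    then show "integrable lborel (\<lambda>\<eta>. LINT y|lborel. norm (?h (\<eta>, y)))"
      using \<Lambda>0_m_integrable by (simp only:) (intro integrable_mult_left integrable_norm, simp)
    show "AE \<eta> in lborel. integrable lborel (\<lambda>y. ?h (\<eta>, y))"
      using plane_integrable_shift(1)[OF k, of x] by (auto intro!: integrable_cis_mult integrable_mult_right)
  qed
  have Fx: "F (A *v y) = (LINT \<eta>|lborel. cis (2 * pi * (y \<bullet> (transpose A *v \<eta>))) * ?v \<eta>)" for y
  proof -
    have "\<eta> \<bullet> (A *v y) = y \<bullet> (transpose A *v \<eta>)" for \<eta>
      using dot_lmul_matrix[of \<eta> A y] by (simp add: inner_commute)
    then show ?thesis unfolding F_eq ifourier_def fourier_def by simp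
  qed
  have "conv (\<lambda>x. F (A *v x)) k x = (LINT y|lborel. LINT \<eta>|lborel. cis (2 * pi * (y \<bullet> (transpose A *v \<eta>))) * (?v \<eta> * k (x - y)))"
    unfolding conv_def Fx by (simp add: mult.assoc[symmetric])
  also have "\<dots> = (LINT \<eta>|lborel. LINT y|lborel. cis (2 * pi * (y \<bullet> (transpose A *v \<eta>))) * (?v \<eta> * k (x - y)))"
    using lborel_pair.Fubini_integral[OF hi] by simp
  also have "\<dots> = (LINT \<eta>::plane|lborel. 0)"
  proof (rule Bochner_Integration.integral_cong[OF refl])
    fix \<eta>
    let ?\<zeta> = "transpose A *v \<eta>"
    show "(LINT y|lborel. cis (2 * pi * (y \<bullet> ?\<zeta>)) * (?v \<eta> * k (x - y))) = 0"
    proof (cases "\<Lambda>0 \<eta> = 0")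
      case False
      have "(LINT y|lborel. cis (2 * pi * (y \<bullet> ?\<zeta>)) * (?v \<eta> * k (x - y)))
         = (LINT y|lborel. (\<lambda>y. cis (2 * pi * ((x - y) \<bullet> ?\<zeta>)) * (?v \<eta> * k y)) (x - y))"
        by simp
      also have "\<dots> = (LINT y|lborel. cis (2 * pi * ((x - y) \<bullet> ?\<zeta>)) * (?v \<eta> * k y))"
        by (rule plane_integral_shift(1)) measurable
      also have "\<dots> = (LINT y|lborel. (cis (2 * pi * (x \<bullet> ?\<zeta>)) * ?v \<eta>) * (cis (- 2 * pi * (y \<bullet> ?\<zeta>)) * k y))"
      proof -
        have "cis (2 * pi * ((x - y) \<bullet> ?\<zeta>)) = cis (2 * pi * (x \<bullet> ?\<zeta>)) * cis (- 2 * pi * (y \<bullet> ?\<zeta>))" for y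
          by (simp add: cis_mult inner_diff_left right_diff_distrib)
        then show ?thesis by (simp only: mult_ac)
      qed
      also have "\<dots> = (cis (2 * pi * (x \<bullet> ?\<zeta>)) * ?v \<eta>) * fourier k ?\<zeta>"
        unfolding fourier_def by (rule integral_mult_right_zero)
      finally show ?thesis using z[OF shifted_bump(3)[OF False]] by simp
    qed simp
  qed
  finally show ?thesis by simp
qed

end

section \<open>Energy of deformed functions\<close>

context near_identity begin

lemma tame_warp: assumes F: "tame F" shows "tame (\<lambda>x. F (warp x))"
  unfolding tame_def
proof (intro conjI)
  show c: "continuous_on UNIV (\<lambda>x. F (warp x))"
    by (rule continuous_on_compose2[OF tameD(1)[OF F] continuous_warp]) auto
  show "bounded (range (\<lambda>x. F (warp x)))" using F unfolding tame_def bounded_iff by auto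
  have "integrable lborel (\<lambda>x. norm (F (warp x)))" by (rule integrable_warp(1)[OF tameD(4)[OF F]]) simp
  then show "integrable lborel (\<lambda>x. F (warp x))"
    by (subst (asm) integrable_norm_iff) (use c in \<open>auto intro: borel_measurable_continuous_onI\<close>)
qed

lemma energy_warp: "tame F \<Longrightarrow> energy F \<le> 2 * energy (\<lambda>x. F (warp x))"
  unfolding energy_def by (rule integrable_warp(3)[OF tame_square_integrable]) auto

end

text \<open>The two deformed functions differ only for \<open>R < \<bar>x\<bar>\<close>, and both maps send such \<open>x\<close> to points of norm at least
\<open>R / 2\<close>. The factor 8 consists of two terms, a factor 2 from squaring the sum of their moduli and a factor 2 from the change of
variables.\<close>

lemma energy_deform_difference:
  assumes "near_identity \<tau> D" "near_identity \<nu> E" and R: "0 < R"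
    and agree: "\<And>x. norm x \<le> R \<Longrightarrow> \<tau> x = \<nu> x" and F: "tame F"
  shows "energy (\<lambda>x. F (x - \<tau> x) - F (x - \<nu> x))
     \<le> 8 * (LINT x|lborel. indicator {x. R / 2 \<le> norm x} x * (norm (F x))\<^sup>2)"
proof -
  interpret T: near_identity \<tau> D by fact
  interpret N: near_identity \<nu> E by fact
  define h where "h = (\<lambda>x. indicator {x. R / 2 \<le> norm x} x * (norm (F x))\<^sup>2)"
  have S: "{x::plane. R / 2 \<le> norm x} \<in> sets borel"
    by (intro borel_closed closed_Collect_le continuous_intros)
  have h: "integrable lborel h" "\<And>x. 0 \<le> h x"
    using integrable_real_mult_indicator[OF _ tame_square_integrable[OF F], of "{x. R / 2 \<le> norm x}"] S
    by (auto simp: h_def mult.commute)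
  have "energy (\<lambda>x. F (x - \<tau> x) - F (x - \<nu> x)) \<le> (LINT x|lborel. 2 * h (T.warp x) + 2 * h (N.warp x))"
    unfolding energy_def
  proof (rule integral_mono)
    show "integrable lborel (\<lambda>x. (norm (F (x - \<tau> x) - F (x - \<nu> x)))\<^sup>2)"
      using tame_square_integrable[OF tame_diff[OF T.tame_warp[OF F] N.tame_warp[OF F]]] by (simp add: T.warp_def N.warp_def)
    show "integrable lborel (\<lambda>x. 2 * h (T.warp x) + 2 * h (N.warp x))"
      using T.integrable_warp(1)[OF h] N.integrable_warp(1)[OF h] by simp
    fix x
    show "(norm (F (x - \<tau> x) - F (x - \<nu> x)))\<^sup>2 \<le> 2 * h (T.warp x) + 2 * h (N.warp x)"
    proof (cases "norm x \<le> R")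
      case True then show ?thesis using agree h(2) by simp
    next
      case False
      then have "R / 2 \<le> norm (T.warp x)" "R / 2 \<le> norm (N.warp x)" using T.norm_warp[of x] N.norm_warp[of x] by linarith+
      then have e: "h (T.warp x) = (norm (F (T.warp x)))\<^sup>2" "h (N.warp x) = (norm (F (N.warp x)))\<^sup>2"
        by (auto simp: h_def)
      have "(norm (F (T.warp x) - F (N.warp x)))\<^sup>2 \<le> (norm (F (T.warp x)) + norm (F (N.warp x)))\<^sup>2"
        by (intro power_mono norm_triangle_ineq4) simp
      also have "\<dots> \<le> 2 * (norm (F (T.warp x)))\<^sup>2 + 2 * (norm (F (N.warp x)))\<^sup>2"
        using sum_squares_bound[of "norm (F (T.warp x))" "norm (F (N.warp x))"] by (simp add: power2_sum)
      finally show ?thesis unfolding e by (simp add: T.warp_def N.warp_def)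
    qed
  qed
  also have "\<dots> = 2 * (LINT x|lborel. h (T.warp x)) + 2 * (LINT x|lborel. h (N.warp x))"
    using T.integrable_warp(1)[OF h] N.integrable_warp(1)[OF h] by simp
  also have "\<dots> \<le> 2 * (2 * (LINT x|lborel. h x)) + 2 * (2 * (LINT x|lborel. h x))"
    using T.integrable_warp(2)[OF h] N.integrable_warp(2)[OF h] by linarith
  finally show ?thesis by (simp add: h_def)
qed

section \<open>Norms of families of functions\<close>

lemma esqrt_mono: "x \<le> y \<Longrightarrow> esqrt x \<le> esqrt y"
  unfolding esqrt_def
  by (auto simp: top_unique enn2real_mono less_top intro!: ennreal_leI)

lemma esqrt_ennreal: "0 \<le> r \<Longrightarrow> esqrt (ennreal r) = ennreal (sqrt r)"
  by (simp add: esqrt_def)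

lemma L2_norm_eq: assumes "tame F" shows "L2_norm F = ennreal (sqrt (energy F))"
proof -
  have "(\<integral>\<^sup>+ x. ennreal ((norm (F x))\<^sup>2) \<partial>lborel) = ennreal (energy F)"
    unfolding energy_def by (rule nn_integral_eq_integral[OF tame_square_integrable[OF assms]]) auto
  then show ?thesis unfolding L2_norm_def by (simp add: esqrt_ennreal energy_nonneg)
qed

lemma L2_norm_sq: "tame F \<Longrightarrow> (L2_norm F)\<^sup>2 = ennreal (energy F)"
  by (simp add: L2_norm_eq ennreal_power energy_nonneg)

lemma l2_L2_norm_ge:
  assumes p: "p \<in> P" and q: "tame (q p)"
  shows "ennreal (sqrt (energy (q p))) \<le> l2_L2_norm P q"
proof -
  have "(\<Sum>p\<in>{p}. (L2_norm (q p))\<^sup>2) \<le> (\<Sum>\<^sub>\<infinity>p\<in>P. (L2_norm (q p))\<^sup>2)"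
    by (subst infsum_finite[symmetric], simp, rule infsum_mono_neutral)
       (use p in \<open>auto intro: nonneg_summable_on_complete\<close>)
  then have "esqrt (ennreal (energy (q p))) \<le> l2_L2_norm P q"
    unfolding l2_L2_norm_def by (intro esqrt_mono) (simp add: L2_norm_sq[OF q])
  then show ?thesis by (simp add: esqrt_ennreal energy_nonneg)
qed

lemma l2_L2_norm_single:
  assumes p: "p \<in> P" and q: "tame (q p)" and z: "\<And>p'. p' \<in> P \<Longrightarrow> p' \<noteq> p \<Longrightarrow> q p' = (\<lambda>_. 0)"
  shows "l2_L2_norm P q = ennreal (sqrt (energy (q p)))"
proof -
  have "(\<Sum>\<^sub>\<infinity>p\<in>P. (L2_norm (q p))\<^sup>2) = (\<Sum>\<^sub>\<infinity>p\<in>{p}. (L2_norm (q p))\<^sup>2)"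
    by (rule infsum_cong_neutral) (use p z in \<open>auto simp: L2_norm_def esqrt_def\<close>)
  then show ?thesis unfolding l2_L2_norm_def by (simp add: L2_norm_sq[OF q] esqrt_ennreal energy_nonneg)
qed

lemma l2_L2_norm_zero: "(\<And>p. p \<in> P \<Longrightarrow> q p = (\<lambda>_. 0)) \<Longrightarrow> l2_L2_norm P q = 0"
proof -
  assume z: "\<And>p. p \<in> P \<Longrightarrow> q p = (\<lambda>_. 0)"
  have "(\<Sum>\<^sub>\<infinity>p\<in>P. (L2_norm (q p))\<^sup>2) = 0"
    by (rule infsum_0) (use z in \<open>auto simp: L2_norm_def esqrt_def\<close>)
  then show ?thesis by (simp add: l2_L2_norm_def esqrt_def)
qed

section \<open>Wave-packet filter banks\<close>

locale bank =
  fixes \<alpha> \<beta> \<epsilon> :: real and chi :: "plane \<Rightarrow> complex" and \<psi> :: "idx \<Rightarrow> plane \<Rightarrow> complex"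
  assumes \<alpha>: "\<alpha> \<le> 1" and \<epsilon>: "0 < \<epsilon>" "\<epsilon> < 1 / 32"
    and bank: "wave_packet_bank \<alpha> \<beta> \<epsilon> chi \<psi>"
begin

lemma chi_integrable: "integrable lborel chi" and filter_integrable: "i \<in> Istar \<alpha> \<beta> \<Longrightarrow> integrable lborel (\<psi> i)"
  using bank unfolding wave_packet_bank_def L1_def by blast+

lemma fourier_\<psi>_support:
  "i \<in> Istar \<alpha> \<beta> \<Longrightarrow> fourier (\<psi> i) \<eta> \<noteq> 0 \<Longrightarrow> \<eta> \<in> Qtile \<alpha> \<beta> \<epsilon> (Some i)"
  using bank closure_subset[of "{x. fourier (\<psi> i) x \<noteq> 0}"] unfolding wave_packet_bank_def supp_def by blast

lemma norm_rot: "norm (rot \<theta> *v y) = norm y"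
proof -
  have "(norm (rot \<theta> *v y))\<^sup>2 = (cos \<theta> * y $ 1 - sin \<theta> * y $ 2)\<^sup>2 + (sin \<theta> * y $ 1 + cos \<theta> * y $ 2)\<^sup>2"
    unfolding power2_norm_eq_inner
    by (simp add: inner_vec_def sum_2 rot_def matrix_vector_mult_def power2_eq_square)
  also have "\<dots> = ((sin \<theta>)\<^sup>2 + (cos \<theta>)\<^sup>2) * ((y $ 1)\<^sup>2 + (y $ 2)\<^sup>2)"
    by algebra
  also have "\<dots> = (norm y)\<^sup>2"
    unfolding power2_norm_eq_inner sin_cos_squared_add by (simp add: inner_vec_def sum_2 power2_eq_square)
  finally show ?thesis by simp
qed

text \<open>Before the rotation the first coordinate of a point of the tile is at least \<open>2 powr (j - 1) - \<epsilon> * 2 powr (\<alpha> * j)\<close>, hence at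
least \<open>(1 - 2 * \<epsilon>) * 2 powr (j - 1)\<close>. So no band-pass filter sees frequencies below \<open>15 / 16\<close>, and there the whole
unit mass of the bank is carried by the low-pass filter.\<close>

lemma Qtile_far:
  assumes i: "i \<in> Istar \<alpha> \<beta>" and \<eta>: "\<eta> \<in> Qtile \<alpha> \<beta> \<epsilon> (Some i)"
  shows "15 / 16 \<le> norm \<eta>"
proof -
  obtain j m l where jml: "i = (j, m, l)" by (cases i)
  have j: "1 \<le> j" using i by (simp add: jml Istar_def)
  obtain x where x: "- \<epsilon> < x $ 1" and e: "\<eta> = tile_map \<alpha> \<beta> (j, m, l) x"
    using \<eta> by (auto simp: Qtile_def jml)
  define y where "y = (vector [vector [2 powr (\<alpha> * real j), 0], vector [0, 2 powr (\<beta> * real j)]] :: real^2^2) *v x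
        + vector [2 powr (real j - 1) + real m * 2 powr (\<alpha> * real j), 0]"
  have "norm \<eta> = norm y" unfolding e tile_map_def y_def by (simp add: norm_rot)
  have y1: "y $ 1 = 2 powr (\<alpha> * real j) * x $ 1 + (2 powr (real j - 1) + real m * 2 powr (\<alpha> * real j))"
    by (simp add: y_def matrix_vector_mult_def sum_2)
  have a: "2 powr (\<alpha> * real j) \<le> 2 * 2 powr (real j - 1)"
  proof -
    have "2 powr (\<alpha> * real j) \<le> 2 powr (real j)" using \<alpha> by (intro powr_mono) (use mult_right_mono[of \<alpha> 1 "real j"] in auto)
    also have "2 powr (real j) = 2 * 2 powr (real j - 1)" by (simp add: powr_diff)
    finally show ?thesis .
  qed
  have b: "1 \<le> 2 powr (real j - 1)" using j by (intro ge_one_powr_ge_zero) auto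
  have "- (2 powr (\<alpha> * real j)) * \<epsilon> \<le> 2 powr (\<alpha> * real j) * x $ 1"
    using mult_left_mono[OF less_imp_le[OF x], of "2 powr (\<alpha> * real j)"] by simp
  moreover have "2 powr (\<alpha> * real j) * \<epsilon> \<le> (2 * 2 powr (real j - 1)) * (1 / 32)"
    using a \<epsilon> by (intro mult_mono) auto
  moreover have "0 \<le> real m * 2 powr (\<alpha> * real j)" by simp
  ultimately have "15 / 16 \<le> y $ 1" unfolding y1 using b by linarith
  then show ?thesis using component_le_norm_cart[of y 1] \<open>norm \<eta> = norm y\<close> by linarith
qed

lemma fourier_\<psi>_low: "i \<in> Istar \<alpha> \<beta> \<Longrightarrow> norm \<eta> < 15 / 16 \<Longrightarrow> fourier (\<psi> i) \<eta> = 0"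
  using fourier_\<psi>_support Qtile_far by fastforce

lemma partition:
  "AE \<xi> in lborel. ((\<lambda>i. (norm (fourier (\<psi> i) \<xi>))\<^sup>2) has_sum (1 - (norm (fourier chi \<xi>))\<^sup>2)) (Istar \<alpha> \<beta>)"
  using bank unfolding wave_packet_bank_def by blast

lemma chi_le_1: "AE \<xi> in lborel. norm (fourier chi \<xi>) \<le> 1"
  using partition
proof eventually_elim
  case (elim \<xi>)
  from has_sum_nonneg[OF elim] have "(norm (fourier chi \<xi>))\<^sup>2 \<le> 1" by simp
  then show ?case by (simp add: power2_le_iff_abs_le[of 1, simplified])
qed

lemma chi_low: "AE \<xi> in lborel. norm \<xi> < 15 / 16 \<longrightarrow> norm (fourier chi \<xi>) = 1"
  using partition
proof eventually_elim
  case (elim \<xi>)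
  show ?case
  proof
    assume "norm \<xi> < 15 / 16"
    then have "((\<lambda>i. (norm (fourier (\<psi> i) \<xi>))\<^sup>2) has_sum 0) (Istar \<alpha> \<beta>)"
      by (intro has_sum_0) (simp add: fourier_\<psi>_low)
    then have "(norm (fourier chi \<xi>))\<^sup>2 = 1" using has_sum_unique[OF elim] by fastforce
    then show "norm (fourier chi \<xi>) = 1" by (simp add: power2_eq_1_iff) (metis norm_ge_zero le_minus_one_simps(3))
  qed
qed

text \<open>In particular, at almost every point where one filter has modulus 1 the other one vanishes.\<close>

lemma \<psi>_pair:
  assumes "i \<in> Istar \<alpha> \<beta>" "k \<in> Istar \<alpha> \<beta>" "i \<noteq> k"
  shows "AE \<xi> in lborel. (norm (fourier (\<psi> i) \<xi>))\<^sup>2 + (norm (fourier (\<psi> k) \<xi>))\<^sup>2 \<le> 1"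
  using partition
proof eventually_elim
  case (elim \<xi>)
  have "(\<Sum>i\<in>{i, k}. (norm (fourier (\<psi> i) \<xi>))\<^sup>2) \<le> 1 - (norm (fourier chi \<xi>))\<^sup>2"
    by (rule finite_sum_le_has_sum[OF elim]) (use assms in auto)
  then have "(norm (fourier (\<psi> i) \<xi>))\<^sup>2 + (norm (fourier (\<psi> k) \<xi>))\<^sup>2 \<le> 1 - (norm (fourier chi \<xi>))\<^sup>2"
    using assms(3) by simp
  then show ?case using zero_le_power2[of "norm (fourier chi \<xi>)"] by linarith
qed

lemma \<psi>_le_1:
  assumes "i \<in> Istar \<alpha> \<beta>"
  shows "AE \<xi> in lborel. norm (fourier (\<psi> i) \<xi>) \<le> 1" "norm (fourier (\<psi> i) \<xi>) \<le> 1"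
proof -
  show ae: "AE \<xi> in lborel. norm (fourier (\<psi> i) \<xi>) \<le> 1"
    using partition
  proof eventually_elim
    case (elim \<xi>)
    have "(\<Sum>i\<in>{i}. (norm (fourier (\<psi> i) \<xi>))\<^sup>2) \<le> 1 - (norm (fourier chi \<xi>))\<^sup>2"
      by (rule finite_sum_le_has_sum[OF elim]) (use assms in auto)
    then have "(norm (fourier (\<psi> i) \<xi>))\<^sup>2 \<le> 1 - (norm (fourier chi \<xi>))\<^sup>2" by simp
    then have "(norm (fourier (\<psi> i) \<xi>))\<^sup>2 \<le> 1\<^sup>2"
      using zero_le_power2[of "norm (fourier chi \<xi>)"] unfolding one_power2 by linarith
    then show ?case by (rule power2_le_imp_le) simp
  qed
  have "open {\<xi>. 1 < norm (fourier (\<psi> i) \<xi>)}"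
    by (intro open_Collect_less continuous_intros continuous_on_fourier filter_integrable[OF assms])
  then have "{\<xi>. 1 < norm (fourier (\<psi> i) \<xi>)} = {}"
    using ae by (intro open_AE_empty) (auto elim!: eventually_mono)
  then show "norm (fourier (\<psi> i) \<xi>) \<le> 1" by (auto simp: not_less)
qed

text \<open>The argument at a fixed scale. With \<open>u\<close> and \<open>u'\<close> the responses of the active filter to the packet and to the
deformed packet, the energy of \<open>u'\<close> is at most that of the difference \<open>d\<close> between the cut-off and
the linear deformation, since the latter is annihilated. This is at most \<open>c ^ 4 / 8\<close>, while the
undeformed response keeps energy \<open>c ^ 4\<close>, even after modulus and low-pass filter, as \<open>\<Lambda>\<close> has energy
at least 1: the packet has energy 1, and the multiplier only decreased it.\<close>

lemma deformed_packet_lower_bounds: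
  assumes i: "i \<in> Istar \<alpha> \<beta>" and bump: "bump s \<Lambda>" and s: "s \<le> 15 / 16"
    and c: "0 < c" "\<And>\<eta>. \<eta> \<in> ball \<xi>0 s \<Longrightarrow> c \<le> norm (fourier (\<psi> i) \<eta>)"
    and kill: "\<And>\<eta>. \<eta> \<in> ball \<xi>0 s \<Longrightarrow> fourier (\<psi> i) ((mat 1 - M) *v \<eta>) = 0"
    and k: "0 \<le> \<kappa>" "\<And>\<eta>. \<eta> \<in> ball \<xi>0 s \<Longrightarrow> norm (fourier (\<psi> i) \<eta> - fourier (\<psi> i) \<xi>0) \<le> \<kappa>"
    and unit: "energy (packet \<Lambda> \<xi>0 (\<psi> i)) = 1"
    and tail: "2 * (LINT x|lborel. indicator {x. R / 2 \<le> norm x} x * (norm (fourier \<Lambda> (- x)))\<^sup>2)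
        + 2 * (\<kappa>\<^sup>2 * energy \<Lambda>) \<le> c ^ 4 / 64"
    and near: "near_identity \<tau> D" "near_identity (\<lambda>x. transpose M *v x) E"
    and R: "0 < R" "\<And>x. norm x \<le> R \<Longrightarrow> \<tau> x = transpose M *v x"
  defines "F \<equiv> packet \<Lambda> \<xi>0 (\<psi> i)"
  shows "ennreal (sqrt (c ^ 4 / 8)) \<le> l2_L2_norm (Istar \<alpha> \<beta>) (\<lambda>i x. S1 chi \<psi> (deform \<tau> F) i x - S1 chi \<psi> F i x)"
    and "ennreal (sqrt (c ^ 4 / 8)) \<le> l2_L2_norm (Ifull \<alpha> \<beta>) (W_commutator chi \<psi> \<tau> F)"
proof -
  interpret A: active_filter \<Lambda> s \<xi>0 "\<psi> i" by unfold_locales (use bump filter_integrable[OF i] in auto)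
  interpret T: near_identity \<tau> D by fact
  interpret N: near_identity "\<lambda>x. transpose M *v x" E by fact
  note \<psi>i = filter_integrable[OF i] and le1 = \<psi>_le_1[OF i]
  have F: "tame F" unfolding F_def A.F_def[symmetric] by (rule A.F_tame)
  have DF: "deform \<tau> F = (\<lambda>x. F (T.warp x))" by (simp add: fun_eq_iff deform_def T.warp_def)
  have DFt: "tame (deform \<tau> F)" unfolding DF by (rule T.tame_warp[OF F])
  define d where "d = (\<lambda>x. F (x - \<tau> x) - F (x - transpose M *v x))"
  have NFt: "tame (\<lambda>x. F (x - transpose M *v x))" using N.tame_warp[OF F] unfolding N.warp_def .
  have dt: "tame d" unfolding d_def using tame_diff[OF DFt NFt] by (simp add: deform_def)
  define u where "u = conv F (\<psi> i)"
  define u' where "u' = conv (deform \<tau> F) (\<psi> i)"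
  have ut: "tame u" "tame u'" unfolding u_def u'_def by (intro conv_tame \<psi>i F DFt)+
  have "u' = conv d (\<psi> i)"
  proof
    fix x
    have tr: "transpose (mat 1 - transpose M) = mat 1 - M"
      by (simp add: vec_eq_iff transpose_def mat_def)
    have "conv (\<lambda>x. F ((mat 1 - transpose M) *v x)) (\<psi> i) x = 0"
      unfolding F_def A.F_def[symmetric]
      by (rule A.conv_linear_deform_zero[OF \<psi>i]) (simp only: tr kill)
    then have "conv (\<lambda>x. F (x - transpose M *v x)) (\<psi> i) x = 0"
      by (simp add: matrix_vector_mult_diff_rdistrib)
    then show "u' x = conv d (\<psi> i) x"
      using conv_diff_left[OF DFt NFt \<psi>i, of x] by (simp add: d_def u'_def deform_def)
  qed
  then have "energy u' \<le> energy d" using energy_conv_le[OF dt \<psi>i le1(1)] by simp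
  also have "\<dots> \<le> 8 * (LINT x|lborel. indicator {x. R / 2 \<le> norm x} x * (norm (F x))\<^sup>2)"
    unfolding d_def by (rule energy_deform_difference[OF near R F])
  also have "(LINT x|lborel. indicator {x. R / 2 \<le> norm x} x * (norm (F x))\<^sup>2) \<le> c ^ 4 / 64"
  proof -
    have "{x::plane. R / 2 \<le> norm x} \<in> sets borel"
      by (intro borel_closed closed_Collect_le continuous_intros)
    from A.tail_energy[unfolded A.m_def, OF k le1(2) this] tail
    show ?thesis unfolding F_def A.F_def by linarith
  qed
  finally have u'e: "energy u' \<le> c ^ 4 / 8" by simp
  have N1: "1 \<le> energy \<Lambda>"
  proof -
    have "energy F = (LINT \<eta>|lborel. (norm (fourier F \<eta>))\<^sup>2)" using plancherel(2)[OF F] by (simp add: energy_def)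
    also have "\<dots> \<le> (LINT \<eta>|lborel. (norm (A.\<Lambda>0 \<eta>))\<^sup>2)"
    proof (rule integral_mono[OF plancherel(1)[OF F] tame_square_integrable[OF A.shifted_bump(1)]])
      fix \<eta>
      have "norm (fourier F \<eta>) \<le> norm (A.\<Lambda>0 \<eta>)"
        unfolding F_def A.F_def[symmetric] A.fourier_F norm_mult complex_mod_cnj A.m_def
        by (rule mult_left_le[OF le1(2)]) simp
      then show "(norm (fourier F \<eta>))\<^sup>2 \<le> (norm (A.\<Lambda>0 \<eta>))\<^sup>2" by (rule power_mono) simp
    qed
    also have "\<dots> = energy \<Lambda>" using A.shifted_bump(4) by (simp add: energy_def)
    finally show ?thesis using unit by (simp add: F_def)
  qed
  have hf: "tame (U1 \<psi> i F)" "tame (U1 \<psi> i (deform \<tau> F))"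
    using tame_norm[OF ut(1)] tame_norm[OF ut(2)] by (simp_all add: U1_def[abs_def] u_def u'_def)
  have St: "tame (S1 chi \<psi> F i)" "tame (S1 chi \<psi> (deform \<tau> F) i)"
    unfolding S1_def by (intro conv_tame hf chi_integrable)+
  have "c ^ 4 * 1 \<le> c ^ 4 * energy \<Lambda>" using N1 c(1) by (intro mult_left_mono) auto
  also have "\<dots> \<le> energy (S1 chi \<psi> F i)"
    unfolding S1_def U1_def[abs_def] F_def A.F_def[symmetric]
  proof (rule A.low_pass_energy[OF c(1) _ chi_integrable])
    show "\<eta> \<in> ball \<xi>0 s \<Longrightarrow> c \<le> norm (A.m \<eta>)" for \<eta> unfolding A.m_def by (rule c(2))
    show "AE \<eta> in lborel. \<eta> \<in> ball 0 s \<longrightarrow> norm (fourier chi \<eta>) = 1"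
      using chi_low by (rule eventually_mono) (use s in auto)
  qed
  finally have Se: "c ^ 4 \<le> energy (S1 chi \<psi> F i)" by simp
  have "energy (S1 chi \<psi> (deform \<tau> F) i) \<le> energy (U1 \<psi> i (deform \<tau> F))"
    unfolding S1_def by (rule energy_conv_le[OF hf(2) chi_integrable chi_le_1])
  also have "\<dots> = energy u'" unfolding U1_def[abs_def] u'_def by (rule energy_norm)
  finally have "energy (S1 chi \<psi> (deform \<tau> F) i) \<le> energy u'" .
  moreover have c4: "0 \<le> c ^ 4" using c(1) by simp
  ultimately have "c ^ 4 / 8 \<le> energy (S1 chi \<psi> F i) / 2 - energy (S1 chi \<psi> (deform \<tau> F) i)"
    using Se u'e c4 by linarith
  also have "\<dots> \<le> energy (\<lambda>x. S1 chi \<psi> (deform \<tau> F) i x - S1 chi \<psi> F i x)"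
    by (rule energy_diff_lower[OF St])
  finally have "ennreal (sqrt (c ^ 4 / 8)) \<le> ennreal (sqrt (energy (\<lambda>x. S1 chi \<psi> (deform \<tau> F) i x - S1 chi \<psi> F i x)))"
    by (intro ennreal_leI real_sqrt_le_mono)
  also have "\<dots> \<le> l2_L2_norm (Istar \<alpha> \<beta>) (\<lambda>i x. S1 chi \<psi> (deform \<tau> F) i x - S1 chi \<psi> F i x)"
    by (rule l2_L2_norm_ge[OF i]) (rule tame_diff[OF St(2,1)])
  finally show "ennreal (sqrt (c ^ 4 / 8)) \<le> l2_L2_norm (Istar \<alpha> \<beta>) (\<lambda>i x. S1 chi \<psi> (deform \<tau> F) i x - S1 chi \<psi> F i x)" .
  have "energy (S1 chi \<psi> F i) \<le> energy (U1 \<psi> i F)"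
    unfolding S1_def by (rule energy_conv_le[OF hf(1) chi_integrable chi_le_1])
  also have "\<dots> = energy u" unfolding U1_def[abs_def] u_def by (rule energy_norm)
  also have "\<dots> \<le> 2 * energy (\<lambda>x. u (T.warp x))" by (rule T.energy_warp[OF ut(1)])
  finally have "c ^ 4 / 8 \<le> energy (\<lambda>x. u (T.warp x)) / 2 - energy u'" using Se u'e c4 by linarith
  also have "\<dots> \<le> energy (\<lambda>x. u' x - u (T.warp x))" by (rule energy_diff_lower[OF T.tame_warp[OF ut(1)] ut(2)])
  also have "(\<lambda>x. u' x - u (T.warp x)) = W_commutator chi \<psi> \<tau> F (Some i)"
    by (simp add: fun_eq_iff W_commutator_def W_map_def u_def u'_def deform_def T.warp_def)
  finally have "ennreal (sqrt (c ^ 4 / 8)) \<le> ennreal (sqrt (energy (W_commutator chi \<psi> \<tau> F (Some i))))"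
    by (intro ennreal_leI real_sqrt_le_mono)
  also have "\<dots> \<le> l2_L2_norm (Ifull \<alpha> \<beta>) (W_commutator chi \<psi> \<tau> F)"
  proof (rule l2_L2_norm_ge)
    show "Some i \<in> Ifull \<alpha> \<beta>" using i by (simp add: Ifull_def)
    have "W_commutator chi \<psi> \<tau> F (Some i) = (\<lambda>x. u' x - u (T.warp x))"
      by (simp add: fun_eq_iff W_commutator_def W_map_def u_def u'_def deform_def T.warp_def)
    then show "tame (W_commutator chi \<psi> \<tau> F (Some i))" using tame_diff[OF ut(2) T.tame_warp[OF ut(1)]] by simp
  qed
  finally show "ennreal (sqrt (c ^ 4 / 8)) \<le> l2_L2_norm (Ifull \<alpha> \<beta>) (W_commutator chi \<psi> \<tau> F)" .
qed

lemma conv_zero_left: "conv (\<lambda>_. 0) k = (\<lambda>_. 0)"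
  by (simp add: fun_eq_iff conv_def)

lemma U_path_zero: "U_path \<psi> p (\<lambda>_. 0) = (\<lambda>_. 0)"
  by (induction p) (auto simp: U1_def[abs_def] conv_zero_left)

text \<open>If the active filter has modulus 1 on its core, all other filters vanish almost everywhere there, and the response of the active one is the
modulated kernel. Its modulus is the kernel of \<open>\<Lambda>\<close>, which has only low frequencies, so the second layer
vanishes. Only the packet itself and one first-layer output remain, each of norm at most 1.\<close>

lemma mixed_norm_le:
  assumes i: "i \<in> Istar \<alpha> \<beta>" and bump: "bump s \<Lambda>" and s: "s \<le> 15 / 16"
    and c: "\<And>\<eta>. \<eta> \<in> ball \<xi>0 s \<Longrightarrow> 1 \<le> norm (fourier (\<psi> i) \<eta>)"
    and unit: "energy (packet \<Lambda> \<xi>0 (\<psi> i)) = 1"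
  defines "F \<equiv> packet \<Lambda> \<xi>0 (\<psi> i)"
  shows "(\<Sum>n. l2_L2_norm (paths \<alpha> \<beta> n) (\<lambda>p. U_path \<psi> p F)) \<le> 2"
proof -
  interpret A: active_filter \<Lambda> s \<xi>0 "\<psi> i" by unfold_locales (use bump filter_integrable[OF i] in auto)
  note \<psi>i = filter_integrable[OF i] and le1 = \<psi>_le_1[OF i]
  have F: "tame F" and FA: "F = A.F" unfolding F_def A.F_def[symmetric] using A.F_tame by auto
  have m1: "norm (A.m \<eta>) = 1" if "A.\<Lambda>0 \<eta> \<noteq> 0" for \<eta>
    using c[OF A.shifted_bump(3)[OF that]] le1(2)[of \<eta>] unfolding A.m_def by (rule antisym[rotated])
  have other: "U1 \<psi> k F = (\<lambda>_. 0)" if k: "k \<in> Istar \<alpha> \<beta>" "k \<noteq> i" for k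
  proof -
    have "conv F (\<psi> k) x = 0" for x
    proof -
      have "AE \<eta> in lborel. A.\<Lambda>0 \<eta> * cnj (A.m \<eta>) * fourier (\<psi> k) \<eta> = 0"
      proof (rule eventually_mono[OF \<psi>_pair[OF i k(1) k(2)[symmetric]]])
        fix \<eta> assume p: "(norm (fourier (\<psi> i) \<eta>))\<^sup>2 + (norm (fourier (\<psi> k) \<eta>))\<^sup>2 \<le> 1"
        show "A.\<Lambda>0 \<eta> * cnj (A.m \<eta>) * fourier (\<psi> k) \<eta> = 0"
        proof (cases "A.\<Lambda>0 \<eta> = 0")
          case False
          from p m1[OF False] show ?thesis unfolding A.m_def by simp
        qed simp
      qed
      then show ?thesis unfolding FA A.conv_F[OF filter_integrable[OF k(1)]] ifourier_def fourier_def
        by (intro integral_eq_zero_AE) (auto elim!: eventually_mono)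
    qed
    then show ?thesis by (simp add: U1_def[abs_def])
  qed
  have active: "U1 \<psi> i F = ifourier \<Lambda>"
  proof
    fix x
    have "A.\<Lambda>0 \<eta> * cnj (A.m \<eta>) * fourier (\<psi> i) \<eta> = A.\<Lambda>0 \<eta>" for \<eta>
    proof (cases "A.\<Lambda>0 \<eta> = 0")
      case False
      have "cnj (A.m \<eta>) * A.m \<eta> = complex_of_real ((norm (A.m \<eta>))\<^sup>2)"
        by (subst mult.commute) (rule complex_norm_square[symmetric])
      then show ?thesis using m1[OF False] by (simp add: A.m_def mult.assoc)
    qed simp
    then have "conv F (\<psi> i) x = ifourier A.\<Lambda>0 x" unfolding FA A.conv_F[OF \<psi>i] by (simp only:)
    then have "U1 \<psi> i F x = complex_of_real (norm (fourier \<Lambda> (- x)))" by (simp add: U1_def A.modulated_kernel(3))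
    also have "\<dots> = ifourier \<Lambda> x" unfolding ifourier_def by (rule A.bump_props(4)[symmetric])
    finally show "U1 \<psi> i F x = ifourier \<Lambda> x" .
  qed
  have second: "U1 \<psi> k (U1 \<psi> k' F) = (\<lambda>_. 0)" if k: "k \<in> Istar \<alpha> \<beta>" "k' \<in> Istar \<alpha> \<beta>" for k k'
  proof (cases "k' = i")
    case True
    have "\<Lambda> \<eta> * fourier (\<psi> k) \<eta> = 0" for \<eta>
      using fourier_\<psi>_low[OF k(1), of \<eta>] A.bump_props(5)[of \<eta>] s by fastforce
    then have "conv (ifourier \<Lambda>) (\<psi> k) x = 0" for x
      unfolding conv_ifourier[OF tameD(2)[OF A.bump_props(1)] filter_integrable[OF k(1)]]
      by (simp only: ifourier_def fourier_def[of "\<lambda>_. 0"]) simp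
    then show ?thesis unfolding True active by (simp add: U1_def[abs_def])
  next
    case False
    show ?thesis unfolding other[OF k(2) False] by (simp add: U1_def[abs_def] conv_zero_left)
  qed
  have ht: "tame (U1 \<psi> i F)" using tame_norm[OF conv_tame[OF F \<psi>i]] by (simp add: U1_def[abs_def])
  have n0: "l2_L2_norm (paths \<alpha> \<beta> 0) (\<lambda>p. U_path \<psi> p F) = 1"
    using l2_L2_norm_single[of "[]" "paths \<alpha> \<beta> 0" "\<lambda>p. U_path \<psi> p F"] F unit
    by (simp add: paths_def F_def)
  have n1: "l2_L2_norm (paths \<alpha> \<beta> 1) (\<lambda>p. U_path \<psi> p F) \<le> 1"
  proof -
    have "l2_L2_norm (paths \<alpha> \<beta> 1) (\<lambda>p. U_path \<psi> p F) = ennreal (sqrt (energy (U_path \<psi> [i] F)))"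
    proof (rule l2_L2_norm_single)
      show "[i] \<in> paths \<alpha> \<beta> 1" using i by (simp add: paths_def)
      show "tame (U_path \<psi> [i] F)" using ht by simp
      fix p assume p: "p \<in> paths \<alpha> \<beta> 1" "p \<noteq> [i]"
      then obtain k where k: "p = [k]" by (auto simp: paths_def length_Suc_conv)
      then have "k \<in> Istar \<alpha> \<beta>" "k \<noteq> i" using p by (auto simp: paths_def)
      with k show "U_path \<psi> p F = (\<lambda>_. 0)" using other by simp
    qed
    moreover have "energy (U_path \<psi> [i] F) \<le> energy F"
      using energy_conv_le[OF F \<psi>i le1(1)] energy_norm[of "conv F (\<psi> i)"] by (simp add: U1_def[abs_def])
    ultimately show ?thesis using unit by (simp add: F_def)
  qed
  have n2: "l2_L2_norm (paths \<alpha> \<beta> n) (\<lambda>p. U_path \<psi> p F) = 0" if "n \<notin> {0, 1}" for n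
  proof (rule l2_L2_norm_zero)
    fix p assume p: "p \<in> paths \<alpha> \<beta> n"
    obtain n' where "n = Suc (Suc n')" using \<open>n \<notin> {0, 1}\<close> by (metis One_nat_def insertCI not0_implies_Suc)
    then obtain k' k q where "p = k' # k # q" "k \<in> Istar \<alpha> \<beta>" "k' \<in> Istar \<alpha> \<beta>"
      using p by (auto simp: paths_def length_Suc_conv)
    then show "U_path \<psi> p F = (\<lambda>_. 0)" by (simp add: second U_path_zero)
  qed
  have "(\<Sum>n. l2_L2_norm (paths \<alpha> \<beta> n) (\<lambda>p. U_path \<psi> p F))
      = (\<Sum>n\<in>{0, 1}. l2_L2_norm (paths \<alpha> \<beta> n) (\<lambda>p. U_path \<psi> p F))"
    by (rule suminf_finite) (use n2 in auto)
  also have "\<dots> = l2_L2_norm (paths \<alpha> \<beta> 0) (\<lambda>p. U_path \<psi> p F) + l2_L2_norm (paths \<alpha> \<beta> 1) (\<lambda>p. U_path \<psi> p F)"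
    by simp
  also have "\<dots> \<le> 1 + 1" using n0 n1 by (intro add_mono) auto
  finally show ?thesis by simp
qed

end

section \<open>Families of unstable packets\<close>

lemma conv_scale_left: "conv (\<lambda>x. a * f x) k x = a * conv f k x"
  unfolding conv_def by (simp add: mult.assoc)

lemma packet_scale: "packet (\<lambda>\<eta>. a * \<Lambda> \<eta>) \<xi>0 \<psi>0 = (\<lambda>x. a * packet \<Lambda> \<xi>0 \<psi>0 x)"
proof -
  have "ifourier (\<lambda>\<eta>. a * \<Lambda> (\<eta> - \<xi>0)) = (\<lambda>x. a * ifourier (\<lambda>\<eta>. \<Lambda> (\<eta> - \<xi>0)) x)"
    by (simp add: fun_eq_iff ifourier_def fourier_scale)
  then show ?thesis unfolding packet_def by (simp only: conv_scale_left[abs_def])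
qed

lemma compact_fourier_supportI:
  assumes F: "tame F" and S: "\<And>\<eta>. fourier F \<eta> \<noteq> 0 \<Longrightarrow> \<eta> \<in> ball a r"
  shows "compact_fourier_support F"
  unfolding compact_fourier_support_def
proof (intro exI conjI)
  have "fourier F \<in> borel_measurable borel"
    by (intro borel_measurable_continuous_onI continuous_on_fourier tameD(2)[OF F])
  then have "L2 (fourier F)" using plancherel(1)[OF F] by (simp add: L2_def)
  moreover have "L2_norm (\<lambda>x. 0) = 0" by (simp add: L2_norm_def esqrt_def)
  ultimately show "is_L2_fourier F (fourier F)"
    unfolding is_L2_fourier_def using tame_L1_L2[OF F] by (intro conjI exI[of _ "\<lambda>_. F"]) auto
  have "{\<eta>. fourier F \<eta> \<noteq> 0} \<subseteq> cball a r" using S by fastforce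
  then have "supp (fourier F) \<subseteq> cball a r" unfolding supp_def by (rule closure_minimal) simp
  then show "compact (supp (fourier F))" unfolding supp_def
    by (meson bounded_cball bounded_subset closed_closure compact_eq_bounded_closed)
qed

lemma small_tail:
  fixes h :: "plane \<Rightarrow> real"
  assumes h: "integrable lborel h" and e: "0 < e"
  obtains R where "0 < R" "(LINT x|lborel. indicator {x. R / 2 \<le> norm x} x * h x) \<le> e"
proof -
  define S where "S = (\<lambda>n. {x::plane. real (Suc n) \<le> norm x})"
  have Sm [measurable]: "S n \<in> sets borel" for n unfolding S_def
    by (intro borel_closed closed_Collect_le continuous_intros)
  have [measurable]: "h \<in> borel_measurable borel" using h by auto
  have "(\<lambda>n. LINT x|lborel. indicator (S n) x * h x) \<longlonglongrightarrow> (LINT x::plane|lborel. 0)"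
  proof (rule integral_dominated_convergence[where w = "\<lambda>x. norm (h x)"])
    show "AE x in lborel. (\<lambda>n. indicator (S n) x * h x) \<longlonglongrightarrow> 0"
    proof (rule AE_I2)
      fix x :: plane
      obtain n0 where "norm x < real n0" using reals_Archimedean2 by blast
      then have "\<forall>\<^sub>F n in sequentially. indicator (S n) x * h x = 0"
        unfolding S_def by (intro eventually_sequentiallyI[of n0]) (auto simp: indicator_def)
      then show "(\<lambda>n. indicator (S n) x * h x) \<longlonglongrightarrow> 0" by (rule tendsto_eventually)
    qed
  qed (use h in \<open>auto simp: indicator_def\<close>)
  then have "(\<lambda>n. LINT x|lborel. indicator (S n) x * h x) \<longlonglongrightarrow> 0" by simp
  then have "\<forall>\<^sub>F n in sequentially. (LINT x|lborel. indicator (S n) x * h x) < e" using e by (rule order_tendstoD)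
  then obtain n where "(LINT x|lborel. indicator (S n) x * h x) < e"
    using eventually_happens' by fastforce
  then show ?thesis using that[of "2 * real (Suc n)"] unfolding S_def by (simp del: of_nat_Suc)
qed

context bank begin

text \<open>The choice of the parameters, in this order: the width \<open>s\<close> of the bump from the Lipschitz constant of the
multipliers, then the bump, then the radius \<open>R\<close> from the decay of its kernel, then the cut-off. None of
them depends on \<open>j\<close>; only the normalising factors \<open>a j\<close> do, and \<open>1 / c\<^sup>2\<close> bounds the energies of the normalised bumps.\<close>

lemma unstable_packets:
  assumes \<beta>: "\<beta> < 1"
    and sys: "active_core_system \<alpha> \<beta> \<epsilon> j0 r0 \<iota> \<xi> M"
    and c: "0 < c" and bound: "active_core_bound \<psi> j0 r0 \<iota> \<xi> c"
    and reg: "active_core_regular \<psi> j0 r0 \<iota> \<xi>"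
  obtains s \<Lambda> \<tau> where "s \<le> r0" "s \<le> 15 / 16"
    "\<And>j. j \<ge> j0 \<Longrightarrow> bump s (\<Lambda> j)"
    "\<And>j. j \<ge> j0 \<Longrightarrow> energy (packet (\<Lambda> j) (\<xi> j) (\<psi> (\<iota> j))) = 1"
    "unstable_family \<alpha> \<beta> chi \<psi> j0 (\<lambda>j. packet (\<Lambda> j) (\<xi> j) (\<psi> (\<iota> j))) \<tau>"
proof -
  have r0: "0 < r0"
    and \<iota>: "\<And>j. j \<ge> j0 \<Longrightarrow> \<iota> j \<in> Istar \<alpha> \<beta>"
    and ballQ: "\<And>j. j \<ge> j0 \<Longrightarrow> ball (\<xi> j) r0 \<subseteq> Qtile \<alpha> \<beta> \<epsilon> (Some (\<iota> j))"
    and away: "\<And>j \<rho> i. j \<ge> j0 \<Longrightarrow> 0 < \<rho> \<Longrightarrow> \<rho> \<le> r0 \<Longrightarrow> i \<in> Ifull \<alpha> \<beta> \<Longrightarrow> Qtile \<alpha> \<beta> \<epsilon> i \<inter> ball (\<xi> j) \<rho> \<noteq> {} \<Longrightarrow>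
           Qtile \<alpha> \<beta> \<epsilon> i \<inter> (\<lambda>x. (mat 1 - M j) *v x) ` ball (\<xi> j) \<rho> = {}"
    using sys unfolding active_core_system_def by (blast, blast, blast, blast)
  define q where "q = (\<lambda>j::nat. 2 powr (- (1 - \<beta>) * real j))"
  obtain a' b where a': "0 < a'" and ab: "\<And>j. j \<ge> j0 \<Longrightarrow> a' * q j \<le> onorm ((*v) (M j)) \<and> onorm ((*v) (M j)) \<le> b * q j"
    using sys unfolding active_core_system_def q_def by metis
  have q0: "0 < q j" for j by (simp add: q_def)
  have b: "0 < b"
  proof -
    have "a' * q j0 \<le> b * q j0" using ab[of j0] by linarith
    then show ?thesis using a' q0[of j0] by (simp add: mult_le_cancel_right)
  qed
  have q_lim: "q \<longlonglongrightarrow> 0"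
  proof -
    have "q = (\<lambda>j. (2 powr (- (1 - \<beta>))) ^ j)"
      unfolding q_def by (simp add: fun_eq_iff powr_realpow[symmetric] powr_powr)
    moreover have "2 powr (- (1 - \<beta>)) < 2 powr 0" using \<beta> by (intro powr_less_mono) auto
    ultimately show ?thesis by (simp add: LIMSEQ_realpow_zero)
  qed
  obtain C0 where C0: "\<And>j. j \<ge> j0 \<Longrightarrow> \<exists>G. weak_gradient (ball (\<xi> j) r0) (fourier (\<psi> (\<iota> j))) G \<and>
        Linf_norm (restrict_space lborel (ball (\<xi> j) r0)) G \<le> ennreal C0"
    using reg unfolding active_core_regular_def by blast
  define C where "C = max C0 0"
  have C: "0 \<le> C" by (simp add: C_def)
  have lip: "norm (fourier (\<psi> (\<iota> j)) \<eta> - fourier (\<psi> (\<iota> j)) (\<xi> j)) \<le> 2 * C * norm (\<eta> - \<xi> j)"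
    if j: "j \<ge> j0" and \<eta>: "\<eta> \<in> ball (\<xi> j) r0" for j \<eta>
  proof -
    obtain G where G: "weak_gradient (ball (\<xi> j) r0) (fourier (\<psi> (\<iota> j))) G"
      "Linf_norm (restrict_space lborel (ball (\<xi> j) r0)) G \<le> ennreal C0" using C0[OF j] by blast
    have "Linf_norm (restrict_space lborel (ball (\<xi> j) r0)) G \<le> ennreal C"
      by (rule order_trans[OF G(2)]) (simp add: C_def ennreal_leI)
    from lipschitz_of_weak_gradient[OF continuous_on_fourier[OF filter_integrable[OF \<iota>[OF j]]] G(1) this C \<eta>]
    show ?thesis .
  qed
  \<comment> \<open>With this width the multiplier oscillates by at most \<open>\<kappa> \<le> c ^ 3 / 16\<close> on the bump, and the two terms of \<open>tail_energy\<close>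
    can each be made at most \<open>c ^ 4 / 128\<close>.\<close>
  define s where "s = min (min r0 (15 / 16)) (c ^ 3 / (32 * (C + 1)))"
  have s: "0 < s" "s \<le> r0" "s \<le> 15 / 16" "s \<le> c ^ 3 / (32 * (C + 1))"
  proof -
    have "0 < c ^ 3 / (32 * (C + 1))" using c C by simp
    then show "0 < s" using r0 by (simp add: s_def)
    show "s \<le> r0" "s \<le> 15 / 16" "s \<le> c ^ 3 / (32 * (C + 1))" unfolding s_def by linarith+
  qed
  define \<kappa> where "\<kappa> = 2 * C * s"
  have \<kappa>: "0 \<le> \<kappa>" "\<kappa> \<le> c ^ 3 / 16"
  proof -
    show "0 \<le> \<kappa>" using C s(1) by (simp add: \<kappa>_def)
    have "\<kappa> \<le> 2 * C * (c ^ 3 / (32 * (C + 1)))" unfolding \<kappa>_def using C s(4) by (intro mult_left_mono) auto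
    also have "\<dots> = c ^ 3 / 16 * (C / (C + 1))" using C by (simp add: divide_simps)
    also have "\<dots> \<le> c ^ 3 / 16" using C c by (intro mult_left_le) auto
    finally show "\<kappa> \<le> c ^ 3 / 16" .
  qed
  have \<kappa>2: "\<kappa>\<^sup>2 \<le> c ^ 6 / 256"
    using power_mono[OF \<kappa>(2,1), of 2] by (simp add: power_divide flip: power_mult)
  obtain \<Lambda> where \<Lambda>: "bump s \<Lambda>" "0 < energy \<Lambda>" using bump_exists[OF s(1)] by blast
  have \<Lambda>t: "tame \<Lambda>" using \<Lambda>(1) by (simp add: bump_def)
  have core: "c \<le> norm (fourier (\<psi> (\<iota> j)) \<eta>)" if "j \<ge> j0" "\<eta> \<in> ball (\<xi> j) s" for j \<eta>
    using bound that s(2) unfolding active_core_bound_def by auto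
  define a where "a = (\<lambda>j. 1 / sqrt (energy (packet \<Lambda> (\<xi> j) (\<psi> (\<iota> j)))))"
  define \<Lambda>j where "\<Lambda>j = (\<lambda>j \<eta>. complex_of_real (a j) * \<Lambda> \<eta>)"
  have big: "c\<^sup>2 * energy \<Lambda> \<le> energy (packet \<Lambda> (\<xi> j) (\<psi> (\<iota> j)))" if j: "j \<ge> j0" for j
  proof -
    interpret A: active_filter \<Lambda> s "\<xi> j" "\<psi> (\<iota> j)" by unfold_locales (use \<Lambda> filter_integrable[OF \<iota>[OF j]] in auto)
    show ?thesis using A.energy_F_ge[of c] core[OF j] c unfolding A.F_def A.m_def by simp
  qed
  have pos: "0 < energy (packet \<Lambda> (\<xi> j) (\<psi> (\<iota> j)))" if j: "j \<ge> j0" for j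
    using big[OF j] c \<Lambda>(2) by (meson less_le_trans mult_pos_pos zero_less_power)
  have a: "(a j)\<^sup>2 * energy \<Lambda> \<le> 1 / c\<^sup>2" "0 \<le> a j" "(a j)\<^sup>2 = 1 / energy (packet \<Lambda> (\<xi> j) (\<psi> (\<iota> j)))"
    if j: "j \<ge> j0" for j
  proof -
    show e: "(a j)\<^sup>2 = 1 / energy (packet \<Lambda> (\<xi> j) (\<psi> (\<iota> j)))"
      using pos[OF j] by (simp add: a_def power_divide)
    show "0 \<le> a j" using pos[OF j] by (simp add: a_def)
    show "(a j)\<^sup>2 * energy \<Lambda> \<le> 1 / c\<^sup>2" unfolding e using big[OF j] pos[OF j] c
      by (simp add: field_simps)
  qed
  have bumpj: "bump s (\<Lambda>j j)" if "j \<ge> j0" for j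
    unfolding \<Lambda>j_def by (rule bump_scale[OF \<Lambda>(1) a(2)[OF that]])
  have unit: "energy (packet (\<Lambda>j j) (\<xi> j) (\<psi> (\<iota> j))) = 1" if "j \<ge> j0" for j
    unfolding \<Lambda>j_def packet_scale energy_scale using a(3)[OF that] pos[OF that] by simp
  have fi: "integrable lborel (\<lambda>x. (norm (fourier \<Lambda> (- x)))\<^sup>2)"
    using plane_integrable_shift(3)[OF plancherel(1)[OF \<Lambda>t]] .
  obtain R where R: "0 < R" "(LINT x|lborel. indicator {x. R / 2 \<le> norm x} x * (norm (fourier \<Lambda> (- x)))\<^sup>2) \<le> c ^ 6 * energy \<Lambda> / 256"
    using small_tail[OF fi, of "c ^ 6 * energy \<Lambda> / 256"] c \<Lambda>(2) by auto
  have tail: "2 * (LINT x|lborel. indicator {x. R / 2 \<le> norm x} x * (norm (fourier (\<Lambda>j j) (- x)))\<^sup>2)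
        + 2 * (\<kappa>\<^sup>2 * energy (\<Lambda>j j)) \<le> c ^ 4 / 64" if j: "j \<ge> j0" for j
  proof -
    have e: "energy (\<Lambda>j j) = (a j)\<^sup>2 * energy \<Lambda>" unfolding \<Lambda>j_def energy_scale by simp
    have "indicator {x. R / 2 \<le> norm x} x * (norm (fourier (\<Lambda>j j) (- x)))\<^sup>2
        = (a j)\<^sup>2 * (indicator {x. R / 2 \<le> norm x} x * (norm (fourier \<Lambda> (- x)))\<^sup>2)" for x :: plane
      unfolding \<Lambda>j_def fourier_scale by (simp add: norm_mult power_mult_distrib)
    then have "(LINT x|lborel. indicator {x. R / 2 \<le> norm x} x * (norm (fourier (\<Lambda>j j) (- x)))\<^sup>2)
       = (a j)\<^sup>2 * (LINT x|lborel. indicator {x. R / 2 \<le> norm x} x * (norm (fourier \<Lambda> (- x)))\<^sup>2)"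
      by (simp only: integral_mult_right_zero)
    also have "\<dots> \<le> (a j)\<^sup>2 * (c ^ 6 * energy \<Lambda> / 256)" by (rule mult_left_mono[OF R(2)]) simp
    also have "\<dots> = ((a j)\<^sup>2 * energy \<Lambda>) * (c ^ 6 / 256)" by simp
    also have "\<dots> \<le> 1 / c\<^sup>2 * (c ^ 6 / 256)" by (rule mult_right_mono[OF a(1)[OF j]]) (use c in simp)
    also have "\<dots> = c ^ 4 / 256" using c by (simp add: field_simps flip: power_add)
    finally have t1: "(LINT x|lborel. indicator {x. R / 2 \<le> norm x} x * (norm (fourier (\<Lambda>j j) (- x)))\<^sup>2) \<le> c ^ 4 / 256" .
    have "\<kappa>\<^sup>2 * energy (\<Lambda>j j) \<le> (c ^ 6 / 256) * (1 / c\<^sup>2)"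
      unfolding e using \<kappa>2 a(1)[OF j] energy_nonneg[of \<Lambda>] c by (intro mult_mono) auto
    also have "\<dots> = c ^ 4 / 256" using c by (simp add: field_simps flip: power_add)
    finally show ?thesis using t1 c by simp
  qed
  obtain T :: "real ^ 2 ^ 2 \<Rightarrow> plane \<Rightarrow> plane" where T: "\<And>N. Cc_infinity (T N)"
    "\<And>N x. norm x \<le> R \<Longrightarrow> T N x = N *v x"
    "\<And>m. \<exists>C\<ge>0. \<forall>N s. (\<forall>k l. \<bar>N $ k $ l\<bar> \<le> s) \<longrightarrow> Cm_norm m (T N) \<le> ennreal (C * s)"
    "\<exists>K\<ge>0. \<forall>N s x. (\<forall>k l. \<bar>N $ k $ l\<bar> \<le> s) \<longrightarrow>
       (\<exists>D. (T N has_derivative D) (at x) \<and> (\<forall>k l. \<bar>D (axis l 1) $ k\<bar> \<le> K * s))"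
    using cut_off_linear_field[OF R(1)] by blast
  obtain Cm where Cm: "\<And>m N s. (\<forall>k l. \<bar>N $ k $ l\<bar> \<le> s) \<Longrightarrow> Cm_norm m (T N) \<le> ennreal (Cm m * s)"
    using T(3) by metis
  obtain K where K: "K \<ge> 0" "\<And>N s x. (\<forall>k l. \<bar>N $ k $ l\<bar> \<le> s) \<Longrightarrow>
       (\<exists>D. (T N has_derivative D) (at x) \<and> (\<forall>k l. \<bar>D (axis l 1) $ k\<bar> \<le> K * s))"
    using T(4) by blast
  define \<tau> where "\<tau> = (\<lambda>j. T (transpose (M j)))"
  have entries: "\<forall>k l. \<bar>transpose (M j) $ k $ l\<bar> \<le> b * q j" if "j \<ge> j0" for j
    using matrix_component_le_onorm[of "M j"] ab[OF that] by (auto simp: transpose_def intro: order_trans)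
  have "(\<lambda>j. (K * b + b) * q j) \<longlonglongrightarrow> (K * b + b) * 0" by (intro tendsto_intros q_lim)
  then have "\<forall>\<^sub>F j in sequentially. (K * b + b) * q j < 1 / 8" by (rule order_tendstoD) simp
  then have ev: "\<forall>\<^sub>F j in sequentially. (K * b + b) * q j < 1 / 8 \<and> j \<ge> j0"
    using eventually_ge_at_top eventually_conj by blast
  let ?ok = "\<lambda>j. (\<forall>m. Cm_norm m (\<tau> j) \<le> ennreal ((Cm m * b) * 2 powr (- (1 - \<beta>) * real j))) \<and>
      ennreal (sqrt (c ^ 4 / 8)) \<le> l2_L2_norm (Istar \<alpha> \<beta>)
        (\<lambda>i x. S1 chi \<psi> (deform (\<tau> j) (packet (\<Lambda>j j) (\<xi> j) (\<psi> (\<iota> j)))) i x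
           - S1 chi \<psi> (packet (\<Lambda>j j) (\<xi> j) (\<psi> (\<iota> j))) i x) \<and>
      ennreal (sqrt (c ^ 4 / 8)) \<le> l2_L2_norm (Ifull \<alpha> \<beta>)
        (W_commutator chi \<psi> (\<tau> j) (packet (\<Lambda>j j) (\<xi> j) (\<psi> (\<iota> j))))"
  \<comment> \<open>For small \<open>q j\<close> both the cut-off field and the linear field are admissible for \<^locale>\<open>near_identity\<close>.\<close>
  have step: "?ok j"
    if jj: "(K * b + b) * q j < 1 / 8 \<and> j \<ge> j0" for j
  proof -
    have j: "j \<ge> j0" using jj by blast
    have sm: "K * (b * q j) \<le> 1 / 8" "b * q j \<le> 1 / 8"
    proof -
      have "0 \<le> b * q j" using b q0[of j] by simp
      moreover from this have "0 \<le> K * (b * q j)" by (rule mult_nonneg_nonneg[OF K(1)])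
      moreover have "(K * b + b) * q j = K * (b * q j) + b * q j" by (simp add: algebra_simps)
      ultimately show "K * (b * q j) \<le> 1 / 8" "b * q j \<le> 1 / 8" using jj by linarith+
    qed
    obtain D where D: "\<And>x. (\<tau> j has_derivative D x) (at x)" "\<And>x k l. \<bar>D x (axis l 1) $ k\<bar> \<le> K * (b * q j)"
      using K(2)[OF entries[OF j]] unfolding \<tau>_def by metis
    have near: "near_identity (\<tau> j) D"
    proof
      show "\<tau> j 0 = 0" using T(2)[of 0] R(1) by (simp add: \<tau>_def del: transpose_matrix_vector)
    qed (use D sm order_trans in blast)+
    have nearN: "near_identity (\<lambda>x. transpose (M j) *v x) (\<lambda>_ h. transpose (M j) *v h)"
    proof
      show "((\<lambda>x. transpose (M j) *v x) has_derivative (\<lambda>h. transpose (M j) *v h)) (at x)" for x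
        by (rule bounded_linear_imp_has_derivative) (rule matrix_vector_mul_bounded_linear)
      have "(transpose (M j) *v axis l 1) $ k = transpose (M j) $ k $ l" for k l
        by (simp add: matrix_vector_mul_component cart_eq_inner_axis[symmetric] del: transpose_matrix_vector)
      then show "\<bar>(transpose (M j) *v axis l 1) $ k\<bar> \<le> 1 / 8" for k l
        using entries[OF j] sm(2) order_trans by metis
    qed (simp del: transpose_matrix_vector)
    have kill: "fourier (\<psi> (\<iota> j)) ((mat 1 - M j) *v \<eta>) = 0" if "\<eta> \<in> ball (\<xi> j) s" for \<eta>
    proof -
      have "\<xi> j \<in> Qtile \<alpha> \<beta> \<epsilon> (Some (\<iota> j)) \<inter> ball (\<xi> j) s" using ballQ[OF j] r0 s(1) by auto
      then have "Qtile \<alpha> \<beta> \<epsilon> (Some (\<iota> j)) \<inter> (\<lambda>x. (mat 1 - M j) *v x) ` ball (\<xi> j) s = {}"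
        using \<iota>[OF j] by (intro away[OF j s(1,2)]) (auto simp: Ifull_def)
      then have "(mat 1 - M j) *v \<eta> \<notin> Qtile \<alpha> \<beta> \<epsilon> (Some (\<iota> j))" using that by blast
      then show ?thesis using fourier_\<psi>_support[OF \<iota>[OF j]] by blast
    qed
    have kap: "norm (fourier (\<psi> (\<iota> j)) \<eta> - fourier (\<psi> (\<iota> j)) (\<xi> j)) \<le> \<kappa>" if "\<eta> \<in> ball (\<xi> j) s" for \<eta>
    proof -
      have "norm (fourier (\<psi> (\<iota> j)) \<eta> - fourier (\<psi> (\<iota> j)) (\<xi> j)) \<le> 2 * C * norm (\<eta> - \<xi> j)"
        using that s(2) by (intro lip[OF j]) auto
      also have "\<dots> \<le> \<kappa>" unfolding \<kappa>_def using that C by (intro mult_left_mono) (auto simp: dist_norm norm_minus_commute)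
      finally show ?thesis .
    qed
    have agree: "\<tau> j x = transpose (M j) *v x" if "norm x \<le> R" for x
      unfolding \<tau>_def by (rule T(2)[OF that])
    note I = deformed_packet_lower_bounds[OF \<iota>[OF j] bumpj[OF j] s(3) c core[OF j] kill \<kappa>(1) kap unit[OF j] tail[OF j] near nearN R(1) agree]
    have "Cm_norm m (\<tau> j) \<le> ennreal ((Cm m * b) * 2 powr (- (1 - \<beta>) * real j))" for m
      using Cm[OF entries[OF j], of m] by (simp add: \<tau>_def q_def mult.assoc)
    then show ?thesis using I by blast
  qed
  have "unstable_family \<alpha> \<beta> chi \<psi> j0 (\<lambda>j. packet (\<Lambda>j j) (\<xi> j) (\<psi> (\<iota> j))) \<tau>"
    unfolding unstable_family_def
  proof (intro conjI allI impI exI[of _ "sqrt (c ^ 4 / 8)"] exI[of _ "\<lambda>m. Cm m * b"])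
    fix j assume j: "j \<ge> j0"
    interpret A: active_filter "\<Lambda>j j" s "\<xi> j" "\<psi> (\<iota> j)" by unfold_locales (use bumpj[OF j] filter_integrable[OF \<iota>[OF j]] in auto)
    show "L2 (packet (\<Lambda>j j) (\<xi> j) (\<psi> (\<iota> j)))" using tame_L1_L2[OF A.F_tame] by (simp add: A.F_def)
    show "compact_fourier_support (packet (\<Lambda>j j) (\<xi> j) (\<psi> (\<iota> j)))"
      unfolding A.F_def[symmetric]
      by (rule compact_fourier_supportI[OF A.F_tame, of "\<xi> j" s]) (use A.shifted_bump(3) in \<open>auto simp: A.fourier_F\<close>)
    show "L2_norm (packet (\<Lambda>j j) (\<xi> j) (\<psi> (\<iota> j))) = 1"
      using L2_norm_eq[OF A.F_tame] unit[OF j] by (simp add: A.F_def)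
    show "Cc_infinity (\<tau> j)" unfolding \<tau>_def by (rule T(1))
  next
    show "0 < sqrt (c ^ 4 / 8)" using c by simp
    show "\<forall>\<^sub>F j in sequentially. ?ok j" using ev by (rule eventually_mono) (rule step)
  qed
  then show ?thesis using that[OF s(2,3)] bumpj unit by blast
qed

end

theorem theorem5p12:
  fixes \<alpha> \<beta> \<epsilon> r0 c_act :: real
    and chi :: "plane \<Rightarrow> complex" and \<psi> :: "idx \<Rightarrow> plane \<Rightarrow> complex"
    and j0 :: nat and \<iota> :: "nat \<Rightarrow> idx" and \<xi> :: "nat \<Rightarrow> plane" and M :: "nat \<Rightarrow> real ^ 2 ^ 2"
  assumes "0 \<le> \<beta>" "\<beta> \<le> \<alpha>" "\<alpha> \<le> 1" "\<beta> < 1"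
    and "0 < \<epsilon>" "\<epsilon> < 1 / 32"
    and "wave_packet_bank \<alpha> \<beta> \<epsilon> chi \<psi>"
    and "active_core_system \<alpha> \<beta> \<epsilon> j0 r0 \<iota> \<xi> M"
    and "0 < c_act" "active_core_bound \<psi> j0 r0 \<iota> \<xi> c_act"
    and "active_core_regular \<psi> j0 r0 \<iota> \<xi>"
  shows "(\<exists>f \<tau>. unstable_family \<alpha> \<beta> chi \<psi> j0 f \<tau>) \<and>
    (\<forall>j1 r1 \<iota>' \<xi>' M'.
       active_core_system \<alpha> \<beta> \<epsilon> j1 r1 \<iota>' \<xi>' M' \<and>
       active_core_bound \<psi> j1 r1 \<iota>' \<xi>' 1 \<and>
       active_core_regular \<psi> j1 r1 \<iota>' \<xi>' \<longrightarrow>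
       (\<exists>f \<tau>. unstable_family \<alpha> \<beta> chi \<psi> j1 f \<tau> \<and>
          (SUP j\<in>{j1..}. \<Sum>n. l2_L2_norm (paths \<alpha> \<beta> n) (\<lambda>p. U_path \<psi> p (f j))) < \<infinity>))"
proof -
  interpret bank \<alpha> \<beta> \<epsilon> chi \<psi> by unfold_locales fact+
  show ?thesis
  proof (intro conjI allI impI)
    show "\<exists>f \<tau>. unstable_family \<alpha> \<beta> chi \<psi> j0 f \<tau>"
      by (rule unstable_packets[OF assms(4,8-11)]) blast
    fix j1 r1 \<iota>' \<xi>' M'
    assume a: "active_core_system \<alpha> \<beta> \<epsilon> j1 r1 \<iota>' \<xi>' M' \<and> active_core_bound \<psi> j1 r1 \<iota>' \<xi>' 1 \<and>
       active_core_regular \<psi> j1 r1 \<iota>' \<xi>'"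
    then have sys: "active_core_system \<alpha> \<beta> \<epsilon> j1 r1 \<iota>' \<xi>' M'" and bd: "active_core_bound \<psi> j1 r1 \<iota>' \<xi>' 1"
      and reg: "active_core_regular \<psi> j1 r1 \<iota>' \<xi>'" by auto
    obtain s \<Lambda> \<tau> where s: "s \<le> r1" "s \<le> 15 / 16"
      and b: "\<And>j. j \<ge> j1 \<Longrightarrow> bump s (\<Lambda> j)"
      and u: "\<And>j. j \<ge> j1 \<Longrightarrow> energy (packet (\<Lambda> j) (\<xi>' j) (\<psi> (\<iota>' j))) = 1"
      and f: "unstable_family \<alpha> \<beta> chi \<psi> j1 (\<lambda>j. packet (\<Lambda> j) (\<xi>' j) (\<psi> (\<iota>' j))) \<tau>"
      using unstable_packets[OF assms(4) sys zero_less_one bd reg] by blast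
    have "(\<Sum>n. l2_L2_norm (paths \<alpha> \<beta> n) (\<lambda>p. U_path \<psi> p (packet (\<Lambda> j) (\<xi>' j) (\<psi> (\<iota>' j))))) \<le> 2"
      if j: "j \<in> {j1..}" for j
    proof (rule mixed_norm_le[OF _ b s(2) _ u])
      show "\<iota>' j \<in> Istar \<alpha> \<beta>" using sys j unfolding active_core_system_def by auto
      show "1 \<le> norm (fourier (\<psi> (\<iota>' j)) \<eta>)" if "\<eta> \<in> ball (\<xi>' j) s" for \<eta>
        using bd j that s(1) unfolding active_core_bound_def by auto
    qed (use j in auto)
    then have "(SUP j\<in>{j1..}. \<Sum>n. l2_L2_norm (paths \<alpha> \<beta> n) (\<lambda>p. U_path \<psi> p (packet (\<Lambda> j) (\<xi>' j) (\<psi> (\<iota>' j))))) \<le> 2"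
      by (rule SUP_least)
    also have "(2::ennreal) < \<infinity>" by simp
    finally show "\<exists>f \<tau>. unstable_family \<alpha> \<beta> chi \<psi> j1 f \<tau> \<and>
          (SUP j\<in>{j1..}. \<Sum>n. l2_L2_norm (paths \<alpha> \<beta> n) (\<lambda>p. U_path \<psi> p (f j))) < \<infinity>"
      using f by blast
  qed
qed

end
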